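(* Let $n\ge 2$ be an integer, let $D>0$ and $\tilde\beta>0$, and let $a_0,a_n,u_0,k\in\mathbb{R}$. Consider the reaction–convection–diffusion equation $$\frac{\partial u}{\partial t}+(a_0+a_nu^n)\frac{\partial u}{\partial x}=D\frac{\partial^2u}{\partial x^2}+\tilde\beta\, u(u-u_0)(k-u).$$ Then this equation has at most one isolated periodic (traveling) wave solution, in the sense explained in the context, in each of the following cases: (i) $0<u_0<k\le 2u_0$, for all integers $n\ge 2$; (ii) $-k<u_0<0$, for all integers $n\ge 2$; (iii) $k>0$ and $u_0<-k$, for all integers $n\ge 2$; (iv) $k>0$ and $u_0=-k$, for all even positive integers $n$.
   Context: Traveling waves $u(x,t)=u(\eta)$, $\eta=x-ct$ ($c$ the wave speed) satisfy $D u''=(-c+a_0+a_nu^n)u'-\tilde\beta u(u-u_0)(k-u)$. Set $\beta=\tilde\beta/D>0$ and write $\frac{a_0-c}{D}=\alpha_0\epsilon$, $\frac{a_n}{D}=\alpha_n\epsilon$ with $0<\epsilon\ll 1$ and real parameters $\alpha_0,\alpha_n$. This gives the planar system $$\frac{du}{d\eta}=y,\qquad \frac{dy}{d\eta}=\epsilon(\alpha_0+\alpha_nu^n)y-\beta u(u-u_0)(k-u),$$ whose $\epsilon=0$ version is the Hamiltonian system with $H(u,y)=\frac{y^2}{2}+\beta\left(-\frac{u^4}{4}+\frac{k+u_0}{3}u^3-\frac{ku_0}{2}u^2\right)$. In each case listed, the unperturbed system has a center (at $(u_0,0)$ in case (i), at $(0,0)$ in cases (ii)–(iv)) surrounded by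 a periodic annulus $\{\Gamma_h: H(u,y)=h,\ h\in(h_1,h_2)\}$ of closed level curves, where $(h_1,h_2)$ is maximal. An isolated periodic wave solution of the PDE corresponds to a limit cycle of the perturbed system; the claim "at most one isolated periodic wave solution" means that, for $\epsilon>0$ sufficiently small, at most one limit cycle of the perturbed system bifurcates from this periodic annulus. *)

theory Defs
  imports "HOL-Analysis.Analysis"
begin

text \<open>Hamiltonian of the unperturbed system, points are (u,y).\<close>
definition Ham :: "real \<Rightarrow> real \<Rightarrow> real \<Rightarrow> real \<times> real \<Rightarrow> real" where
  "Ham \<beta> u0 k p = (snd p)^2 / 2
     + \<beta> * (0 - (fst p)^4 / 4 + (k + u0) / 3 * (fst p)^3 - k * u0 / 2 * (fst p)^2)"

definition vf :: "nat \<Rightarrow> real \<Rightarrow> real \<Rightarrow> real \<Rightarrow> real \<Rightarrow> real \<Rightarrow> real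
                   \<Rightarrow> real \<times> real \<Rightarrow> real \<times> real" where
  "vf n \<alpha>0 \<alpha>n \<beta> u0 k \<epsilon> p =
     (snd p, \<epsilon> * (\<alpha>0 + \<alpha>n * (fst p)^n) * snd p - \<beta> * fst p * (fst p - u0) * (k - fst p))"

definition is_solution :: "(real \<times> real \<Rightarrow> real \<times> real) \<Rightarrow> (real \<Rightarrow> real \<times> real) \<Rightarrow> bool" where
  "is_solution f x \<longleftrightarrow> (\<forall>t. (x has_vector_derivative f (x t)) (at t))"

definition periodic_orbit :: "(real \<times> real \<Rightarrow> real \<times> real) \<Rightarrow> (real \<times> real) set \<Rightarrow> bool" where
  "periodic_orbit f \<Gamma> \<longleftrightarrow>
     (\<exists>x T. is_solution f x \<and> T > 0 \<and> (\<forall>t. x (t + T) = x t) \<and> (\<exists>s t. x s \<noteq> x t)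
            \<and> \<Gamma> = range x)"

definition limit_cycle :: "(real \<times> real \<Rightarrow> real \<times> real) \<Rightarrow> (real \<times> real) set \<Rightarrow> bool" where
  "limit_cycle f \<Gamma> \<longleftrightarrow> periodic_orbit f \<Gamma> \<and>
     (\<exists>U. open U \<and> \<Gamma> \<subseteq> U \<and> (\<forall>\<Gamma>'. periodic_orbit f \<Gamma>' \<and> \<Gamma>' \<subseteq> U \<longrightarrow> \<Gamma>' = \<Gamma>))"

text \<open>Upper end h2 of the maximal period annulus around the center c (h1 = H c):
  the supremum of levels h > H c such that the component of {H < h} containing c is
  bounded and its closure contains no equilibrium of the unperturbed field f0 except c.\<close>
definition annulus_top :: "(real \<times> real \<Rightarrow> real) \<Rightarrow> (real \<times> real \<Rightarrow> real \<times> real)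
                           \<Rightarrow> real \<times> real \<Rightarrow> real" where
  "annulus_top H f0 c = Sup {h. H c < h \<and> bounded (connected_component_set {p. H p < h} c)
       \<and> (\<forall>p \<in> closure (connected_component_set {p. H p < h} c). f0 p = 0 \<longrightarrow> p = c)}"

text \<open>The (open) period annulus: union of the ovals Gamma_h, h in (h1,h2).\<close>
definition annulus :: "(real \<times> real \<Rightarrow> real) \<Rightarrow> (real \<times> real \<Rightarrow> real \<times> real)
                           \<Rightarrow> real \<times> real \<Rightarrow> (real \<times> real) set" where
  "annulus H f0 c = connected_component_set {p. H p < annulus_top H f0 c} c - {c}"

definition at_most_one_lc_from :: "(real \<Rightarrow> real \<times> real \<Rightarrow> real \<times> real) \<Rightarrow> (real \<times> real) set \<Rightarrow> bool" where
  "at_most_one_lc_from F A \<longleftrightarrow>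
     (\<forall>K. compact K \<and> K \<subseteq> A \<longrightarrow>
        (\<exists>\<epsilon>0>0. \<forall>\<epsilon>. 0 < \<epsilon> \<and> \<epsilon> < \<epsilon>0 \<longrightarrow>
           (\<forall>L1 L2. limit_cycle (F \<epsilon>) L1 \<and> L1 \<subseteq> K \<and> limit_cycle (F \<epsilon>) L2 \<and> L2 \<subseteq> K
                     \<longrightarrow> L1 = L2)))"

definition at_most_one_periodic_wave ::
  "nat \<Rightarrow> real \<Rightarrow> real \<Rightarrow> real \<Rightarrow> real \<Rightarrow> real \<Rightarrow> real \<times> real \<Rightarrow> bool" where
  "at_most_one_periodic_wave n \<alpha>0 \<alpha>n \<beta> u0 k c \<longleftrightarrow>
     at_most_one_lc_from (\<lambda>\<epsilon>. vf n \<alpha>0 \<alpha>n \<beta> u0 k \<epsilon>)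
        (annulus (Ham \<beta> u0 k) (vf n \<alpha>0 \<alpha>n \<beta> u0 k 0) c)"

end

theory Submission
  imports Defs
begin

text \<open>
  In each case an affine change of variables turns the system into
  $x' = y$, $y' = \epsilon f(x) y - V'(x)$ with $V'(x) = \beta x (x + b)(k - x)$, $0 < b \le k$.
  Put $\zeta(x) = \pm\sqrt{2 V(x)}$ and $\gamma = \zeta'$. In the polar coordinates $\zeta(x) = r\cos\theta$,
  $y = -r\sin\theta$ periodic orbits become $2\pi$-periodic solutions of a scalar equation
  $r' = \epsilon N(r, \theta, \epsilon)$. Two of them, $R < S$, satisfy
  $\int_0^{2\pi} (N(S) - N(R)) / (S - R)\, d\theta = 0$, because the integrand is
  $(\ln (S - R))' / \epsilon$. For small $\epsilon$ both are close to a zero of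
  $M(r) = \int_0^{2\pi} N(r, \theta, 0)\, d\theta$, and the integral is close to $M'$ there, so it
  suffices that $M$ has at most one zero and that this zero is simple.

  With $\phi = f / \gamma$ as a function of $z = \zeta(x)$, $M(r) = r\int \phi(r\cos\theta)\sin^2\theta\,d\theta$ and
  $M'(r) = \int \phi(r\cos\theta)\cos^2\theta\,d\theta$ at every $r$ (by parts). If the even part of $\phi$
  changes sign at most once on $z > 0$, comparing $\sin^2$ with $\cos^2$ shows that $M'$ has a fixed sign at
  the zeros of $M$. At two points $-w < 0 < a$ of equal potential the even part of $\phi$ is
  proportional to $f(a) + t f(-w)$ with $t = V'(a) / |V'(-w)|$, so the sign condition follows from
  monotonicity of the mean of $u^n$ with weights $1 : t$; here $w - a$, $w / a$ and hence $t \ge 1$ increase with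
  the energy. If $f = 0$, all nearby level curves are periodic orbits and there is no limit cycle.
\<close>

section \<open>Periodic solutions of a scalar periodic equation\<close>

text \<open>The claim concerns compact subsets of the annulus, so all radii lie in some [a, b]
  inside (0, Z) and the bound on \<epsilon> may depend on that interval; no expansion at the center
  or at the outer boundary is needed. The normalization b \<le> k puts the saddle of lower energy at
  -b. The level interval then reaches at least as far to the left as to the right, and its left end
  has at least half of the weight: both effects work in the same direction, and the power n enters
  only through monotonicity, convexity and parity. In case (i) the normalization is the condition k
  \<le> 2 u_0, after the reflection x = u_0 - u. The power is then centered at the saddle u = 0
  instead of the center, which takes an inequality of its own. For b = k the interval is symmetric
  with equal weights and an odd power averages to 0. With \<alpha>0 = 0 this makes M vanish
  identically, so first order decides nothing; hence the restriction to even n in case (iv).\<close>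

lemma integral_freeze:
  fixes h :: "real \<Rightarrow> real \<Rightarrow> real \<Rightarrow> real"
  assumes cont: "continuous_on ({a..b} \<times> {0..2*pi} \<times> {0..e1}) (\<lambda>(r, \<theta>, e). h r \<theta> e)"
    and "e1 > 0" and "\<eta> > 0"
  obtains \<delta> where "\<delta> > 0"
    "\<And>\<rho> e \<xi>. \<lbrakk>\<rho> \<in> {a..b}; 0 \<le> e; e \<le> e1; e < \<delta>;
        \<And>\<theta>. \<theta> \<in> {0..2*pi} \<Longrightarrow> \<xi> \<theta> \<in> {a..b} \<and> \<bar>\<xi> \<theta> - \<rho>\<bar> < \<delta>;
        (\<lambda>\<theta>. h (\<xi> \<theta>) \<theta> e) integrable_on {0..2*pi}\<rbrakk> \<Longrightarrow>
        \<bar>integral {0..2*pi} (\<lambda>\<theta>. h (\<xi> \<theta>) \<theta> e) - integral {0..2*pi} (\<lambda>\<theta>. h \<rho> \<theta> 0)\<bar> < \<eta>"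
proof -
  \<comment> \<open>The factor 2 makes the final estimate, \<open>\<eta>'\<close> times the length 2
    pi, strict.\<close>
  define \<eta>' where "\<eta>' = \<eta> / (2 * (2*pi))"
  have \<eta>': "\<eta>' > 0" using assms by (simp add: \<eta>'_def)
  have "uniformly_continuous_on ({a..b} \<times> {0..2*pi} \<times> {0..e1}) (\<lambda>(r, \<theta>, e). h r \<theta> e)"
    by (intro compact_uniformly_continuous cont compact_Times compact_Icc)
  then obtain d where d: "d > 0" "\<And>p q. \<lbrakk>p \<in> {a..b} \<times> {0..2*pi} \<times> {0..e1};
      q \<in> {a..b} \<times> {0..2*pi} \<times> {0..e1}; dist q p < d\<rbrakk> \<Longrightarrow>
      dist ((\<lambda>(r, \<theta>, e). h r \<theta> e) q) ((\<lambda>(r, \<theta>, e). h r \<theta> e) p) < \<eta>'"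
    using \<eta>' unfolding uniformly_continuous_on_def by metis
  show ?thesis
  proof (rule that[of "d/2"])
    show "d/2 > 0" using d by simp
  next
    \<comment> \<open>Along \<open>\<xi>\<close> only integrability is available, not continuity of
      \<open>\<xi>\<close>: in the application \<open>\<xi>\<close> is picked pointwise by the mean
      value theorem.\<close>
    fix \<rho> e \<xi>
    assume \<rho>: "\<rho> \<in> {a..b}" and e: "0 \<le> e" "e \<le> e1" "e < d/2"
      and \<xi>: "\<And>\<theta>. \<theta> \<in> {0..2*pi} \<Longrightarrow> \<xi> \<theta> \<in> {a..b} \<and> \<bar>\<xi> \<theta> - \<rho>\<bar> < d/2"
      and int: "(\<lambda>\<theta>. h (\<xi> \<theta>) \<theta> e) integrable_on {0..2*pi}"
    have c0: "continuous_on {0..2*pi} (\<lambda>\<theta>. h \<rho> \<theta> 0)"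
    proof -
      have "continuous_on {0..2*pi} ((\<lambda>(r, \<theta>, e). h r \<theta> e) \<circ> (\<lambda>\<theta>. (\<rho>, \<theta>, 0)))"
        by (rule continuous_on_compose[OF _ continuous_on_subset[OF cont]])
           (use \<rho> \<open>e1 > 0\<close> in \<open>auto intro!: continuous_intros\<close>)
      then show ?thesis by (simp add: o_def)
    qed
    have bd: "norm (h (\<xi> \<theta>) \<theta> e - h \<rho> \<theta> 0) \<le> \<eta>'" if "\<theta> \<in> {0..2*pi}" for \<theta>
    proof -
      have "dist (\<xi> \<theta>, \<theta>, e) (\<rho>, \<theta>, 0) \<le> \<bar>\<xi> \<theta> - \<rho>\<bar> + \<bar>e\<bar>"
        by (simp add: dist_Pair_Pair dist_real_def sqrt_sum_squares_le_sum_abs)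
      also have "\<dots> < d" using \<xi>[OF that] e by auto
      finally have "dist (h (\<xi> \<theta>) \<theta> e) (h \<rho> \<theta> 0) < \<eta>'"
        using d(2)[of "(\<rho>, \<theta>, 0)" "(\<xi> \<theta>, \<theta>, e)"] \<xi>[OF that] \<rho> e that \<open>e1 > 0\<close> by auto
      then show ?thesis by (simp add: dist_real_def)
    qed
    have "integral {0..2*pi} (\<lambda>\<theta>. h (\<xi> \<theta>) \<theta> e) - integral {0..2*pi} (\<lambda>\<theta>. h \<rho> \<theta> 0)
        = integral {0..2*pi} (\<lambda>\<theta>. h (\<xi> \<theta>) \<theta> e - h \<rho> \<theta> 0)"
      by (rule integral_diff[symmetric]) (use int c0 in \<open>auto intro: integrable_continuous_interval\<close>)
    moreover have "norm (integral {0..2*pi} (\<lambda>\<theta>. h (\<xi> \<theta>) \<theta> e - h \<rho> \<theta> 0)) \<le> \<eta>' * (2*pi - 0)"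
    proof -
      have "norm (integral {0..2*pi} (\<lambda>\<theta>. h (\<xi> \<theta>) \<theta> e - h \<rho> \<theta> 0)) \<le> integral {0..2*pi} (\<lambda>_. \<eta>')"
        by (rule integral_norm_bound_integral)
           (use bd in \<open>auto intro!: integrable_diff int integrable_continuous_interval[OF c0]\<close>)
      then show ?thesis by (simp add: mult.commute)
    qed
    moreover have "\<eta>' * (2*pi - 0) < \<eta>" using assms by (simp add: \<eta>'_def)
    ultimately show "\<bar>integral {0..2*pi} (\<lambda>\<theta>. h (\<xi> \<theta>) \<theta> e) - integral {0..2*pi} (\<lambda>\<theta>. h \<rho> \<theta> 0)\<bar> < \<eta>"
      by simp
  qed
qed

text \<open>Gronwall's argument for the squared distance D: since D' is bounded by 2 L D in modulus,
  D exp(-2Lt) is nonincreasing and D exp(2Lt) is nondecreasing. The first settles times after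
  \<open>t0\<close>, the second times before it.\<close>

lemma ode_unique_real:
  fixes R S :: "real \<Rightarrow> real"
  assumes R: "\<And>t. (R has_real_derivative R' t) (at t)"
    and S: "\<And>t. (S has_real_derivative S' t) (at t)"
    and lip: "\<And>t. \<bar>R' t - S' t\<bar> \<le> L * \<bar>R t - S t\<bar>"
    and eq: "R t0 = S t0"
  shows "R t = S t"
proof -
  define D where "D t = (R t - S t)^2" for t
  have D': "(D has_real_derivative 2 * (R t - S t) * (R' t - S' t)) (at t)" for t
    unfolding D_def by (auto intro!: derivative_eq_intros R S)
  have bd: "\<bar>2 * (R t - S t) * (R' t - S' t)\<bar> \<le> 2 * L * D t" for t
  proof -
    have "\<bar>2 * (R t - S t) * (R' t - S' t)\<bar> = 2 * \<bar>R t - S t\<bar> * \<bar>R' t - S' t\<bar>"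
      by (simp only: abs_mult abs_numeral)
    also have "\<dots> \<le> 2 * \<bar>R t - S t\<bar> * (L * \<bar>R t - S t\<bar>)"
      by (intro mult_left_mono lip) auto
    also have "\<dots> = 2 * L * \<bar>R t - S t\<bar>^2" by (simp add: power2_eq_square)
    finally show ?thesis by (simp add: D_def)
  qed
  have D0: "D t0 = 0" by (simp add: D_def eq)
  have nn: "D t \<ge> 0" for t by (simp add: D_def)
  consider "t \<ge> t0" | "t < t0" by linarith
  then have "D t \<le> 0"
  proof cases
    case 1
    have "D t * exp (-(2 * L * t)) \<le> D t0 * exp (-(2 * L * t0))"
    proof (rule DERIV_nonpos_imp_nonincreasing[OF 1])
      fix s
      have "((\<lambda>t. D t * exp (-(2 * L * t))) has_real_derivative
          (2 * (R s - S s) * (R' s - S' s) - 2 * L * D s) * exp (-(2 * L * s))) (at s)"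
        by (auto intro!: derivative_eq_intros D' simp: algebra_simps)
      moreover have "(2 * (R s - S s) * (R' s - S' s) - 2 * L * D s) * exp (-(2 * L * s)) \<le> 0"
        using bd[of s] by (intro mult_nonpos_nonneg) auto
      ultimately show "\<exists>y. ((\<lambda>t. D t * exp (-(2 * L * t))) has_real_derivative y) (at s) \<and> y \<le> 0"
        by blast
    qed
    then show ?thesis using D0 by (simp add: mult_le_0_iff)
  next
    case 2
    have "D t * exp (2 * L * t) \<le> D t0 * exp (2 * L * t0)"
    proof (rule DERIV_nonneg_imp_nondecreasing[OF less_imp_le[OF 2]])
      fix s
      have "((\<lambda>t. D t * exp (2 * L * t)) has_real_derivative
          (2 * (R s - S s) * (R' s - S' s) + 2 * L * D s) * exp (2 * L * s)) (at s)"
        by (auto intro!: derivative_eq_intros D' simp: algebra_simps)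
      moreover have "(2 * (R s - S s) * (R' s - S' s) + 2 * L * D s) * exp (2 * L * s) \<ge> 0"
        using bd[of s] by (intro mult_nonneg_nonneg) auto
      ultimately show "\<exists>y. ((\<lambda>t. D t * exp (2 * L * t)) has_real_derivative y) (at s) \<and> y \<ge> 0"
        by blast
    qed
    then show ?thesis using D0 by (simp add: mult_le_0_iff)
  qed
  then have "D t = 0" using nn[of t] by simp
  then show ?thesis by (simp add: D_def)
qed

lemma continuous_nonvanishing_sign:
  fixes g :: "real \<Rightarrow> real"
  assumes "continuous_on UNIV g" "\<And>t. g t \<noteq> 0" "g a > 0"
  shows "g b > 0"
proof (rule ccontr)
  assume "\<not> g b > 0"
  then have "g b < 0" using assms(2)[of b] by simp
  have "connected (range g)" using assms by (intro connected_continuous_image) auto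
  then have "0 \<in> range g"
    using \<open>g b < 0\<close> assms(3) unfolding connected_iff_interval by (meson less_imp_le rangeI)
  then show False using assms(2) by auto
qed

lemma periodic_reduce:
  fixes g :: "real \<Rightarrow> 'a"
  assumes T: "T > 0" and per: "\<And>t. g (t + T) = g t"
  obtains s where "s \<in> {0..T}" "g s = g t"
proof -
  have P: "g (t + real n * T) = g t" for n t
  proof (induction n)
    case (Suc n)
    have "t + real (Suc n) * T = (t + real n * T) + T" by (simp add: algebra_simps)
    then show ?case by (simp only: per Suc)
  qed simp
  define k where "k = \<lfloor>t / T\<rfloor>"
  define s where "s = t - real_of_int k * T"
  have "real_of_int k \<le> t / T" "t / T < real_of_int k + 1" unfolding k_def by linarith+
  then have "s \<in> {0..T}" using T by (auto simp: s_def field_simps)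
  moreover have "g s = g t"
  proof (cases "k \<ge> 0")
    case True
    then show ?thesis using P[of s "nat k"] by (simp add: s_def)
  next
    case False
    then show ?thesis using P[of t "nat (-k)"] by (simp add: s_def)
  qed
  ultimately show ?thesis using that by blast
qed

text \<open>Averaging setting for dR/d\<theta> = e N(R, \<theta>, e). The small factor stays outside
  \<open>N\<close>, so that \<open>N\<close> keeps its content at e = 0, where the average is
  taken.\<close>

locale periodic_family =
  fixes N Nr :: "real \<Rightarrow> real \<Rightarrow> real \<Rightarrow> real" and a b e1 :: real
  assumes ab: "a \<le> b" and e1: "e1 > 0"
    and N': "\<And>r \<theta> e. \<lbrakk>a \<le> r; r \<le> b; 0 \<le> e; e \<le> e1\<rbrakk> \<Longrightarrow>
        ((\<lambda>r. N r \<theta> e) has_real_derivative Nr r \<theta> e) (at r)"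
    and contN: "continuous_on ({a..b} \<times> UNIV \<times> {0..e1}) (\<lambda>(r, \<theta>, e). N r \<theta> e)"
    and contNr: "continuous_on ({a..b} \<times> UNIV \<times> {0..e1}) (\<lambda>(r, \<theta>, e). Nr r \<theta> e)"
    and N_per: "\<And>r \<theta> e. N r (\<theta> + 2*pi) e = N r \<theta> e"
    and Nr_per: "\<And>r \<theta> e. Nr r (\<theta> + 2*pi) e = Nr r \<theta> e"
begin

definition sol :: "real \<Rightarrow> (real \<Rightarrow> real) \<Rightarrow> bool" where
  "sol e R \<longleftrightarrow> (\<forall>\<theta>. R \<theta> \<in> {a..b} \<and> (R has_real_derivative e * N (R \<theta>) \<theta> e) (at \<theta>))"

text \<open>The first-order Melnikov function: \<open>e * M r\<close> approximates the displacement
  over one turn of the solution that starts at r.\<close>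

definition "M r = integral {0..2*pi} (\<lambda>\<theta>. N r \<theta> 0)"
definition "M' r = integral {0..2*pi} (\<lambda>\<theta>. Nr r \<theta> 0)"

lemma contN': "continuous_on ({a..b} \<times> {0..2*pi} \<times> {0..e1}) (\<lambda>(r, \<theta>, e). N r \<theta> e)"
  by (rule continuous_on_subset[OF contN]) auto

lemma contNr': "continuous_on ({a..b} \<times> {0..2*pi} \<times> {0..e1}) (\<lambda>(r, \<theta>, e). Nr r \<theta> e)"
  by (rule continuous_on_subset[OF contNr]) auto

lemma bounded_fun:
  assumes cont: "continuous_on ({a..b} \<times> UNIV \<times> {0..e1}) (\<lambda>(r, \<theta>, e). h r \<theta> e :: real)"
    and per: "\<And>r \<theta> e. h r (\<theta> + 2*pi) e = h r \<theta> e"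
  obtains C where "C > 0" "\<And>r \<theta> e. \<lbrakk>r \<in> {a..b}; 0 \<le> e; e \<le> e1\<rbrakk> \<Longrightarrow> \<bar>h r \<theta> e\<bar> \<le> C"
proof -
  have "compact ((\<lambda>(r, \<theta>, e). h r \<theta> e) ` ({a..b} \<times> {0..2*pi} \<times> {0..e1}))"
    by (intro compact_continuous_image continuous_on_subset[OF cont] compact_Times compact_Icc) auto
  then obtain C where C: "C > 0" "\<And>x. x \<in> {a..b} \<times> {0..2*pi} \<times> {0..e1} \<Longrightarrow>
      norm ((\<lambda>(r, \<theta>, e). h r \<theta> e) x) \<le> C"
    unfolding compact_eq_bounded_closed bounded_pos by auto
  show ?thesis
  proof (rule that[OF C(1)])
    fix r \<theta> e assume *: "r \<in> {a..b}" "0 \<le> e" "e \<le> e1"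
    obtain s where "s \<in> {0..2*pi}" "h r s e = h r \<theta> e"
      using periodic_reduce[of "2*pi" "\<lambda>\<theta>. h r \<theta> e" \<theta>] per by auto
    then show "\<bar>h r \<theta> e\<bar> \<le> C" using C(2)[of "(r, s, e)"] * by auto
  qed
qed

lemma N_Lipschitz:
  obtains C where "C > 0"
    "\<And>r r' \<theta> e. \<lbrakk>r \<in> {a..b}; r' \<in> {a..b}; 0 \<le> e; e \<le> e1\<rbrakk> \<Longrightarrow>
       \<bar>N r \<theta> e - N r' \<theta> e\<bar> \<le> C * \<bar>r - r'\<bar>"
proof -
  obtain C where C: "C > 0" "\<And>r \<theta> e. \<lbrakk>r \<in> {a..b}; 0 \<le> e; e \<le> e1\<rbrakk> \<Longrightarrow> \<bar>Nr r \<theta> e\<bar> \<le> C"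
    using bounded_fun[of Nr, OF contNr Nr_per] by blast
  show ?thesis
  proof (rule that[OF C(1)])
    fix r r' \<theta> e assume *: "r \<in> {a..b}" "r' \<in> {a..b}" "0 \<le> e" "e \<le> e1"
    have "norm (N r \<theta> e - N r' \<theta> e) \<le> C * norm (r - r')"
      by (rule field_differentiable_bound[where S = "{a..b}" and f' = "\<lambda>r. Nr r \<theta> e"])
         (use * C in \<open>auto intro: has_field_derivative_at_within N'\<close>)
    then show "\<bar>N r \<theta> e - N r' \<theta> e\<bar> \<le> C * \<bar>r - r'\<bar>" by simp
  qed
qed

lemma sol_unique:
  assumes "sol e R" "sol e S" "0 \<le> e" "e \<le> e1" "R t0 = S t0"
  shows "R = S"
proof
  obtain C where C: "C > 0"
    "\<And>r r' \<theta> e. \<lbrakk>r \<in> {a..b}; r' \<in> {a..b}; 0 \<le> e; e \<le> e1\<rbrakk> \<Longrightarrow>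
       \<bar>N r \<theta> e - N r' \<theta> e\<bar> \<le> C * \<bar>r - r'\<bar>" using N_Lipschitz by blast
  fix t
  show "R t = S t"
  proof (rule ode_unique_real[where R = R and S = S and t = t and L = "e * C" and t0 = t0 and R' = "\<lambda>t. e * N (R t) t e"
        and S' = "\<lambda>t. e * N (S t) t e"])
    show "(R has_real_derivative e * N (R t) t e) (at t)" for t using assms by (auto simp: sol_def)
    show "(S has_real_derivative e * N (S t) t e) (at t)" for t using assms by (auto simp: sol_def)
    show "\<bar>e * N (R t) t e - e * N (S t) t e\<bar> \<le> e * C * \<bar>R t - S t\<bar>" for t
    proof -
      have "\<bar>N (R t) t e - N (S t) t e\<bar> \<le> C * \<bar>R t - S t\<bar>"
        using assms by (intro C) (auto simp: sol_def)
      from mult_left_mono[OF this \<open>0 \<le> e\<close>] show ?thesis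
        using \<open>0 \<le> e\<close> by (simp add: abs_mult flip: right_diff_distrib)
    qed
  qed fact
qed

lemma sol_cont: "sol e R \<Longrightarrow> continuous_on X R"
  by (meson DERIV_isCont continuous_at_imp_continuous_on sol_def)

lemma cont_N_sol:
  assumes "sol e R" "0 \<le> e" "e \<le> e1"
  shows "continuous_on X (\<lambda>\<theta>. N (R \<theta>) \<theta> e)"
proof -
  have "continuous_on X ((\<lambda>(r, \<theta>, e). N r \<theta> e) \<circ> (\<lambda>\<theta>. (R \<theta>, \<theta>, e)))"
    by (rule continuous_on_compose[OF _ continuous_on_subset[OF contN]])
       (use assms in \<open>auto intro!: continuous_intros sol_cont simp: sol_def\<close>)
  then show ?thesis by (simp add: o_def)
qed

text \<open>A solution that closes up after several turns closes up after one turn, since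
  distinct solutions of a scalar equation are ordered.\<close>
lemma sol_period_one_turn:
  assumes R: "sol e R" and e: "0 \<le> e" "e \<le> e1"
    and per: "\<And>\<theta>. R (\<theta> + 2*pi*real (Suc m)) = R \<theta>"
  shows "R (\<theta> + 2*pi) = R \<theta>"
proof -
  define S where "S \<theta> = R (\<theta> + 2*pi)" for \<theta>
  have S: "sol e S"
    unfolding sol_def
  proof (intro allI conjI)
    fix \<theta>
    show "S \<theta> \<in> {a..b}" using R by (auto simp: sol_def S_def)
    have "(R has_real_derivative e * N (R (\<theta> + 2*pi)) (\<theta> + 2*pi) e) (at (\<theta> + 2*pi))"
      using R by (auto simp: sol_def)
    then have "((\<lambda>\<theta>. R (\<theta> + 2*pi)) has_real_derivative e * N (R (\<theta> + 2*pi)) (\<theta> + 2*pi) e) (at \<theta>)"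
      by (simp add: DERIV_shift)
    then show "(S has_real_derivative e * N (S \<theta>) \<theta> e) (at \<theta>)"
      by (simp add: S_def[abs_def] N_per)
  qed
  \<comment> \<open>If \<open>S - R\<close> has a constant sign, with \<open>s\<close> equal to 1 or
    -1, the values after successive turns are strictly monotone and cannot return after
    \<open>Suc m\<close> turns.\<close>
  have telescope: False if "\<And>\<theta>. s * (S \<theta> - R \<theta>) > 0" for s
  proof -
    have "s * (R (\<theta> + 2*pi*real (Suc n)) - R \<theta>) > 0" for n \<theta>
    proof (induction n)
      case 0
      show ?case using that[of \<theta>] by (simp add: S_def)
    next
      case (Suc n)
      have "\<theta> + 2*pi*real (Suc (Suc n)) = \<theta> + 2*pi*real (Suc n) + 2*pi" by (simp add: algebra_simps)
      then show ?case using that[of "\<theta> + 2*pi*real (Suc n)"] Suc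
        by (simp add: S_def algebra_simps)
    qed
    from this[of 0 m] per[of 0] show False by simp
  qed
  have "R = S"
  proof (rule ccontr)
    assume "R \<noteq> S"
    then have ne: "S t - R t \<noteq> 0" for t using sol_unique[OF R S e, of t] by auto
    have c: "continuous_on UNIV (\<lambda>t. s * (S t - R t))" for s
      by (intro continuous_intros sol_cont[OF R] sol_cont[OF S])
    show False
    proof (cases "S 0 - R 0 > 0")
      case True
      then have "1 * (S \<theta> - R \<theta>) > 0" for \<theta>
        using continuous_nonvanishing_sign[OF c[of 1], of 0 \<theta>] ne by simp
      then show False by (rule telescope)
    next
      case False
      then have "S 0 - R 0 < 0" using ne[of 0] by simp
      moreover have "R t - S t \<noteq> 0" for t using ne[of t] by simp
      ultimately have "-1 * (S \<theta> - R \<theta>) > 0" for \<theta>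
        using continuous_nonvanishing_sign[OF c[of "-1"], of 0 \<theta>] by simp
      then show False by (rule telescope)
    qed
  qed
  then show ?thesis by (metis S_def)
qed

lemma periodic_average_zero:
  assumes R: "sol e R" and e: "0 < e" "e \<le> e1" and per: "R (2*pi) = R 0"
  shows "integral {0..2*pi} (\<lambda>\<theta>. N (R \<theta>) \<theta> e) = 0"
proof -
  have "((\<lambda>\<theta>. e * N (R \<theta>) \<theta> e) has_integral (R (2*pi) - R 0)) {0..2*pi}"
    by (rule fundamental_theorem_of_calculus)
       (use R in \<open>auto simp: sol_def simp flip: has_real_derivative_iff_has_vector_derivative
          intro: has_field_derivative_at_within\<close>)
  then have "integral {0..2*pi} (\<lambda>\<theta>. e * N (R \<theta>) \<theta> e) = 0" using per by (simp only: integral_unique diff_self)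
  then show ?thesis using e by simp
qed

lemma sol_near_start:
  assumes R: "sol e R" and e: "0 < e" "e \<le> e1" and \<theta>: "\<theta> \<in> {0..2*pi}"
    and C: "\<And>r \<theta>. r \<in> {a..b} \<Longrightarrow> \<bar>N r \<theta> e\<bar> \<le> C"
  shows "\<bar>R \<theta> - R 0\<bar> \<le> e * C * (2*pi)"
proof -
  have C0: "C \<ge> 0" using C[of a 0] ab by force
  have "norm (R \<theta> - R 0) \<le> (e * C) * norm (\<theta> - 0)"
  proof (rule field_differentiable_bound[where S = UNIV and f' = "\<lambda>\<theta>. e * N (R \<theta>) \<theta> e"])
    fix z
    show "(R has_real_derivative e * N (R z) z e) (at z)" using R by (auto simp: sol_def)
    show "norm (e * N (R z) z e) \<le> e * C"
      using R e C[of "R z" z] by (auto simp: sol_def abs_mult)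
  qed auto
  also have "\<dots> \<le> e * C * (2*pi)" using \<theta> e C0 by (intro mult_left_mono) auto
  finally show ?thesis by simp
qed

text \<open>Along a periodic solution the integral of \<open>N\<close> vanishes, and the solution
  stays within O(e) of its start. Hence M at the start is small, while |M| has a positive minimum on
  the compact set K.\<close>

lemma no_periodic_start:
  assumes K: "compact K" "K \<subseteq> {a..b}" "\<And>r. r \<in> K \<Longrightarrow> M r \<noteq> 0"
  obtains \<delta> where "\<delta> > 0"
    "\<And>e R. \<lbrakk>0 < e; e < \<delta>; e \<le> e1; sol e R; R (2*pi) = R 0\<rbrakk> \<Longrightarrow> R 0 \<notin> K"
proof -
  have contM: "continuous_on K M"
  proof -
    have "continuous_on ({a..b} \<times> cbox 0 (2*pi)) (\<lambda>(r, \<theta>). N r \<theta> 0)"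
    proof -
      have "continuous_on ({a..b} \<times> cbox 0 (2*pi)) ((\<lambda>(r, \<theta>, e). N r \<theta> e) \<circ> (\<lambda>(r, \<theta>). (r, \<theta>, 0)))"
        by (rule continuous_on_compose[OF _ continuous_on_subset[OF contN]])
           (use e1 in \<open>auto intro!: continuous_intros simp: split_beta\<close>)
      then show ?thesis by (simp add: o_def split_beta)
    qed
    from integral_continuous_on_param[OF this] show ?thesis
      using K unfolding M_def by (auto intro: continuous_on_subset)
  qed
  obtain \<eta> where \<eta>: "\<eta> > 0" "\<And>r. r \<in> K \<Longrightarrow> \<bar>M r\<bar> \<ge> \<eta>"
  proof (cases "K = {}")
    case True
    then show ?thesis using that[of 1] by auto
  next
    case False
    have "continuous_on K (\<lambda>r. \<bar>M r\<bar>)" by (intro continuous_intros contM)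
    from continuous_attains_inf[OF K(1) False this] obtain x where
      "x \<in> K" "\<And>r. r \<in> K \<Longrightarrow> \<bar>M x\<bar> \<le> \<bar>M r\<bar>" by blast
    then show ?thesis using that[of "\<bar>M x\<bar>"] K(3) by auto
  qed
  obtain d where d: "d > 0"
    "\<And>\<rho> e \<xi>. \<lbrakk>\<rho> \<in> {a..b}; 0 \<le> e; e \<le> e1; e < d;
        \<And>\<theta>. \<theta> \<in> {0..2*pi} \<Longrightarrow> \<xi> \<theta> \<in> {a..b} \<and> \<bar>\<xi> \<theta> - \<rho>\<bar> < d;
        (\<lambda>\<theta>. N (\<xi> \<theta>) \<theta> e) integrable_on {0..2*pi}\<rbrakk> \<Longrightarrow>
        \<bar>integral {0..2*pi} (\<lambda>\<theta>. N (\<xi> \<theta>) \<theta> e) - integral {0..2*pi} (\<lambda>\<theta>. N \<rho> \<theta> 0)\<bar> < \<eta>"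
    using integral_freeze[OF contN' e1 \<eta>(1)] by blast
  obtain C where C: "C > 0" "\<And>r \<theta> e. \<lbrakk>r \<in> {a..b}; 0 \<le> e; e \<le> e1\<rbrakk> \<Longrightarrow> \<bar>N r \<theta> e\<bar> \<le> C"
    using bounded_fun[of N, OF contN N_per] by blast
  show ?thesis
  \<comment> \<open>Over one turn a solution moves by at most e C 2 pi; the second bound keeps this
    below \<open>d\<close>.\<close>
  proof (rule that[of "min d (d / (C * (2*pi)))"])
    show "min d (d / (C * (2*pi))) > 0" using d C by simp
  next
    fix e R assume e: "0 < e" "e < min d (d / (C * (2*pi)))" "e \<le> e1"
      and R: "sol e R" "R (2*pi) = R 0"
    have "e * (C * (2*pi)) < d" using e C pos_less_divide_eq[of "C * (2*pi)" e d] by simp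
    then have near: "\<bar>R \<theta> - R 0\<bar> < d" if "\<theta> \<in> {0..2*pi}" for \<theta>
      using sol_near_start[OF R(1) e(1,3) that, of C] C(2) e by (fastforce simp: mult.assoc)
    have "\<bar>integral {0..2*pi} (\<lambda>\<theta>. N (R \<theta>) \<theta> e) - integral {0..2*pi} (\<lambda>\<theta>. N (R 0) \<theta> 0)\<bar> < \<eta>"
    proof (rule d)
      show "(\<lambda>\<theta>. N (R \<theta>) \<theta> e) integrable_on {0..2*pi}"
        using e R by (intro integrable_continuous_interval cont_N_sol) auto
    qed (use R e near in \<open>auto simp: sol_def\<close>)
    then have "\<bar>M (R 0)\<bar> < \<eta>"
      using periodic_average_zero[OF R(1) e(1,3) R(2)] by (simp add: M_def)
    then show "R 0 \<notin> K" using \<eta>(2) by fastforce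
  qed
qed

text \<open>If $R < S$ are periodic, then integrating $(\ln (S - R))'$ over a period gives $0$; by the
  mean value theorem this integral is $e$ times an average of $\partial_r N$ along a curve between
  $R$ and $S$, hence close to $e M'(r)$ when both curves are close to $r$.\<close>
lemma unique_periodic_near:
  assumes \<rho>: "\<rho> \<in> {a..b}" "M' \<rho> \<noteq> 0"
  obtains \<delta> where "\<delta> > 0"
    "\<And>e R S. \<lbrakk>0 < e; e < \<delta>; e \<le> e1; sol e R; sol e S; R (2*pi) = R 0; S (2*pi) = S 0;
        \<bar>R 0 - \<rho>\<bar> < \<delta>; \<bar>S 0 - \<rho>\<bar> < \<delta>\<rbrakk> \<Longrightarrow> R = S"
proof -
  obtain d where d: "d > 0"
    "\<And>r e \<xi>. \<lbrakk>r \<in> {a..b}; 0 \<le> e; e \<le> e1; e < d;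
        \<And>\<theta>. \<theta> \<in> {0..2*pi} \<Longrightarrow> \<xi> \<theta> \<in> {a..b} \<and> \<bar>\<xi> \<theta> - r\<bar> < d;
        (\<lambda>\<theta>. Nr (\<xi> \<theta>) \<theta> e) integrable_on {0..2*pi}\<rbrakk> \<Longrightarrow>
        \<bar>integral {0..2*pi} (\<lambda>\<theta>. Nr (\<xi> \<theta>) \<theta> e) - integral {0..2*pi} (\<lambda>\<theta>. Nr r \<theta> 0)\<bar> < \<bar>M' \<rho>\<bar>"
    using integral_freeze[OF contNr' e1, of "\<bar>M' \<rho>\<bar>"] \<rho> by auto
  obtain C where C: "C > 0" "\<And>r \<theta> e. \<lbrakk>r \<in> {a..b}; 0 \<le> e; e \<le> e1\<rbrakk> \<Longrightarrow> \<bar>N r \<theta> e\<bar> \<le> C"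
    using bounded_fun[of N, OF contN N_per] by blast
  \<comment> \<open>One half of \<open>d\<close> is spent on the distance of the start from
    \<open>\<rho>\<close>, the other half on the drift during a turn.\<close>
  define \<delta> where "\<delta> = min (d/2) (d / 2 / (C * (2*pi)))"
  have ordered: False
    if e: "0 < e" "e < \<delta>" "e \<le> e1" and R: "sol e R" "R (2*pi) = R 0" "\<bar>R 0 - \<rho>\<bar> < \<delta>"
      and S: "sol e S" "S (2*pi) = S 0" "\<bar>S 0 - \<rho>\<bar> < \<delta>" and less: "\<And>\<theta>. R \<theta> < S \<theta>" for e R S
  proof -
    have ed: "e * (C * (2*pi)) < d/2"
      using e C pos_less_divide_eq[of "C * (2*pi)" e "d/2"] by (simp add: \<delta>_def)
    have near: "\<bar>R \<theta> - \<rho>\<bar> < d" "\<bar>S \<theta> - \<rho>\<bar> < d" if "\<theta> \<in> {0..2*pi}" for \<theta>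
    proof -
      have "\<bar>R \<theta> - R 0\<bar> \<le> e * C * (2*pi)" "\<bar>S \<theta> - S 0\<bar> \<le> e * C * (2*pi)"
        by (rule sol_near_start; use R S e C that in simp)+
      then show "\<bar>R \<theta> - \<rho>\<bar> < d" "\<bar>S \<theta> - \<rho>\<bar> < d"
        using ed R(3) S(3) unfolding \<delta>_def mult.assoc by linarith+
    qed
    have ex: "\<exists>\<xi>. R \<theta> < \<xi> \<and> \<xi> < S \<theta> \<and> N (S \<theta>) \<theta> e - N (R \<theta>) \<theta> e = (S \<theta> - R \<theta>) * Nr \<xi> \<theta> e" for \<theta>
    proof (rule MVT2[OF less])
      fix x assume "R \<theta> \<le> x" "x \<le> S \<theta>"
      moreover have "R \<theta> \<in> {a..b}" "S \<theta> \<in> {a..b}" using R S by (auto simp: sol_def)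
      ultimately show "((\<lambda>r. N r \<theta> e) has_real_derivative Nr x \<theta> e) (at x)"
        using e by (intro N') auto
    qed
    have "\<exists>\<xi>. \<forall>\<theta>. R \<theta> < \<xi> \<theta> \<and> \<xi> \<theta> < S \<theta> \<and>
        N (S \<theta>) \<theta> e - N (R \<theta>) \<theta> e = (S \<theta> - R \<theta>) * Nr (\<xi> \<theta>) \<theta> e"
      by (intro choice allI ex)
    then obtain \<xi> where \<xi>: "\<And>\<theta>. R \<theta> < \<xi> \<theta>" "\<And>\<theta>. \<xi> \<theta> < S \<theta>"
      "\<And>\<theta>. N (S \<theta>) \<theta> e - N (R \<theta>) \<theta> e = (S \<theta> - R \<theta>) * Nr (\<xi> \<theta>) \<theta> e" by blast
    \<comment> \<open>The function \<open>\<xi>\<close> comes from a choice and may be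
      discontinuous; the difference quotient shows that the integrand is continuous all the
      same.\<close>
    have Nr_eq: "Nr (\<xi> \<theta>) \<theta> e = (N (S \<theta>) \<theta> e - N (R \<theta>) \<theta> e) / (S \<theta> - R \<theta>)" for \<theta>
    proof -
      have "S \<theta> - R \<theta> \<noteq> 0" using less[of \<theta>] by linarith
      then show ?thesis unfolding \<xi>(3) by (rule nonzero_mult_div_cancel_left[symmetric])
    qed
    have "((\<lambda>\<theta>. e * Nr (\<xi> \<theta>) \<theta> e) has_integral ln (S (2*pi) - R (2*pi)) - ln (S 0 - R 0)) {0..2*pi}"
    proof (rule fundamental_theorem_of_calculus)
      fix x
      have "((\<lambda>\<theta>. ln (S \<theta> - R \<theta>)) has_real_derivative e * Nr (\<xi> x) x e) (at x within {0..2*pi})"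
      proof -
        have "((\<lambda>\<theta>. S \<theta> - R \<theta>) has_real_derivative e * N (S x) x e - e * N (R x) x e)
            (at x within {0..2*pi})"
          by (rule has_field_derivative_at_within, rule DERIV_diff)
             (use R S in \<open>auto simp: sol_def\<close>)
        from DERIV_ln_divide[THEN DERIV_chain2, OF _ this] less[of x] show ?thesis
          by (simp add: Nr_eq algebra_simps diff_divide_distrib)
      qed
      then show "((\<lambda>\<theta>. ln (S \<theta> - R \<theta>)) has_vector_derivative e * Nr (\<xi> x) x e) (at x within {0..2*pi})"
        by (simp add: has_real_derivative_iff_has_vector_derivative)
    qed simp
    from integral_unique[OF this] have "integral {0..2*pi} (\<lambda>\<theta>. e * Nr (\<xi> \<theta>) \<theta> e) = 0"
      by (simp only: R(2) S(2) diff_self)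
    then have 0: "integral {0..2*pi} (\<lambda>\<theta>. Nr (\<xi> \<theta>) \<theta> e) = 0" using e by simp
    have "\<bar>integral {0..2*pi} (\<lambda>\<theta>. Nr (\<xi> \<theta>) \<theta> e) - integral {0..2*pi} (\<lambda>\<theta>. Nr \<rho> \<theta> 0)\<bar> < \<bar>M' \<rho>\<bar>"
    proof (rule d(2))
      show "\<xi> \<theta> \<in> {a..b} \<and> \<bar>\<xi> \<theta> - \<rho>\<bar> < d" if "\<theta> \<in> {0..2*pi}" for \<theta>
      proof -
        have "R \<theta> \<in> {a..b}" "S \<theta> \<in> {a..b}" using R S by (auto simp: sol_def)
        then show ?thesis using near[OF that] \<xi>(1,2)[of \<theta>] by auto
      qed
      show "(\<lambda>\<theta>. Nr (\<xi> \<theta>) \<theta> e) integrable_on {0..2*pi}"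
        unfolding Nr_eq
      proof (intro integrable_continuous_interval continuous_intros cont_N_sol sol_cont)
        show "\<forall>x\<in>{0..2*pi}. S x - R x \<noteq> 0" using less by (metis diff_gt_0_iff_gt less_irrefl)
      qed (use R S e in auto)
    qed (use e \<rho>(1) d(1) in \<open>auto simp: \<delta>_def\<close>)
    then show False using 0 by (simp add: M'_def)
  qed
  show ?thesis
  proof (rule that[of \<delta>])
    show "\<delta> > 0" using d C by (simp add: \<delta>_def)
  next
    fix e R S
    assume e: "0 < e" "e < \<delta>" "e \<le> e1" and R: "sol e R" and S: "sol e S"
      and RS: "R (2*pi) = R 0" "S (2*pi) = S 0" "\<bar>R 0 - \<rho>\<bar> < \<delta>" "\<bar>S 0 - \<rho>\<bar> < \<delta>"
    show "R = S"
    proof (rule ccontr)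
      assume "R \<noteq> S"
      then have ne: "S t - R t \<noteq> 0" for t using sol_unique[OF R S, of t] e by auto
      have c: "continuous_on UNIV (\<lambda>t. S t - R t)" "continuous_on UNIV (\<lambda>t. R t - S t)"
        by (intro continuous_intros sol_cont[OF R] sol_cont[OF S])+
      show False
      proof (cases "S 0 - R 0 > 0")
        case True
        then have "R \<theta> < S \<theta>" for \<theta>
          using continuous_nonvanishing_sign[OF c(1), of 0 \<theta>] ne by simp
        then show False using ordered[OF e R RS(1,3) S RS(2,4)] by blast
      next
        case False
        then have "R 0 - S 0 > 0" using ne[of 0] by simp
        moreover have "R t - S t \<noteq> 0" for t using ne[of t] by simp
        ultimately have "S \<theta> < R \<theta>" for \<theta>
          using continuous_nonvanishing_sign[OF c(2), of 0 \<theta>] by simp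
        then show False using ordered[OF e S RS(2,4) R RS(1,3)] by blast
      qed
    qed
  qed
qed

text \<open>Starts away from the only zero of \<open>M\<close> are excluded by
  \<open>no_periodic_start\<close>, starts near it are covered by
  \<open>unique_periodic_near\<close>; if \<open>M\<close> has no zero, there is no periodic
  solution for small e.\<close>

theorem unique_periodic:
  assumes nondeg: "\<And>r. \<lbrakk>r \<in> {a..b}; M r = 0\<rbrakk> \<Longrightarrow> M' r \<noteq> 0"
    and uniq: "\<And>r s. \<lbrakk>r \<in> {a..b}; s \<in> {a..b}; M r = 0; M s = 0\<rbrakk> \<Longrightarrow> r = s"
  obtains e0 where "e0 > 0"
    "\<And>e R S. \<lbrakk>0 < e; e < e0; sol e R; sol e S; R (2*pi) = R 0; S (2*pi) = S 0\<rbrakk> \<Longrightarrow> R = S"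
proof (cases "\<exists>\<rho>\<in>{a..b}. M \<rho> = 0")
  case False
  obtain d where d: "d > 0"
    "\<And>e R. \<lbrakk>0 < e; e < d; e \<le> e1; sol e R; R (2*pi) = R 0\<rbrakk> \<Longrightarrow> R 0 \<notin> {a..b}"
    using no_periodic_start[of "{a..b}"] False by auto
  show ?thesis by (rule that[of "min d e1"]) (use d e1 in \<open>force simp: sol_def\<close>)+
next
  case True
  then obtain \<rho> where \<rho>: "\<rho> \<in> {a..b}" "M \<rho> = 0" by blast
  obtain d where d: "d > 0"
    "\<And>e R S. \<lbrakk>0 < e; e < d; e \<le> e1; sol e R; sol e S; R (2*pi) = R 0; S (2*pi) = S 0;
        \<bar>R 0 - \<rho>\<bar> < d; \<bar>S 0 - \<rho>\<bar> < d\<rbrakk> \<Longrightarrow> R = S"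
    using unique_periodic_near[OF \<rho>(1) nondeg[OF \<rho>]] by blast
  have "compact ({a..b} - ball \<rho> d)" by (intro compact_diff) auto
  moreover have "M r \<noteq> 0" if "r \<in> {a..b} - ball \<rho> d" for r
    using uniq[of r \<rho>] \<rho> d that by auto
  ultimately obtain d' where d': "d' > 0"
    "\<And>e R. \<lbrakk>0 < e; e < d'; e \<le> e1; sol e R; R (2*pi) = R 0\<rbrakk> \<Longrightarrow> R 0 \<notin> {a..b} - ball \<rho> d"
    using no_periodic_start[of "{a..b} - ball \<rho> d"] by blast
  have near: "\<bar>R 0 - \<rho>\<bar> < d" if "0 < e" "e < d'" "e \<le> e1" "sol e R" "R (2*pi) = R 0" for e R
    using d'(2)[OF that] that(4) by (auto simp: sol_def dist_real_def abs_minus_commute)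
  show ?thesis
    by (rule that[of "min e1 (min d d')"]) (use d d' e1 near in \<open>auto\<close>)
qed

end

section \<open>The first-order average and its zeros\<close>

text \<open>A function that rises through each of its zeros is positive just after a zero r and
  negative just before the next zero q, so the intermediate value theorem yields a zero before q.
  One-sided derivatives take care of zeros at the ends of the interval.\<close>

lemma increasing_zero_unique:
  fixes g :: "real \<Rightarrow> real"
  assumes g: "\<And>x. x \<in> {a..b} \<Longrightarrow> (g has_real_derivative g' x) (at x within {a..b})"
    and pos: "\<And>x. \<lbrakk>x \<in> {a..b}; g x = 0\<rbrakk> \<Longrightarrow> g' x > 0"
    and r: "r \<in> {a..b}" "g r = 0" and s: "s \<in> {a..b}" "g s = 0"
  shows "r = s"
proof -
  have False if r: "r \<in> {a..b}" "g r = 0" and s: "s \<in> {a..b}" "g s = 0" and less: "r < s" for r s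
  proof -
    have cont: "continuous_on {a..b} g"
      unfolding continuous_on_eq_continuous_within using g DERIV_continuous by blast
    from has_real_derivative_pos_inc_right[OF g[OF r(1)] pos[OF r]]
    obtain d where d: "d > 0" "\<And>h. \<lbrakk>h > 0; r + h \<in> {a..b}; h < d\<rbrakk> \<Longrightarrow> g r < g (r + h)" by blast
    define p where "p = r + min (d/2) ((s - r)/2)"
    have "r < p" "p < s" "p - r < d" using less d(1) by (auto simp: p_def min_def field_simps)
    then have p: "r < p" "p < s" "g p > 0" using d(2)[of "p - r"] r s by auto
    define X where "X = {x \<in> {p..s}. g x = 0}"
    have "closed X" unfolding X_def
      using p r s by (intro continuous_closed_preimage_constant continuous_on_subset[OF cont]) auto
    moreover have "{p..s} \<inter> X = X" by (auto simp: X_def)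
    ultimately have "compact X" using compact_Int_closed[of "{p..s}" X] by simp
    moreover have "s \<in> X" using p s by (auto simp: X_def)
    ultimately obtain q where q: "q \<in> X" "\<And>x. x \<in> X \<Longrightarrow> q \<le> x"
      using compact_attains_inf[of X] by blast
    have "q \<in> {p..s}" "g q = 0" "q \<noteq> p" using q(1) p(3) by (auto simp: X_def)
    then have qab: "q \<in> {a..b}" "g q = 0" "p < q" using p(1) r s by auto
    from has_real_derivative_pos_inc_left[OF g[OF qab(1)] pos[OF qab(1,2)]]
    obtain d' where d': "d' > 0" "\<And>h. \<lbrakk>h > 0; q - h \<in> {a..b}; h < d'\<rbrakk> \<Longrightarrow> g (q - h) < g q" by blast
    define t where "t = q - min (d'/2) ((q - p)/2)"
    have "p < t" "t < q" "q - t < d'" using qab(3) d'(1) by (auto simp: t_def min_def field_simps)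
    then have t: "p < t" "t < q" "g t < 0" using d'(2)[of "q - t"] qab p r by auto
    have "\<exists>x\<ge>p. x \<le> t \<and> g x = 0"
      by (rule IVT2') (use t p r qab in \<open>auto intro: continuous_on_subset[OF cont]\<close>)
    then obtain x where "p \<le> x" "x \<le> t" "g x = 0" by blast
    moreover have "q \<le> s" using q by (auto simp: X_def)
    ultimately have "x \<in> X" using t by (auto simp: X_def)
    then show False using q(2) \<open>x \<le> t\<close> t by fastforce
  qed
  then show ?thesis using r s by (metis linorder_neq_iff)
qed

text \<open>If $\psi$ changes sign from $-$ to $+$ at $x_0 = r c_0$, then
  $\psi(r\cos\theta)(\cos^2\theta - c_0^2) \ge 0$.\<close>
lemma integral_cos_sq_pos:
  fixes \<phi> :: "real \<Rightarrow> real"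
  assumes cont: "continuous_on {-Z<..<Z} \<phi>"
    and sign: "\<And>x y. \<lbrakk>0 < x; x < y; y < Z; s * (\<phi> x + \<phi> (-x)) \<ge> 0\<rbrakk> \<Longrightarrow> s * (\<phi> y + \<phi> (-y)) > 0"
    and r: "0 < r" "r < Z"
    and zero: "integral {0..2*pi} (\<lambda>\<theta>. \<phi> (r * cos \<theta>) * (sin \<theta>)^2) = 0"
  shows "s * integral {0..2*pi} (\<lambda>\<theta>. \<phi> (r * cos \<theta>) * (cos \<theta>)^2) > 0"
proof -
  have in_dom: "\<bar>r * cos \<theta>\<bar> \<le> r" for \<theta>
    using r abs_cos_le_one[of \<theta>] by (simp add: abs_mult mult_left_le)
  then have in_dom': "- Z < r * cos \<theta>" "r * cos \<theta> < Z" for \<theta>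
    using r by (smt (verit))+
  have cphi: "continuous_on X (\<lambda>\<theta>. \<phi> (r * cos \<theta>))" "continuous_on X (\<lambda>\<theta>. \<phi> (- (r * cos \<theta>)))" for X
  proof -
    have "- (r * cos \<theta>) < Z" "- Z < - (r * cos \<theta>)" for \<theta> using in_dom'[of \<theta>] by linarith+
    then show "continuous_on X (\<lambda>\<theta>. \<phi> (r * cos \<theta>))" "continuous_on X (\<lambda>\<theta>. \<phi> (- (r * cos \<theta>)))"
      using in_dom' by (auto intro!: continuous_on_compose2[OF cont] continuous_intros)
  qed
  define \<psi> where "\<psi> x = s * (\<phi> x + \<phi> (-x))" for x
  have cpsi: "continuous_on X (\<lambda>\<theta>. \<psi> (r * cos \<theta>))" for X
    unfolding \<psi>_def by (intro continuous_intros cphi)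
  have even: "\<psi> (-x) = \<psi> x" for x by (simp add: \<psi>_def add.commute)
  \<comment> \<open>Shifting \<theta> by pi changes the sign of the cosine, so a pi-periodic weight
    sees only the even part of \<open>\<phi>\<close>.\<close>
  have fold: "s * integral {0..2*pi} (\<lambda>\<theta>. \<phi> (r * cos \<theta>) * w \<theta>) = integral {0..pi} (\<lambda>\<theta>. \<psi> (r * cos \<theta>) * w \<theta>)"
    if w: "continuous_on UNIV w" "\<And>\<theta>. w (\<theta> + pi) = w \<theta>" for w :: "real \<Rightarrow> real"
  proof -
    define h where "h \<theta> = \<phi> (r * cos \<theta>) * w \<theta>" for \<theta>
    have ch: "continuous_on X h" for X
      unfolding h_def by (intro continuous_intros cphi continuous_on_subset[OF w(1)]) auto
    have ch': "continuous_on X (\<lambda>\<theta>. \<phi> (- (r * cos \<theta>)) * w \<theta>)" for X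
      by (intro continuous_intros cphi continuous_on_subset[OF w(1)]) auto
    have "integral {0..2*pi} h = integral {0..pi} h + integral {pi..2*pi} h"
      by (rule Henstock_Kurzweil_Integration.integral_combine[symmetric])
         (auto intro: integrable_continuous_interval ch)
    also have "integral {pi..2*pi} h = integral {0..pi} (\<lambda>\<theta>. \<phi> (- (r * cos \<theta>)) * w \<theta>)"
      using integral_shift[of 0 pi pi h] ch by (simp add: o_def h_def w(2))
    also have "integral {0..pi} h + \<dots> = integral {0..pi} (\<lambda>\<theta>. h \<theta> + \<phi> (- (r * cos \<theta>)) * w \<theta>)"
      by (rule integral_add[symmetric]) (auto intro: integrable_continuous_interval ch ch')
    also have "(\<lambda>\<theta>. h \<theta> + \<phi> (- (r * cos \<theta>)) * w \<theta>) = (\<lambda>\<theta>. (\<phi> (r * cos \<theta>) + \<phi> (- (r * cos \<theta>))) * w \<theta>)"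
      by (simp add: h_def algebra_simps)
    finally have "s * integral {0..2*pi} h = integral {0..pi} (\<lambda>\<theta>. s * ((\<phi> (r * cos \<theta>) + \<phi> (- (r * cos \<theta>))) * w \<theta>))"
      by simp
    then show ?thesis by (simp only: h_def[abs_def] \<psi>_def mult.assoc)
  qed
  have z: "integral {0..pi} (\<lambda>\<theta>. \<psi> (r * cos \<theta>) * (sin \<theta>)^2) = 0"
    using fold[of "\<lambda>\<theta>. (sin \<theta>)^2"] zero by (simp add: continuous_intros)
  \<comment> \<open>The point where \<psi> changes sign. Inserting \<open>r\<close> keeps the set
    nonempty and gives \<open>x0 = r\<close> when \<psi> stays negative on (0, r).\<close>
  define x0 where "x0 = Inf (insert r {x. 0 < x \<and> x < r \<and> \<psi> x \<ge> 0})"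
  have bdd: "bdd_below (insert r {x. 0 < x \<and> x < r \<and> \<psi> x \<ge> 0})"
    by (rule bdd_belowI[of _ 0]) (use r in auto)
  have x0: "0 \<le> x0" "x0 \<le> r"
    unfolding x0_def using r bdd by (auto intro!: cInf_greatest cInf_lower)
  have neg: "\<psi> x < 0" if "0 < x" "x < x0" for x
  proof (rule ccontr)
    assume "\<not> \<psi> x < 0"
    then have "x0 \<le> x" unfolding x0_def using that x0 by (intro cInf_lower bdd) auto
    then show False using that by simp
  qed
  have pos: "\<psi> x > 0" if "x0 < x" "x < r" for x
  proof -
    have "\<exists>y\<in>insert r {x. 0 < x \<and> x < r \<and> \<psi> x \<ge> 0}. y < x"
      using that(1) unfolding x0_def by (subst (asm) cInf_less_iff) (use bdd in auto)
    then obtain y where "y \<in> insert r {x. 0 < x \<and> x < r \<and> \<psi> x \<ge> 0}" "y < x" by blast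
    then have "0 < y" "y < x" "\<psi> y \<ge> 0" using that(2) by auto
    then show ?thesis using sign[of y x] that r by (simp add: \<psi>_def)
  qed
  define c0 where "c0 = x0 / r"
  have c0: "0 \<le> c0" "c0 \<le> 1" "x0 = r * c0" using x0 r by (auto simp: c0_def)
  have pc: "isCont (\<lambda>x. \<psi> x) 0"
  proof -
    have "continuous_on {-Z<..<Z} \<psi>" unfolding \<psi>_def
      by (intro continuous_intros continuous_on_compose2[OF cont]) auto
    then show ?thesis using r by (intro continuous_on_interior[of "{-Z<..<Z}"]) auto
  qed
  \<comment> \<open>The sign hypothesis speaks of positive arguments only; at 0, which is reached at
    \<theta> = pi/2, the sign comes from continuity.\<close>
  have psi0: "\<psi> 0 \<le> 0" if "x0 > 0"
  proof (rule tendsto_upperbound)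
    show "(\<psi> \<longlongrightarrow> \<psi> 0) (at_right 0)" using pc by (simp add: isCont_def filterlim_at_split)
    show "\<forall>\<^sub>F x in at_right 0. \<psi> x \<le> 0"
      unfolding eventually_at_right_field using that neg by (intro exI[of _ x0]) (auto intro: less_imp_le)
  qed simp
  have nonneg: "\<psi> x * (x^2 - x0^2) \<ge> 0" if "\<bar>x\<bar> < r" for x
  proof -
    have abs: "\<psi> \<bar>x\<bar> = \<psi> x" by (auto simp: abs_if even)
    consider "x = 0" | "x \<noteq> 0" "\<bar>x\<bar> < x0" | "\<bar>x\<bar> = x0" | "\<bar>x\<bar> > x0" by linarith
    then show ?thesis
    proof cases
      case 1
      then show ?thesis using psi0 x0 by (cases "x0 = 0") (auto simp: mult_nonpos_nonneg)
    next
      case 2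
      then have "\<psi> x < 0" using neg[of "\<bar>x\<bar>"] abs by simp
      moreover have "x^2 \<le> x0^2" using 2 x0 by (metis abs_ge_zero less_imp_le power2_abs power_mono)
      ultimately have "\<psi> x \<le> 0" "x^2 - x0^2 \<le> 0" by simp_all
      then show ?thesis by (simp add: mult_nonpos_nonpos)
    next
      case 3
      then show ?thesis by (metis diff_self mult_zero_right order_refl power2_abs)
    next
      case 4
      then have "\<psi> x > 0" using pos[of "\<bar>x\<bar>"] abs that by simp
      moreover have "x0^2 \<le> x^2" using 4 x0 by (metis less_imp_le power2_abs power_mono)
      ultimately show ?thesis by simp
    qed
  qed
  define h where "h \<theta> = \<psi> (r * cos \<theta>) * ((cos \<theta>)^2 - c0^2)" for \<theta>
  have ch: "continuous_on X h" for X unfolding h_def by (intro continuous_intros cpsi)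
  have hr: "r^2 * h \<theta> = \<psi> (r * cos \<theta>) * ((r * cos \<theta>)^2 - x0^2)" for \<theta>
    by (simp add: h_def c0(3) algebra_simps power_mult_distrib)
  have cos_less: "\<bar>r * cos \<theta>\<bar> < r" if "0 < \<theta>" "\<theta> < pi" for \<theta>
  proof -
    have "\<bar>cos \<theta>\<bar> < 1" using that cos_monotone_0_pi[of 0 \<theta>] cos_monotone_0_pi[of \<theta> pi] by auto
    then show ?thesis using r by (simp add: abs_mult)
  qed
  have h_nonneg: "h \<theta> \<ge> 0" if "0 < \<theta>" "\<theta> < pi" for \<theta>
  proof -
    have "r^2 * h \<theta> \<ge> 0" unfolding hr by (rule nonneg[OF cos_less[OF that]])
    then show ?thesis using r by (simp add: zero_le_mult_iff)
  qed
  \<comment> \<open>Strictness: a continuous nonnegative \<open>h\<close> with integral 0 vanishes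
    identically, but \<psi> is nonzero at every point of (0, r) other than
    \<open>x0\<close>.\<close>
  have "integral {0..pi} h \<noteq> 0"
  proof
    assume "integral {0..pi} h = 0"
    then have hi: "(h has_integral 0) (cbox 0 pi)"
      using integrable_integral[OF integrable_continuous_interval[OF ch, of 0 pi]] by simp
    have h0: "h \<theta> = 0" if "0 \<le> \<theta>" "\<theta> \<le> pi" for \<theta>
      by (rule has_integral_0_cbox_imp_0[OF ch _ hi]) (use that h_nonneg pi_gt_zero in \<open>auto simp: not_le\<close>)
    obtain x where x: "0 < x" "x < r" "x \<noteq> x0"
    proof (cases "x0 = r/2")
      case True
      then show ?thesis using that[of "r/3"] r by auto
    next
      case False
      then show ?thesis using that[of "r/2"] r by auto
    qed
    define \<theta> where "\<theta> = arccos (x / r)"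
    have \<theta>: "0 \<le> \<theta>" "\<theta> \<le> pi" "r * cos \<theta> = x"
    proof -
      have "-1 \<le> x / r" "x / r \<le> 1" using x r by (auto simp: field_simps)
      then show "0 \<le> \<theta>" "\<theta> \<le> pi" "r * cos \<theta> = x"
        using r by (simp_all add: \<theta>_def arccos_lbound arccos_ubound)
    qed
    have "\<psi> x * (x^2 - x0^2) = 0" using h0[OF \<theta>(1,2)] hr[of \<theta>] \<theta>(3) by simp
    moreover have "x^2 \<noteq> x0^2" using x x0 by (simp add: power2_eq_iff)
    moreover have "\<psi> x \<noteq> 0" using x neg[of x] pos[of x] by (cases "x < x0") auto
    ultimately show False by simp
  qed
  moreover have "integral {0..pi} h \<ge> 0"
  proof -
    have "integral {0..pi} h = integral (box 0 pi) h"
      by (metis box_real(2) integral_open_interval)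
    moreover have "h integrable_on box 0 pi"
      unfolding integrable_on_open_interval by (simp add: integrable_continuous_interval ch)
    then have "integral (box 0 pi) h \<ge> 0"
      by (rule integral_nonneg) (use h_nonneg in auto)
    ultimately show ?thesis by simp
  qed
  ultimately have hpos: "integral {0..pi} h > 0" by simp
  let ?C = "integral {0..pi} (\<lambda>\<theta>. \<psi> (r * cos \<theta>) * (cos \<theta>)^2)"
  \<comment> \<open>Since cos^2 - c0^2 = (1 - c0^2) cos^2 - c0^2 sin^2 and the sin^2 integral is
    zero, the positive integral of \<open>h\<close> is 1 - c0^2 times the cos^2 integral. This also
    rules out c0 = 1.\<close>
  have "h = (\<lambda>\<theta>. (1 - c0^2) * (\<psi> (r * cos \<theta>) * (cos \<theta>)^2) - c0^2 * (\<psi> (r * cos \<theta>) * (sin \<theta>)^2))"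
    by (auto simp: h_def sin_squared_eq algebra_simps)
  then have "integral {0..pi} h = (1 - c0^2) * ?C - c0^2 * integral {0..pi} (\<lambda>\<theta>. \<psi> (r * cos \<theta>) * (sin \<theta>)^2)"
    by (simp only:) (subst integral_diff, auto intro!: integrable_continuous_interval continuous_intros cpsi)
  then have "(1 - c0^2) * ?C > 0" using hpos z by simp
  moreover have "1 - c0^2 \<ge> 0" using c0 by (simp add: power_le_one)
  ultimately have "?C > 0" by (simp add: zero_less_mult_iff)
  then show ?thesis using fold[of "\<lambda>\<theta>. (cos \<theta>)^2"] by (simp add: continuous_intros)
qed

section \<open>Antiderivatives and inverses for changing between time and angle\<close>

lemma antiderivative_real:
  fixes g :: "real \<Rightarrow> real"
  assumes "continuous_on UNIV g"
  obtains P where "\<And>t. (P has_real_derivative g t) (at t)"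
proof -
  have "isCont g t" for t using assms by (simp add: continuous_on_eq_continuous_at)
  then have "\<exists>P. \<forall>x. - \<infinity> < ereal x \<longrightarrow> ereal x < \<infinity> \<longrightarrow> (P has_vector_derivative g x) (at x)"
    by (intro einterval_antiderivative) auto
  then show ?thesis using that by (auto simp: has_real_derivative_iff_has_vector_derivative)
qed

text \<open>The shift relation makes the increasing function \<Theta> unbounded in both directions,
  hence bijective. It serves both ways: time as a function of the angle along a given orbit, and the
  angle as a function of time when an orbit is constructed.\<close>

lemma inverse_of_increasing_shift:
  fixes \<Theta> \<omega> :: "real \<Rightarrow> real"
  assumes \<Theta>: "\<And>t. (\<Theta> has_real_derivative \<omega> t) (at t)" and pos: "\<And>t. \<omega> t > 0"
    and shift: "\<And>t. \<Theta> (t + T) = \<Theta> t + C" and T: "T > 0"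
  obtains \<tau> where "\<And>t. \<tau> (\<Theta> t) = t" "\<And>\<theta>. \<Theta> (\<tau> \<theta>) = \<theta>"
    "\<And>\<theta>. (\<tau> has_real_derivative inverse (\<omega> (\<tau> \<theta>))) (at \<theta>)" "\<And>\<theta>. \<tau> (\<theta> + C) = \<tau> \<theta> + T"
proof -
  have mono: "\<Theta> s < \<Theta> t" if "s < t" for s t
    using that \<Theta> pos by (intro DERIV_pos_imp_increasing[of s t \<Theta>]) auto
  have inj: "inj \<Theta>" by (rule linorder_injI) (use mono in force)
  have cont: "isCont \<Theta> t" for t by (rule DERIV_isCont[OF \<Theta>])
  have C: "C > 0" using mono[of 0 T] shift[of 0] T by simp
  have shift_n: "\<Theta> (t + real n * T) = \<Theta> t + real n * C" for t n
  proof (induction n)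
    case (Suc n)
    have "\<Theta> (t + real (Suc n) * T) = \<Theta> ((t + real n * T) + T)" by (simp add: algebra_simps)
    then show ?case unfolding shift Suc by (simp add: algebra_simps)
  qed simp
  have surj: "\<exists>t. \<Theta> t = \<theta>" for \<theta>
  proof -
    obtain n where n: "real n * C > \<bar>\<theta> - \<Theta> 0\<bar>" using C ex_less_of_nat_mult by blast
    have "\<Theta> (- (real n * T)) + real n * C = \<Theta> 0" using shift_n[of "- (real n * T)" n] by simp
    then have lo: "\<Theta> (- (real n * T)) \<le> \<theta>" using n by linarith
    have hi: "\<theta> \<le> \<Theta> (real n * T)" using shift_n[of 0 n] n by simp
    have "- (real n * T) \<le> real n * T" using T by simp
    then show ?thesis
      using IVT'[of \<Theta> "- (real n * T)" \<theta> "real n * T"] lo hi cont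
      by (auto intro: continuous_at_imp_continuous_on)
  qed
  define \<tau> where "\<tau> = inv \<Theta>"
  have l: "\<tau> (\<Theta> t) = t" for t unfolding \<tau>_def by (rule inv_f_f[OF inj])
  have r: "\<Theta> (\<tau> \<theta>) = \<theta>" for \<theta> using surj[of \<theta>] l by auto
  have d: "(\<tau> has_real_derivative inverse (\<omega> (\<tau> \<theta>))) (at \<theta>)" for \<theta>
  proof (rule DERIV_inverse_function[where f = \<Theta> and a = "\<theta> - 1" and b = "\<theta> + 1"])
    have "isCont \<tau> (\<Theta> (\<tau> \<theta>))"
      by (rule isCont_inverse_function2[where f = \<Theta> and x = "\<tau> \<theta>" and a = "\<tau> \<theta> - 1" and b = "\<tau> \<theta> + 1"])
         (auto simp: l cont)
    then show "isCont \<tau> \<theta>" by (simp add: r)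
    show "\<omega> (\<tau> \<theta>) \<noteq> 0" using pos[of "\<tau> \<theta>"] by simp
  qed (use \<Theta> r in auto)
  have s: "\<tau> (\<theta> + C) = \<tau> \<theta> + T" for \<theta> using l[of "\<tau> \<theta> + T"] by (simp add: shift r)
  show ?thesis by (rule that[OF l r d s])
qed

section \<open>Perturbed oscillators in polar coordinates\<close>

text \<open>The system u' = y, y' = e f(u) y - g(u) with potential \<zeta>^2 / 2. In (\<zeta>(u), y)
  the unperturbed orbits are circles. \<open>\<zeta>_onto\<close> is asked only on the symmetric
  interval (-Z, Z), because the lower of the two saddle energies limits the radius.\<close>

locale oscillator =
  fixes A B Z :: real and \<zeta> \<gamma> d\<gamma> f df g :: "real \<Rightarrow> real"
  assumes \<zeta>': "\<And>u. \<lbrakk>A < u; u < B\<rbrakk> \<Longrightarrow> (\<zeta> has_real_derivative \<gamma> u) (at u)"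
    and \<gamma>': "\<And>u. \<lbrakk>A < u; u < B\<rbrakk> \<Longrightarrow> (\<gamma> has_real_derivative d\<gamma> u) (at u)"
    and f': "\<And>u. \<lbrakk>A < u; u < B\<rbrakk> \<Longrightarrow> (f has_real_derivative df u) (at u)"
    and cont_d\<gamma>: "continuous_on {A<..<B} d\<gamma>" and cont_df: "continuous_on {A<..<B} df"
    and \<gamma>_pos: "\<And>u. \<lbrakk>A < u; u < B\<rbrakk> \<Longrightarrow> \<gamma> u > 0"
    and g_eq: "\<And>u. \<lbrakk>A < u; u < B\<rbrakk> \<Longrightarrow> g u = \<zeta> u * \<gamma> u"
    and Z_pos: "Z > 0"
    and \<zeta>_onto: "\<And>z. \<lbrakk>- Z < z; z < Z\<rbrakk> \<Longrightarrow> \<exists>u. A < u \<and> u < B \<and> \<zeta> u = z"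
begin

definition "U z = (THE u. A < u \<and> u < B \<and> \<zeta> u = z)"

lemma \<zeta>_mono: "\<lbrakk>A < u; u < v; v < B\<rbrakk> \<Longrightarrow> \<zeta> u < \<zeta> v"
proof (rule DERIV_pos_imp_increasing[of u v])
  fix x assume "A < u" "v < B" "u \<le> x" "x \<le> v"
  then have "A < x" "x < B" by linarith+
  then show "\<exists>y. (\<zeta> has_real_derivative y) (at x) \<and> 0 < y" using \<zeta>' \<gamma>_pos by blast
qed

lemma U_\<zeta>: "\<lbrakk>A < u; u < B\<rbrakk> \<Longrightarrow> U (\<zeta> u) = u"
  unfolding U_def
proof (rule the_equality)
  fix v assume "A < u" "u < B" "A < v \<and> v < B \<and> \<zeta> v = \<zeta> u"
  then show "v = u" using \<zeta>_mono[of u v] \<zeta>_mono[of v u] by (cases u v rule: linorder_cases) auto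
qed simp

lemma U_range: assumes "- Z < z" "z < Z" shows "A < U z" "U z < B" "\<zeta> (U z) = z"
proof -
  obtain u where "A < u" "u < B" "\<zeta> u = z" using \<zeta>_onto[OF assms] by blast
  moreover have "U z = u" using U_\<zeta>[of u] calculation by simp
  ultimately show "A < U z" "U z < B" "\<zeta> (U z) = z" by simp_all
qed

lemma U_deriv:
  assumes "- Z < z" "z < Z"
  shows "(U has_real_derivative inverse (\<gamma> (U z))) (at z)"
proof (rule DERIV_inverse_function[where f = \<zeta> and a = "-Z" and b = Z])
  note R = U_range[OF assms]
  show "(\<zeta> has_real_derivative \<gamma> (U z)) (at (U z))" using R by (intro \<zeta>')
  show "\<gamma> (U z) \<noteq> 0" using \<gamma>_pos[of "U z"] R by simp
  have "isCont U (\<zeta> (U z))"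
  proof (rule isCont_inverse_function2[where f = \<zeta> and x = "U z" and a = "(A + U z)/2" and b = "(U z + B)/2"])
    fix u assume "(A + U z)/2 \<le> u" "u \<le> (U z + B)/2"
    then have "A < u" "u < B" using R by auto
    then show "U (\<zeta> u) = u" "isCont \<zeta> u" using U_\<zeta> \<zeta>' DERIV_isCont by blast+
  qed (use R in auto)
  then show "isCont U z" using R by simp
qed (use assms U_range in auto)

lemma U_cont: "continuous_on {-Z<..<Z} U"
  by (rule continuous_at_imp_continuous_on, rule ballI, rule DERIV_isCont, rule U_deriv; simp)

definition "F z = f (U z)"
definition "G z = \<gamma> (U z)"
definition "dF z = df (U z) * inverse (\<gamma> (U z))"
definition "dG z = d\<gamma> (U z) * inverse (\<gamma> (U z))"

lemma G_pos: "\<lbrakk>- Z < z; z < Z\<rbrakk> \<Longrightarrow> G z > 0"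
  unfolding G_def by (rule \<gamma>_pos[OF U_range(1,2)])

lemma F_deriv: "\<lbrakk>- Z < z; z < Z\<rbrakk> \<Longrightarrow> (F has_real_derivative dF z) (at z)"
  unfolding F_def dF_def by (rule DERIV_chain2[OF f'[OF U_range(1,2)] U_deriv])

lemma G_deriv: "\<lbrakk>- Z < z; z < Z\<rbrakk> \<Longrightarrow> (G has_real_derivative dG z) (at z)"
  unfolding G_def dG_def by (rule DERIV_chain2[OF \<gamma>'[OF U_range(1,2)] U_deriv])

lemma cont_F: "continuous_on {-Z<..<Z} F"
  by (rule continuous_at_imp_continuous_on, rule ballI, rule DERIV_isCont, rule F_deriv; simp)

lemma cont_G: "continuous_on {-Z<..<Z} G"
  by (rule continuous_at_imp_continuous_on, rule ballI, rule DERIV_isCont, rule G_deriv; simp)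

lemma cont_dF: "continuous_on {-Z<..<Z} dF"
proof -
  have "continuous_on {-Z<..<Z} (\<lambda>z. df (U z))"
    by (rule continuous_on_compose2[OF cont_df U_cont]) (use U_range in force)
  moreover have "G z \<noteq> 0" if "z \<in> {-Z<..<Z}" for z using G_pos[of z] that by simp
  ultimately have "continuous_on {-Z<..<Z} (\<lambda>z. df (U z) * inverse (G z))"
    by (auto intro!: continuous_on_mult continuous_on_inverse cont_G)
  then show ?thesis by (simp add: dF_def[abs_def] G_def)
qed

lemma cont_dG: "continuous_on {-Z<..<Z} dG"
proof -
  have "continuous_on {-Z<..<Z} (\<lambda>z. d\<gamma> (U z))"
    by (rule continuous_on_compose2[OF cont_d\<gamma> U_cont]) (use U_range in force)
  moreover have "G z \<noteq> 0" if "z \<in> {-Z<..<Z}" for z using G_pos[of z] that by simp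
  ultimately have "continuous_on {-Z<..<Z} (\<lambda>z. d\<gamma> (U z) * inverse (G z))"
    by (auto intro!: continuous_on_mult continuous_on_inverse cont_G)
  then show ?thesis by (simp add: dG_def[abs_def] G_def)
qed

lemma polar_bound:
  assumes "0 < r" "r < Z"
  shows "- Z < r * cos \<theta>" "r * cos \<theta> < Z"
proof -
  have "\<bar>r * cos \<theta>\<bar> \<le> r" using assms abs_cos_le_one[of \<theta>] by (simp add: abs_mult mult_left_le)
  then show "- Z < r * cos \<theta>" "r * cos \<theta> < Z" using assms by linarith+
qed

text \<open>The angular speed d\<theta>/dt in the coordinates z = r cos \<theta>, y = - r sin
  \<theta>. The radial speed is e r sin^2(\<theta>) F, so the quotient \<open>N\<close> describes
  the orbit with the angle as independent variable.\<close>

definition den :: "real \<Rightarrow> real \<Rightarrow> real \<Rightarrow> real" where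
  "den r \<theta> e = G (r * cos \<theta>) + e * F (r * cos \<theta>) * sin \<theta> * cos \<theta>"

definition N :: "real \<Rightarrow> real \<Rightarrow> real \<Rightarrow> real" where
  "N r \<theta> e = r * (sin \<theta>)^2 * F (r * cos \<theta>) / den r \<theta> e"

definition Nr :: "real \<Rightarrow> real \<Rightarrow> real \<Rightarrow> real" where
  "Nr r \<theta> e = (sin \<theta>)^2 * ((F (r * cos \<theta>) + r * (dF (r * cos \<theta>) * cos \<theta>)) * den r \<theta> e
     - r * F (r * cos \<theta>) * (dG (r * cos \<theta>) * cos \<theta> + e * (dF (r * cos \<theta>) * cos \<theta>) * sin \<theta> * cos \<theta>))
     / (den r \<theta> e)^2"

lemma den_pos_ex:
  assumes "0 < b" "b < Z"
  obtains e1 where "e1 > 0"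
    "\<And>r \<theta> e. \<lbrakk>0 < r; r \<le> b; 0 \<le> e; e \<le> e1\<rbrakk> \<Longrightarrow> den r \<theta> e > 0"
proof -
  have cont: "continuous_on {-b..b} G" "continuous_on {-b..b} (\<lambda>x. \<bar>F x\<bar>)"
  proof -
    have sub: "{-b..b} \<subseteq> {-Z<..<Z}" using assms by auto
    show "continuous_on {-b..b} G" by (rule continuous_on_subset[OF cont_G sub])
    show "continuous_on {-b..b} (\<lambda>x. \<bar>F x\<bar>)"
      by (intro continuous_on_rabs continuous_on_subset[OF cont_F sub])
  qed
  have ne: "{-b..b} \<noteq> {}" using assms by simp
  obtain p where p: "p \<in> {-b..b}" "\<And>x. x \<in> {-b..b} \<Longrightarrow> G p \<le> G x"
    using continuous_attains_inf[OF compact_Icc ne cont(1)] by blast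
  obtain q where q: "q \<in> {-b..b}" "\<And>x. x \<in> {-b..b} \<Longrightarrow> \<bar>F x\<bar> \<le> \<bar>F q\<bar>"
    using continuous_attains_sup[OF compact_Icc ne cont(2)] by blast
  \<comment> \<open>With this choice the perturbation of the angular speed is at most e1 |F q| < G
    p, the minimum of \<open>G\<close>; the summand 1 covers F q = 0.\<close>
  define e1 where "e1 = G p / (2 * (\<bar>F q\<bar> + 1))"
  have Gp: "G p > 0" using p assms by (intro G_pos) auto
  show ?thesis
  proof (rule that[of e1])
    show "e1 > 0" using Gp by (simp add: e1_def)
    fix r \<theta> e assume *: "0 < r" "r \<le> b" "0 \<le> e" "e \<le> e1"
    have "\<bar>r * cos \<theta>\<bar> \<le> r" using * abs_cos_le_one[of \<theta>] by (simp add: abs_mult mult_left_le)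
    then have x: "r * cos \<theta> \<in> {-b..b}" using * by auto
    have "\<bar>e * F (r * cos \<theta>) * sin \<theta> * cos \<theta>\<bar> = e * \<bar>F (r * cos \<theta>)\<bar> * (\<bar>sin \<theta>\<bar> * \<bar>cos \<theta>\<bar>)"
      using * by (simp add: abs_mult)
    also have "\<dots> \<le> e1 * \<bar>F q\<bar> * (1 * 1)"
      using * q(2)[OF x] \<open>e1 > 0\<close> by (intro mult_mono) auto
    also have "\<dots> < e1 * (2 * (\<bar>F q\<bar> + 1))" using \<open>e1 > 0\<close> by simp
    also have "\<dots> = G p" by (simp add: e1_def)
    also have "\<dots> \<le> G (r * cos \<theta>)" by (rule p(2)[OF x])
    finally show "den r \<theta> e > 0" by (simp add: den_def)
  qed
qed

lemma periodic_family_polar: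
  assumes ab: "0 < a" "a \<le> b" "b < Z" and e1: "e1 > 0"
    and den: "\<And>r \<theta> e. \<lbrakk>0 < r; r \<le> b; 0 \<le> e; e \<le> e1\<rbrakk> \<Longrightarrow> den r \<theta> e > 0"
  shows "periodic_family N Nr a b e1"
proof
  fix r \<theta> e assume r: "a \<le> r" "r \<le> b" "0 \<le> e" "e \<le> e1"
  note dom = polar_bound[of r \<theta>]
  have d: "den r \<theta> e > 0" using den r ab by auto
  have Fd: "((\<lambda>r. F (r * cos \<theta>)) has_real_derivative dF (r * cos \<theta>) * cos \<theta>) (at r)"
    by (rule DERIV_chain2[OF F_deriv]) (use dom r ab in \<open>auto intro!: derivative_eq_intros\<close>)
  have Gd: "((\<lambda>r. G (r * cos \<theta>)) has_real_derivative dG (r * cos \<theta>) * cos \<theta>) (at r)"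
    by (rule DERIV_chain2[OF G_deriv]) (use dom r ab in \<open>auto intro!: derivative_eq_intros\<close>)
  have dd: "((\<lambda>r. den r \<theta> e) has_real_derivative
      dG (r * cos \<theta>) * cos \<theta> + e * (dF (r * cos \<theta>) * cos \<theta>) * sin \<theta> * cos \<theta>) (at r)"
    unfolding den_def by (auto intro!: derivative_eq_intros Fd Gd)
  show "((\<lambda>r. N r \<theta> e) has_real_derivative Nr r \<theta> e) (at r)"
    unfolding N_def
    by (rule DERIV_cong[OF DERIV_divide[OF DERIV_mult[OF DERIV_cmult_right[OF DERIV_ident] Fd] dd]])
       (use d in \<open>auto simp: Nr_def power2_eq_square algebra_simps\<close>)
next
  let ?S = "{a..b} \<times> UNIV \<times> {0..e1} :: (real \<times> real \<times> real) set"
  have dom: "- Z < fst x * cos (fst (snd x))" "fst x * cos (fst (snd x)) < Z" if "x \<in> ?S" for x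
    using that polar_bound[of "fst x" "fst (snd x)"] ab by auto
  have c: "continuous_on ?S (\<lambda>x. h (fst x * cos (fst (snd x))))" if "continuous_on {-Z<..<Z} h" for h :: "real \<Rightarrow> real"
    by (rule continuous_on_compose2[OF that]) (use dom in \<open>auto intro!: continuous_intros\<close>)
  have cd: "continuous_on ?S (\<lambda>x. den (fst x) (fst (snd x)) (snd (snd x)))"
    unfolding den_def by (intro continuous_intros c cont_F cont_G)
  have ne: "\<forall>x\<in>?S. den (fst x) (fst (snd x)) (snd (snd x)) \<noteq> 0"
    using den ab by (force simp: less_imp_neq[symmetric])
  then have ne2: "\<forall>x\<in>?S. (den (fst x) (fst (snd x)) (snd (snd x)))^2 \<noteq> 0" by simp
  show "continuous_on ?S (\<lambda>(r, \<theta>, e). N r \<theta> e)"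
    unfolding split_beta N_def using ne by (intro continuous_intros c cd cont_F)
  show "continuous_on ?S (\<lambda>(r, \<theta>, e). Nr r \<theta> e)"
    unfolding split_beta Nr_def using ne2 by (intro continuous_intros c cd cont_F cont_dF cont_dG)
next
  fix r \<theta> e :: real
  show "N r (\<theta> + 2*pi) e = N r \<theta> e" "Nr r (\<theta> + 2*pi) e = Nr r \<theta> e"
    by (simp_all add: N_def Nr_def den_def)
qed (use ab e1 in auto)

definition "\<phi> z = F z / G z"

lemma cont_\<phi>: "continuous_on {-Z<..<Z} \<phi>"
proof -
  have "G z \<noteq> 0" if "z \<in> {-Z<..<Z}" for z using G_pos[of z] that by simp
  then show ?thesis unfolding \<phi>_def by (intro continuous_on_divide cont_F cont_G) auto
qed

lemma first_order:
  assumes r: "0 < r" "r < Z"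
  shows "integral {0..2*pi} (\<lambda>\<theta>. N r \<theta> 0) = r * integral {0..2*pi} (\<lambda>\<theta>. \<phi> (r * cos \<theta>) * (sin \<theta>)^2)"
    and "integral {0..2*pi} (\<lambda>\<theta>. Nr r \<theta> 0) = integral {0..2*pi} (\<lambda>\<theta>. \<phi> (r * cos \<theta>) * (cos \<theta>)^2)"
proof -
  have "(\<lambda>\<theta>. N r \<theta> 0) = (\<lambda>\<theta>. r * (\<phi> (r * cos \<theta>) * (sin \<theta>)^2))"
    by (auto simp: N_def den_def \<phi>_def)
  then show "integral {0..2*pi} (\<lambda>\<theta>. N r \<theta> 0) = r * integral {0..2*pi} (\<lambda>\<theta>. \<phi> (r * cos \<theta>) * (sin \<theta>)^2)"
    by simp
  note dom = polar_bound[OF r]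
  define d\<phi> where "d\<phi> z = (dF z * G z - F z * dG z) / (G z * G z)" for z
  have \<phi>d: "(\<phi> has_real_derivative d\<phi> z) (at z)" if "- Z < z" "z < Z" for z
    unfolding \<phi>_def d\<phi>_def using that G_pos[OF that]
    by (intro DERIV_divide F_deriv G_deriv) auto
  \<comment> \<open>In \<open>Nr r \<theta> 0\<close> the term with the derivative of
    \<open>\<phi>\<close> equals - sin \<theta> cos \<theta> times the \<theta>-derivative of
    \<phi>(r cos \<theta>). Integrating it by parts leaves the boundary term \<open>P\<close>, which
    is zero at both ends.\<close>
  define P where "P \<theta> = \<phi> (r * cos \<theta>) * (sin \<theta> * cos \<theta>)" for \<theta>
  have P': "(P has_real_derivative \<phi> (r * cos \<theta>) * (cos \<theta>)^2 - Nr r \<theta> 0) (at \<theta>)" for \<theta>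
  proof -
    have 1: "((\<lambda>\<theta>. \<phi> (r * cos \<theta>)) has_real_derivative d\<phi> (r * cos \<theta>) * (- (r * sin \<theta>))) (at \<theta>)"
      by (rule DERIV_chain2[OF \<phi>d]) (use dom in \<open>auto intro!: derivative_eq_intros\<close>)
    have 2: "((\<lambda>\<theta>. sin \<theta> * cos \<theta>) has_real_derivative (cos \<theta>)^2 - (sin \<theta>)^2) (at \<theta>)"
      by (auto intro!: derivative_eq_intros simp: power2_eq_square)
    have Nr0: "Nr r \<theta> 0 = (sin \<theta>)^2 * (\<phi> (r * cos \<theta>) + r * cos \<theta> * d\<phi> (r * cos \<theta>))"
      using G_pos[OF dom, of \<theta>]
      by (simp add: Nr_def den_def \<phi>_def d\<phi>_def field_simps power2_eq_square)
    show ?thesis unfolding P_def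
      by (rule DERIV_cong[OF DERIV_mult[OF 1 2]]) (simp add: Nr0 algebra_simps power2_eq_square)
  qed
  have "((\<lambda>\<theta>. \<phi> (r * cos \<theta>) * (cos \<theta>)^2 - Nr r \<theta> 0) has_integral P (2*pi) - P 0) {0..2*pi}"
    by (rule fundamental_theorem_of_calculus)
       (auto simp flip: has_real_derivative_iff_has_vector_derivative intro: has_field_derivative_at_within P')
  then have i: "((\<lambda>\<theta>. \<phi> (r * cos \<theta>) * (cos \<theta>)^2 - Nr r \<theta> 0) has_integral 0) {0..2*pi}"
    by (simp add: P_def)
  have "continuous_on {0..2*pi} (\<lambda>\<theta>. \<phi> (r * cos \<theta>) * (cos \<theta>)^2)"
    by (intro continuous_intros continuous_on_compose2[OF cont_\<phi>]) (use dom in auto)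
  then have j: "((\<lambda>\<theta>. \<phi> (r * cos \<theta>) * (cos \<theta>)^2) has_integral
      integral {0..2*pi} (\<lambda>\<theta>. \<phi> (r * cos \<theta>) * (cos \<theta>)^2)) {0..2*pi}"
    by (intro integrable_integral integrable_continuous_interval)
  from has_integral_diff[OF j i] show "integral {0..2*pi} (\<lambda>\<theta>. Nr r \<theta> 0) =
      integral {0..2*pi} (\<lambda>\<theta>. \<phi> (r * cos \<theta>) * (cos \<theta>)^2)"
    by (simp add: integral_unique)
qed

text \<open>By \<open>integral_cos_sq_pos\<close> the function s M has positive derivative at each
  of its zeros. This gives simplicity at once, and uniqueness of the zero through
  \<open>increasing_zero_unique\<close>.\<close>

theorem unique_polar_periodic:
  assumes rng: "0 < a" "a \<le> b" "b < Z" and s: "s \<noteq> 0"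
    and sign: "\<And>x y. \<lbrakk>0 < x; x < y; y < Z; s * (\<phi> x + \<phi> (-x)) \<ge> 0\<rbrakk> \<Longrightarrow> s * (\<phi> y + \<phi> (-y)) > 0"
  obtains e0 where "e0 > 0"
    "\<And>e R S. \<lbrakk>0 < e; e < e0; \<And>\<theta>. R \<theta> \<in> {a..b}; \<And>\<theta>. S \<theta> \<in> {a..b};
       \<And>\<theta>. (R has_real_derivative e * N (R \<theta>) \<theta> e) (at \<theta>);
       \<And>\<theta>. (S has_real_derivative e * N (S \<theta>) \<theta> e) (at \<theta>);
       R (2*pi) = R 0; S (2*pi) = S 0\<rbrakk> \<Longrightarrow> R = S"
proof -
  obtain e1 where e1: "e1 > 0"
    "\<And>r \<theta> e. \<lbrakk>0 < r; r \<le> b; 0 \<le> e; e \<le> e1\<rbrakk> \<Longrightarrow> den r \<theta> e > 0"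
    using den_pos_ex[of b] rng by auto
  interpret periodic_family N Nr a b e1
    by (rule periodic_family_polar) (use rng e1 in auto)
  have M'_sign: "s * M' r > 0" if "r \<in> {a..b}" "M r = 0" for r
  proof -
    have r: "0 < r" "r < Z" using that(1) rng by auto
    have "integral {0..2*pi} (\<lambda>\<theta>. \<phi> (r * cos \<theta>) * (sin \<theta>)^2) = 0"
      using that(2) r first_order(1)[OF r] by (simp add: M_def)
    from integral_cos_sq_pos[OF cont_\<phi> sign r this] show ?thesis
      by (simp add: M'_def first_order(2)[OF r])
  qed
  have M_deriv: "(M has_real_derivative M' r) (at r within {a..b})" if "r \<in> {a..b}" for r
  proof -
    have "((\<lambda>r. integral (cbox 0 (2*pi)) (\<lambda>\<theta>. N r \<theta> 0)) has_real_derivative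
      integral (cbox 0 (2*pi)) (\<lambda>\<theta>. Nr r \<theta> 0)) (at r within {a..b})"
    proof (rule leibniz_rule_field_derivative)
      show "((\<lambda>r. N r \<theta> 0) has_real_derivative Nr r \<theta> 0) (at r within {a..b})" if "r \<in> {a..b}" for r \<theta>
        using N'[of r 0 \<theta>] that e1 by (auto intro: has_field_derivative_at_within)
      have c: "continuous_on ({a..b} \<times> cbox 0 (2*pi)) ((\<lambda>(r, \<theta>, e). h r \<theta> e) \<circ> (\<lambda>(r, \<theta>). (r, \<theta>, 0)))"
        if "continuous_on ({a..b} \<times> UNIV \<times> {0..e1}) (\<lambda>(r, \<theta>, e). h r \<theta> e :: real)" for h
        by (rule continuous_on_compose[OF _ continuous_on_subset[OF that]])
           (use e1 in \<open>auto intro!: continuous_intros simp: split_beta\<close>)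
      show "continuous_on ({a..b} \<times> cbox 0 (2*pi)) (\<lambda>(r, \<theta>). Nr r \<theta> 0)"
        using c[OF contNr] by (simp add: o_def split_beta)
      show "(\<lambda>\<theta>. N r \<theta> 0) integrable_on cbox 0 (2*pi)" if "r \<in> {a..b}" for r
      proof (intro integrable_continuous)
        have "continuous_on (cbox 0 (2*pi)) ((\<lambda>(r, \<theta>, e). N r \<theta> e) \<circ> (\<lambda>\<theta>. (r, \<theta>, 0)))"
          by (rule continuous_on_compose[OF _ continuous_on_subset[OF contN]])
             (use that e1 in \<open>auto intro!: continuous_intros\<close>)
        then show "continuous_on (cbox 0 (2*pi)) (\<lambda>\<theta>. N r \<theta> 0)" by (simp add: o_def)
      qed
    qed (use that in auto)
    then show ?thesis by (simp add: M_def[abs_def] M'_def)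
  qed
  have uniq: "r = t" if "r \<in> {a..b}" "t \<in> {a..b}" "M r = 0" "M t = 0" for r t
  proof (rule increasing_zero_unique[where g = "\<lambda>r. s * M r" and g' = "\<lambda>r. s * M' r" and a = a and b = b])
    show "((\<lambda>r. s * M r) has_real_derivative s * M' x) (at x within {a..b})" if "x \<in> {a..b}" for x
      by (rule DERIV_cmult[OF M_deriv[OF that]])
    show "s * M' x > 0" if "x \<in> {a..b}" "s * M x = 0" for x
      by (rule M'_sign) (use that s in simp_all)
  qed (use that in simp_all)
  have nondeg: "M' r \<noteq> 0" if "r \<in> {a..b}" "M r = 0" for r
    using M'_sign[OF that] by auto
  obtain e0 where e0: "e0 > 0"
    "\<And>e R S. \<lbrakk>0 < e; e < e0; sol e R; sol e S; R (2*pi) = R 0; S (2*pi) = S 0\<rbrakk> \<Longrightarrow> R = S"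
    using unique_periodic[OF nondeg uniq] by blast
  show ?thesis
  proof (rule that[OF e0(1)])
    fix e R S
    assume "0 < e" "e < e0" "\<And>\<theta>. R \<theta> \<in> {a..b}" "\<And>\<theta>. S \<theta> \<in> {a..b}"
       "\<And>\<theta>. (R has_real_derivative e * N (R \<theta>) \<theta> e) (at \<theta>)"
       "\<And>\<theta>. (S has_real_derivative e * N (S \<theta>) \<theta> e) (at \<theta>)"
       "R (2*pi) = R 0" "S (2*pi) = S 0"
    moreover from this have "sol e R" "sol e S" unfolding sol_def by blast+
    ultimately show "R = S" using e0(2) by blast
  qed
qed

section \<open>Planar periodic orbits as curves in polar coordinates\<close>

definition field :: "real \<Rightarrow> real \<times> real \<Rightarrow> real \<times> real" where
  "field e p = (snd p, e * f (fst p) * snd p - g (fst p))"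

text \<open>The minus sign makes the angle increase with time, since orbits in the (u, y) plane run
  clockwise.\<close>

definition polar :: "real \<Rightarrow> real \<Rightarrow> real \<times> real" where
  "polar r \<theta> = (U (r * cos \<theta>), - (r * sin \<theta>))"

lemma solution_derivs:
  assumes "is_solution (field e) x"
  shows "((\<lambda>t. fst (x t)) has_real_derivative snd (x t)) (at t)"
    "((\<lambda>t. snd (x t)) has_real_derivative
       e * f (fst (x t)) * snd (x t) - g (fst (x t))) (at t)"
proof -
  have "(x has_vector_derivative field e (x t)) (at t)" using assms by (simp add: is_solution_def)
  from bounded_linear.has_vector_derivative[OF bounded_linear_fst this]
    bounded_linear.has_vector_derivative[OF bounded_linear_snd this]
  show "((\<lambda>t. fst (x t)) has_real_derivative snd (x t)) (at t)"
    "((\<lambda>t. snd (x t)) has_real_derivative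
       e * f (fst (x t)) * snd (x t) - g (fst (x t))) (at t)"
    by (simp_all add: field_def has_real_derivative_iff_has_vector_derivative)
qed

text \<open>The angle is lifted to the real line by integrating its speed and then inverted, so that
  it replaces time. During the given period T the orbit may wind several times;
  \<open>sol_period_one_turn\<close> reduces this to a single turn.\<close>

lemma periodic_orbit_polar:
  assumes rng: "0 < a" "a \<le> b" "b < Z" and e1: "e1 > 0" and e: "0 \<le> e" "e \<le> e1"
    and den: "\<And>r \<theta> e. \<lbrakk>0 < r; r \<le> b; 0 \<le> e; e \<le> e1\<rbrakk> \<Longrightarrow> den r \<theta> e > 0"
    and L: "periodic_orbit (field e) L"
    and L_sub: "L \<subseteq> {p. A < fst p \<and> fst p < B \<and> a \<le> sqrt ((\<zeta> (fst p))^2 + (snd p)^2) \<and>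
      sqrt ((\<zeta> (fst p))^2 + (snd p)^2) \<le> b}"
  obtains R where "\<And>\<theta>. R \<theta> \<in> {a..b}" "\<And>\<theta>. (R has_real_derivative e * N (R \<theta>) \<theta> e) (at \<theta>)"
    "R (2*pi) = R 0" "L = range (\<lambda>\<theta>. polar (R \<theta>) \<theta>)"
proof -
  obtain x T where x: "is_solution (field e) x" and T: "T > 0" and per: "\<And>t. x (t + T) = x t"
    and Lx: "L = range x" using L by (auto simp: periodic_orbit_def)
  define u where "u t = fst (x t)" for t
  define y where "y t = snd (x t)" for t
  define z where "z t = \<zeta> (u t)" for t
  define r where "r t = sqrt ((z t)^2 + (y t)^2)" for t
  have u_dom: "A < u t" "u t < B" for t using L_sub by (auto simp: Lx u_def)
  have r_rng: "a \<le> r t" "r t \<le> b" for t using L_sub by (auto simp: Lx u_def y_def z_def r_def)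
  have r_pos: "r t > 0" "r t < Z" for t using r_rng[of t] rng by auto
  have r_sq: "(r t)^2 = (z t)^2 + (y t)^2" for t by (simp add: r_def)
  have "\<bar>z t\<bar> \<le> r t" for t unfolding r_def by (rule real_le_rsqrt) simp
  then have z_dom: "- Z < z t" "z t < Z" for t using r_pos[of t] by (smt (verit))+
  have U_z: "U (z t) = u t" for t unfolding z_def by (rule U_\<zeta>[OF u_dom])
  have u': "(u has_real_derivative y t) (at t)" for t
    using solution_derivs(1)[OF x, of t] by (simp add: u_def[abs_def] y_def)
  have y': "(y has_real_derivative e * F (z t) * y t - z t * G (z t)) (at t)" for t
    using solution_derivs(2)[OF x, of t] g_eq[OF u_dom, of t]
    by (simp add: y_def[abs_def] z_def F_def G_def U_\<zeta>[OF u_dom]) (simp add: u_def)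
  have z': "(z has_real_derivative G (z t) * y t) (at t)" for t
    unfolding z_def[abs_def] using DERIV_chain2[OF \<zeta>'[OF u_dom] u', of t]
    by (simp add: G_def U_\<zeta> u_dom)
  have r': "(r has_real_derivative e * F (z t) * (y t)^2 / r t) (at t)" for t
  proof -
    have "((\<lambda>t. (z t)^2 + (y t)^2) has_real_derivative 2 * (e * F (z t) * (y t)^2)) (at t)"
      by (auto intro!: derivative_eq_intros z' y' simp: algebra_simps power2_eq_square)
    moreover have pos: "(z t)^2 + (y t)^2 > 0" unfolding r_sq[symmetric] using r_pos[of t] by simp
    ultimately have "((\<lambda>t. sqrt ((z t)^2 + (y t)^2)) has_real_derivative
        inverse (sqrt ((z t)^2 + (y t)^2)) / 2 * (2 * (e * F (z t) * (y t)^2))) (at t)"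
      by (intro DERIV_chain2[OF DERIV_real_sqrt])
    then have "(r has_real_derivative inverse (r t) / 2 * (2 * (e * F (z t) * (y t)^2))) (at t)"
      by (simp only: r_def[abs_def])
    moreover have "inverse (r t) / 2 * (2 * X) = X / r t" for X using r_pos[of t] by (simp add: field_simps)
    ultimately show ?thesis by (simp only:)
  qed
  \<comment> \<open>The angular speed (y z' - z y') / r^2 of the point (z, -y), simplified by the
    equations of motion.\<close>
  define \<omega> where "\<omega> t = G (z t) - e * F (z t) * (z t * y t / (r t)^2)" for t
  have cz: "continuous_on UNIV z" "continuous_on UNIV y" "continuous_on UNIV r"
    by (rule continuous_at_imp_continuous_on, rule ballI, rule DERIV_isCont,
        rule z' y' r')+
  have "continuous_on UNIV (\<lambda>t. G (z t))" "continuous_on UNIV (\<lambda>t. F (z t))"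
    by (rule continuous_on_compose2[OF cont_G cz(1)], use z_dom in auto)
       (rule continuous_on_compose2[OF cont_F cz(1)], use z_dom in auto)
  moreover have "r t \<noteq> 0" for t using r_pos[of t] by simp
  ultimately have "continuous_on UNIV \<omega>"
    unfolding \<omega>_def by (intro continuous_intros cz) simp_all
  then obtain P where P: "\<And>t. (P has_real_derivative \<omega> t) (at t)" using antiderivative_real by blast
  define p where "p t = z t / r t" for t
  define q where "q t = - (y t / r t)" for t
  have pq: "(p t)^2 + (q t)^2 = 1" for t
    using r_pos[of t] by (simp add: p_def q_def power_divide flip: add_divide_distrib r_sq)
  have p': "(p has_real_derivative - (q t * \<omega> t)) (at t)" for t
  proof -
    have "(G (z t) * y t * r t - z t * (e * F (z t) * (y t)^2 / r t)) / (r t * r t) = - (q t * \<omega> t)"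
      using r_pos[of t] by (simp add: q_def \<omega>_def field_simps power2_eq_square)
    with DERIV_divide[OF z'[of t] r'[of t]] r_pos[of t] show ?thesis
      unfolding p_def[abs_def] by simp
  qed
  have q': "(q has_real_derivative p t * \<omega> t) (at t)" for t
  proof -
    have "- (((e * F (z t) * y t - z t * G (z t)) * r t - y t * (e * F (z t) * (y t)^2 / r t)) / (r t * r t))
        = (z t * G (z t) * (r t)^2 - e * F (z t) * y t * ((r t)^2 - (y t)^2)) / (r t)^3"
      using r_pos[of t] by (simp add: field_simps power2_eq_square power3_eq_cube)
    also have "(r t)^2 - (y t)^2 = (z t)^2" by (simp add: r_sq)
    also have "(z t * G (z t) * (r t)^2 - e * F (z t) * y t * (z t)^2) / (r t)^3 = p t * \<omega> t"
      using r_pos[of t] by (simp add: p_def \<omega>_def field_simps power2_eq_square power3_eq_cube)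
    finally have *: "- (((e * F (z t) * y t - z t * G (z t)) * r t - y t * (e * F (z t) * (y t)^2 / r t)) / (r t * r t))
        = p t * \<omega> t" .
    from DERIV_minus[OF DERIV_divide[OF y'[of t] r'[of t]]] r_pos[of t] show ?thesis
      unfolding q_def[abs_def] * by simp
  qed
  obtain \<alpha> where \<alpha>: "p 0 = cos \<alpha>" "q 0 = sin \<alpha>" using sincos_total_2pi[OF pq[of 0]] by metis
  define \<Theta> where "\<Theta> t = P t - P 0 + \<alpha>" for t
  have \<Theta>': "(\<Theta> has_real_derivative \<omega> t) (at t)" for t
    unfolding \<Theta>_def by (auto intro!: derivative_eq_intros P)
  \<comment> \<open>Both (p, q) and (cos \<Theta>, sin \<Theta>) are unit vectors rotating with
    speed \<omega>, so their inner product is constant. It is 1 at time 0, which forces equality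
    without any branch of the arctangent.\<close>
  have "p t * cos (\<Theta> t) + q t * sin (\<Theta> t) = p 0 * cos (\<Theta> 0) + q 0 * sin (\<Theta> 0)" for t
  proof (rule DERIV_isconst_all[where f = "\<lambda>t. p t * cos (\<Theta> t) + q t * sin (\<Theta> t)"])
    show "\<forall>t. ((\<lambda>t. p t * cos (\<Theta> t) + q t * sin (\<Theta> t)) has_real_derivative 0) (at t)"
      by (auto intro!: derivative_eq_intros p' q' \<Theta>' simp: algebra_simps)
  qed
  then have one: "p t * cos (\<Theta> t) + q t * sin (\<Theta> t) = 1" for t
    by (simp add: \<Theta>_def \<alpha> flip: power2_eq_square)
  have angle: "p t = cos (\<Theta> t)" "q t = sin (\<Theta> t)" for t
  proof -
    have "(p t - cos (\<Theta> t))^2 + (q t - sin (\<Theta> t))^2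
        = ((p t)^2 + (q t)^2) + ((cos (\<Theta> t))^2 + (sin (\<Theta> t))^2) - 2 * (p t * cos (\<Theta> t) + q t * sin (\<Theta> t))"
      by (simp add: power2_diff algebra_simps)
    also have "\<dots> = 0" by (simp add: pq one)
    finally show "p t = cos (\<Theta> t)" "q t = sin (\<Theta> t)" by (simp_all add: sum_power2_eq_zero_iff)
  qed
  have zy: "z t = r t * cos (\<Theta> t)" "y t = - (r t * sin (\<Theta> t))" for t
    using angle[of t] r_pos[of t] by (simp_all add: p_def q_def field_simps)
  have \<omega>_den: "\<omega> t = den (r t) (\<Theta> t) e" for t
  proof -
    have "z t * y t / (r t)^2 = - (sin (\<Theta> t) * cos (\<Theta> t))"
      using r_pos[of t] by (simp add: zy power2_eq_square)
    then show ?thesis by (simp add: \<omega>_def den_def zy(1)[symmetric] mult.assoc)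
  qed
  have \<omega>_pos: "\<omega> t > 0" for t unfolding \<omega>_den using r_pos[of t] r_rng[of t] e by (intro den)
  have x_polar: "x t = polar (r t) (\<Theta> t)" for t
    by (simp add: polar_def U_z flip: zy) (simp add: u_def y_def)
  have per': "u (t + T) = u t" "y (t + T) = y t" "z (t + T) = z t" "r (t + T) = r t"
    "\<omega> (t + T) = \<omega> t" for t
    by (simp_all add: u_def y_def z_def r_def \<omega>_def per)
  define C where "C = \<Theta> T - \<Theta> 0"
  have shift: "\<Theta> (t + T) = \<Theta> t + C" for t
  proof -
    have "\<Theta> (t + T) - \<Theta> t = \<Theta> (0 + T) - \<Theta> 0"
    proof (rule DERIV_isconst_all[where f = "\<lambda>t. \<Theta> (t + T) - \<Theta> t"])
      have "((\<lambda>t. \<Theta> (t + T)) has_real_derivative \<omega> t) (at t)" for t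
        using \<Theta>'[of "t + T"] by (simp add: DERIV_shift per')
      from DERIV_diff[OF this \<Theta>'] show "\<forall>t. ((\<lambda>t. \<Theta> (t + T) - \<Theta> t) has_real_derivative 0) (at t)"
        by simp
    qed
    then show ?thesis by (simp add: C_def)
  qed
  obtain \<tau> where \<tau>: "\<And>t. \<tau> (\<Theta> t) = t" "\<And>\<theta>. \<Theta> (\<tau> \<theta>) = \<theta>"
    "\<And>\<theta>. (\<tau> has_real_derivative inverse (\<omega> (\<tau> \<theta>))) (at \<theta>)" "\<And>\<theta>. \<tau> (\<theta> + C) = \<tau> \<theta> + T"
    using inverse_of_increasing_shift[OF \<Theta>' \<omega>_pos shift T] by blast
  have "C > 0"
  proof -
    have "\<Theta> 0 < \<Theta> T"
      by (rule DERIV_pos_imp_increasing[OF T]) (use \<Theta>' \<omega>_pos in blast)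
    then show ?thesis by (simp add: C_def)
  qed
  \<comment> \<open>After the period T the position repeats, so the angle has changed by a whole
    number of turns, and this number is positive because the angle increases.\<close>
  moreover have "sin (\<Theta> T) = sin (\<Theta> 0) \<and> cos (\<Theta> T) = cos (\<Theta> 0)"
    using per'(2,3,4)[of 0] by (simp add: p_def q_def flip: angle)
  then obtain n :: int where "\<Theta> T = \<Theta> 0 + 2 * pi * n" using sin_cos_eq_iff by blast
  ultimately have C: "C = 2 * pi * n" "n > 0"
    by (auto simp: C_def zero_less_mult_iff)
  \<comment> \<open>\<open>sol_period_one_turn\<close> counts \<open>Suc m\<close> turns.\<close>
  define m where "m = nat n - 1"
  have Cm: "C = 2 * pi * real (Suc m)" using C by (simp add: m_def)
  define R where "R \<theta> = r (\<tau> \<theta>)" for \<theta>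
  have R_rng: "R \<theta> \<in> {a..b}" for \<theta> using r_rng by (simp add: R_def)
  have R': "(R has_real_derivative e * N (R \<theta>) \<theta> e) (at \<theta>)" for \<theta>
  proof -
    have "e * F (z (\<tau> \<theta>)) * (y (\<tau> \<theta>))^2 / r (\<tau> \<theta>) * inverse (\<omega> (\<tau> \<theta>)) = e * N (R \<theta>) \<theta> e"
      using r_pos[of "\<tau> \<theta>"] unfolding N_def R_def \<omega>_den zy \<tau>(2)
      by (simp add: field_simps power2_eq_square)
    with DERIV_chain2[OF r' \<tau>(3), of \<theta>] show ?thesis unfolding R_def[abs_def] by simp
  qed
  interpret periodic_family N Nr a b e1 by (rule periodic_family_polar) (use rng e1 den in auto)
  have "R (0 + 2*pi) = R 0"
  proof (rule sol_period_one_turn[where m = m])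
    show "sol e R" using R_rng R' unfolding sol_def by blast
    show "R (\<theta> + 2 * pi * real (Suc m)) = R \<theta>" for \<theta>
      using \<tau>(4)[of \<theta>] per'(4) by (simp only: R_def Cm)
  qed (use e in auto)
  moreover have "L = range (\<lambda>\<theta>. polar (R \<theta>) \<theta>)"
    unfolding Lx
  proof (intro equalityI subsetI)
    fix v assume "v \<in> range x"
    then obtain t where "v = x t" by blast
    then have "v = polar (R (\<Theta> t)) (\<Theta> t)" by (simp add: x_polar R_def \<tau>(1))
    then show "v \<in> range (\<lambda>\<theta>. polar (R \<theta>) \<theta>)" by blast
  next
    fix v assume "v \<in> range (\<lambda>\<theta>. polar (R \<theta>) \<theta>)"
    then obtain \<theta> where "v = polar (R \<theta>) \<theta>" by blast
    then have "v = x (\<tau> \<theta>)" by (simp add: x_polar R_def \<tau>(2))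
    then show "v \<in> range x" by blast
  qed
  ultimately show ?thesis using that[OF R_rng R'] by simp
qed

lemma annulus_bounds:
  assumes K: "compact K" "K \<noteq> {}" and dom: "\<And>p. p \<in> K \<Longrightarrow> A < fst p \<and> fst p < B"
    and rng: "\<And>p. p \<in> K \<Longrightarrow> 0 < (\<zeta> (fst p))^2 + (snd p)^2 \<and> (\<zeta> (fst p))^2 + (snd p)^2 < Z^2"
  obtains a b where "0 < a" "a \<le> b" "b < Z"
    "\<And>p. p \<in> K \<Longrightarrow> a \<le> sqrt ((\<zeta> (fst p))^2 + (snd p)^2) \<and> sqrt ((\<zeta> (fst p))^2 + (snd p)^2) \<le> b"
proof -
  define \<rho> where "\<rho> p = sqrt ((\<zeta> (fst p))^2 + (snd p)^2)" for p :: "real \<times> real"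
  have "continuous_on {A<..<B} \<zeta>"
    by (intro continuous_at_imp_continuous_on ballI DERIV_isCont[OF \<zeta>']) auto
  then have "continuous_on K (\<lambda>p. \<zeta> (fst p))"
    by (rule continuous_on_compose2) (use dom in \<open>auto intro!: continuous_intros\<close>)
  then have cont: "continuous_on K \<rho>" unfolding \<rho>_def by (intro continuous_intros)
  obtain p where p: "p \<in> K" "\<And>v. v \<in> K \<Longrightarrow> \<rho> p \<le> \<rho> v"
    using continuous_attains_inf[OF K cont] by blast
  obtain q where q: "q \<in> K" "\<And>v. v \<in> K \<Longrightarrow> \<rho> v \<le> \<rho> q"
    using continuous_attains_sup[OF K cont] by blast
  show ?thesis
  proof (rule that[of "\<rho> p" "\<rho> q"])
    show "0 < \<rho> p" using rng[OF p(1)] by (simp add: \<rho>_def)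
    show "\<rho> p \<le> \<rho> q" using p q by blast
    have "\<rho> q < sqrt (Z^2)" unfolding \<rho>_def using rng[OF q(1)] real_sqrt_less_mono by blast
    then show "\<rho> q < Z" using Z_pos by simp
  qed (use p q in \<open>auto simp: \<rho>_def\<close>)
qed

theorem unique_periodic_orbit:
  assumes K: "compact K" and dom: "\<And>p. p \<in> K \<Longrightarrow> A < fst p \<and> fst p < B"
    and rng: "\<And>p. p \<in> K \<Longrightarrow> 0 < (\<zeta> (fst p))^2 + (snd p)^2 \<and> (\<zeta> (fst p))^2 + (snd p)^2 < Z^2"
    and s: "s \<noteq> 0"
    and sign: "\<And>x y. \<lbrakk>0 < x; x < y; y < Z; s * (\<phi> x + \<phi> (-x)) \<ge> 0\<rbrakk> \<Longrightarrow> s * (\<phi> y + \<phi> (-y)) > 0"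
  obtains e0 where "e0 > 0"
    "\<And>e L1 L2. \<lbrakk>0 < e; e < e0; periodic_orbit (field e) L1; L1 \<subseteq> K;
       periodic_orbit (field e) L2; L2 \<subseteq> K\<rbrakk> \<Longrightarrow> L1 = L2"
proof (cases "K = {}")
  case True
  then show ?thesis using that[of 1] by auto
next
  case False
  obtain a b where ab: "0 < a" "a \<le> b" "b < Z" and
    Kab: "\<And>p. p \<in> K \<Longrightarrow> a \<le> sqrt ((\<zeta> (fst p))^2 + (snd p)^2) \<and> sqrt ((\<zeta> (fst p))^2 + (snd p)^2) \<le> b"
    using annulus_bounds[OF K False dom rng] by blast
  have K_sub: "K \<subseteq> {p. A < fst p \<and> fst p < B \<and> a \<le> sqrt ((\<zeta> (fst p))^2 + (snd p)^2) \<and>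
      sqrt ((\<zeta> (fst p))^2 + (snd p)^2) \<le> b}"
    using dom Kab by blast
  obtain e1 where e1: "e1 > 0"
    "\<And>r \<theta> e. \<lbrakk>0 < r; r \<le> b; 0 \<le> e; e \<le> e1\<rbrakk> \<Longrightarrow> den r \<theta> e > 0"
    using den_pos_ex[of b] ab by auto
  obtain e0 where e0: "e0 > 0"
    "\<And>e R S. \<lbrakk>0 < e; e < e0; \<And>\<theta>. R \<theta> \<in> {a..b}; \<And>\<theta>. S \<theta> \<in> {a..b};
       \<And>\<theta>. (R has_real_derivative e * N (R \<theta>) \<theta> e) (at \<theta>);
       \<And>\<theta>. (S has_real_derivative e * N (S \<theta>) \<theta> e) (at \<theta>);
       R (2*pi) = R 0; S (2*pi) = S 0\<rbrakk> \<Longrightarrow> R = S"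
    by (rule unique_polar_periodic[OF ab s], rule sign, assumption+, blast)
  show ?thesis
  proof (rule that[of "min e0 e1"])
    show "min e0 e1 > 0" using e0 e1 by simp
    fix e L1 L2
    assume e: "0 < e" "e < min e0 e1" and L1: "periodic_orbit (field e) L1" "L1 \<subseteq> K"
      and L2: "periodic_orbit (field e) L2" "L2 \<subseteq> K"
    have e': "0 \<le> e" "e \<le> e1" "e < e0" using e by auto
    have ex: "\<exists>R. (\<forall>\<theta>. R \<theta> \<in> {a..b}) \<and> (\<forall>\<theta>. (R has_real_derivative e * N (R \<theta>) \<theta> e) (at \<theta>)) \<and>
        R (2*pi) = R 0 \<and> L = range (\<lambda>\<theta>. polar (R \<theta>) \<theta>)"
      if L: "periodic_orbit (field e) L" "L \<subseteq> K" for L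
    proof (rule periodic_orbit_polar[OF ab e1(1) e'(1,2) _ L(1) order_trans[OF L(2) K_sub]])
      show "den r \<theta> e > 0" if "0 < r" "r \<le> b" "0 \<le> e" "e \<le> e1" for r \<theta> e
        by (rule e1(2)[OF that])
    qed blast
    obtain R where R: "\<And>\<theta>. R \<theta> \<in> {a..b}" "\<And>\<theta>. (R has_real_derivative e * N (R \<theta>) \<theta> e) (at \<theta>)"
      "R (2*pi) = R 0" "L1 = range (\<lambda>\<theta>. polar (R \<theta>) \<theta>)"
      using ex[OF L1] by blast
    obtain S where S: "\<And>\<theta>. S \<theta> \<in> {a..b}" "\<And>\<theta>. (S has_real_derivative e * N (S \<theta>) \<theta> e) (at \<theta>)"
      "S (2*pi) = S 0" "L2 = range (\<lambda>\<theta>. polar (S \<theta>) \<theta>)"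
      using ex[OF L2] by blast
    have "R = S" by (rule e0(2)[OF e(1) e'(3) R(1) S(1) R(2) S(2) R(3) S(3)])
    then show "L1 = L2" using R(4) S(4) by simp
  qed
qed

text \<open>Without damping each circle is invariant. The travel time along it is the integral of
  1/G over the angle, and inverting this function yields the motion.\<close>

lemma circle_periodic_orbit:
  assumes r: "0 < r" "r < Z" and f0: "\<And>u. \<lbrakk>A < u; u < B\<rbrakk> \<Longrightarrow> f u = 0"
  shows "periodic_orbit (field e) (range (polar r))"
proof -
  note dom = polar_bound[OF r]
  have G_pos': "G (r * cos \<theta>) > 0" for \<theta> by (rule G_pos[OF dom])
  have "continuous_on UNIV (\<lambda>\<theta>. inverse (G (r * cos \<theta>)))"
    by (intro continuous_intros continuous_on_compose2[OF cont_G])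
       (use dom less_imp_neq[OF G_pos'] in auto)
  then obtain \<tau> where \<tau>': "\<And>\<theta>. (\<tau> has_real_derivative inverse (G (r * cos \<theta>))) (at \<theta>)"
    using antiderivative_real by blast
  define T where "T = \<tau> (2*pi) - \<tau> 0"
  have shift: "\<tau> (\<theta> + 2*pi) = \<tau> \<theta> + T" for \<theta>
  proof -
    have "\<tau> (\<theta> + 2*pi) - \<tau> \<theta> = \<tau> (0 + 2*pi) - \<tau> 0"
    proof (rule DERIV_isconst_all[where f = "\<lambda>\<theta>. \<tau> (\<theta> + 2*pi) - \<tau> \<theta>"])
      have "((\<lambda>\<theta>. \<tau> (\<theta> + 2*pi)) has_real_derivative inverse (G (r * cos \<theta>))) (at \<theta>)" for \<theta>
        using \<tau>'[of "\<theta> + 2*pi"] by (simp add: DERIV_shift)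
      from DERIV_diff[OF this \<tau>'] show "\<forall>\<theta>. ((\<lambda>\<theta>. \<tau> (\<theta> + 2*pi) - \<tau> \<theta>) has_real_derivative 0) (at \<theta>)"
        by simp
    qed
    then show ?thesis by (simp add: T_def)
  qed
  have inv_pos: "inverse (G (r * cos \<theta>)) > 0" for \<theta> using G_pos' by simp
  obtain \<Theta> where \<Theta>: "\<And>\<theta>. \<Theta> (\<tau> \<theta>) = \<theta>" "\<And>t. \<tau> (\<Theta> t) = t"
    "\<And>t. (\<Theta> has_real_derivative inverse (inverse (G (r * cos (\<Theta> t))))) (at t)"
    "\<And>t. \<Theta> (t + T) = \<Theta> t + 2*pi"
    using inverse_of_increasing_shift[OF \<tau>' inv_pos shift] by auto
  have \<Theta>': "(\<Theta> has_real_derivative G (r * cos (\<Theta> t))) (at t)" for t using \<Theta>(3)[of t] by simp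
  have "T > 0"
  proof -
    have "\<tau> 0 < \<tau> (2*pi)"
      by (rule DERIV_pos_imp_increasing[of 0 "2*pi" \<tau>]) (use \<tau>' inv_pos in \<open>simp, blast\<close>)
    then show ?thesis by (simp add: T_def)
  qed
  define x where "x t = polar r (\<Theta> t)" for t
  have "is_solution (field e) x"
    unfolding is_solution_def
  proof
    fix t
    have "((\<lambda>t. r * cos (\<Theta> t)) has_real_derivative - (r * sin (\<Theta> t) * G (r * cos (\<Theta> t)))) (at t)"
      by (auto intro!: derivative_eq_intros \<Theta>')
    from DERIV_chain2[OF U_deriv[OF dom] this]
    have 1: "((\<lambda>t. U (r * cos (\<Theta> t))) has_real_derivative - (r * sin (\<Theta> t))) (at t)"
    proof (rule DERIV_cong)
      show "inverse (\<gamma> (U (r * cos (\<Theta> t)))) * - (r * sin (\<Theta> t) * G (r * cos (\<Theta> t))) = - (r * sin (\<Theta> t))"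
        using G_pos'[of "\<Theta> t"] by (simp add: G_def)
    qed
    have 2: "((\<lambda>t. - (r * sin (\<Theta> t))) has_real_derivative - (r * cos (\<Theta> t) * G (r * cos (\<Theta> t)))) (at t)"
      by (auto intro!: derivative_eq_intros \<Theta>')
    have "field e (x t) = (- (r * sin (\<Theta> t)), - (r * cos (\<Theta> t) * G (r * cos (\<Theta> t))))"
      using U_range[OF dom, of "\<Theta> t"] by (simp add: field_def x_def polar_def f0 G_def g_eq)
    with has_vector_derivative_Pair[OF 1[unfolded has_real_derivative_iff_has_vector_derivative]
        2[unfolded has_real_derivative_iff_has_vector_derivative]]
    show "(x has_vector_derivative field e (x t)) (at t)" by (simp add: x_def[abs_def] polar_def)
  qed
  moreover have "x (t + T) = x t" for t by (simp add: x_def \<Theta>(4) polar_def)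
  moreover have "x (\<tau> (pi/2)) \<noteq> x (\<tau> 0)" using r by (simp add: x_def \<Theta>(1) polar_def)
  moreover have "range (polar r) = range x"
  proof -
    have "range x = polar r ` range \<Theta>" by (simp add: x_def[abs_def] image_image)
    also have "range \<Theta> = UNIV" by (rule surjI[where f = \<tau>]) (rule \<Theta>(1))
    finally show ?thesis by simp
  qed
  ultimately show ?thesis unfolding periodic_orbit_def using \<open>T > 0\<close> by blast
qed

lemma polar_radius:
  assumes "0 < r" "r < Z"
  shows "(\<zeta> (fst (polar r \<theta>)))^2 + (snd (polar r \<theta>))^2 = r^2"
proof -
  have "(r * cos \<theta>)^2 + (r * sin \<theta>)^2 = r^2 * ((cos \<theta>)^2 + (sin \<theta>)^2)"
    by (simp only: power_mult_distrib distrib_left)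
  then show ?thesis using U_range(3)[OF polar_bound[OF assms]] by (simp add: polar_def)
qed

text \<open>For f = 0 the radius is constant, so L is a circle; by uniform continuity slightly
  larger circles, again periodic orbits, lie in any isolating neighbourhood of L.\<close>

lemma not_limit_cycle:
  assumes f0: "\<And>u. \<lbrakk>A < u; u < B\<rbrakk> \<Longrightarrow> f u = 0"
    and L: "limit_cycle (field e) L" and "e \<ge> 0"
    and dom: "\<And>p. p \<in> L \<Longrightarrow> A < fst p \<and> fst p < B"
    and rng: "\<And>p. p \<in> L \<Longrightarrow> 0 < (\<zeta> (fst p))^2 + (snd p)^2 \<and> (\<zeta> (fst p))^2 + (snd p)^2 < Z^2"
  shows False
proof -
  have po: "periodic_orbit (field e) L" using L by (simp add: limit_cycle_def)
  obtain W where W: "open W" "L \<subseteq> W" "\<And>L'. \<lbrakk>periodic_orbit (field e) L'; L' \<subseteq> W\<rbrakk> \<Longrightarrow> L' = L"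
    using L by (auto simp: limit_cycle_def)
  obtain x T where x: "is_solution (field e) x" and T: "T > 0" and per: "\<And>t. x (t + T) = x t"
    and Lx: "L = range x" using po by (auto simp: periodic_orbit_def)
  have cx: "continuous_on X x" for X
    using x by (intro continuous_at_imp_continuous_on ballI has_vector_derivative_continuous)
       (auto simp: is_solution_def)
  have "L = x ` {0..T}"
  proof -
    have "x t \<in> x ` {0..T}" for t using periodic_reduce[of T x t] T per by (metis imageI)
    then show ?thesis by (auto simp: Lx)
  qed
  then have cL: "compact L" using compact_continuous_image[OF cx compact_Icc] by simp
  have ne: "L \<noteq> {}" by (simp add: Lx)
  obtain a b where ab: "0 < a" "a \<le> b" "b < Z" and
    Lab: "\<And>p. p \<in> L \<Longrightarrow> a \<le> sqrt ((\<zeta> (fst p))^2 + (snd p)^2) \<and> sqrt ((\<zeta> (fst p))^2 + (snd p)^2) \<le> b"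
    using annulus_bounds[OF cL ne dom rng] by blast
  have F0: "F (r * cos \<theta>) = 0" if "0 < r" "r < Z" for r \<theta>
    unfolding F_def by (intro f0 U_range polar_bound that)
  have den: "den r \<theta> e > 0" if "0 < r" "r \<le> b" for r \<theta> e
    unfolding den_def using F0[of r \<theta>] G_pos polar_bound[of r \<theta>] that ab by simp
  have L_sub: "L \<subseteq> {p. A < fst p \<and> fst p < B \<and> a \<le> sqrt ((\<zeta> (fst p))^2 + (snd p)^2) \<and>
      sqrt ((\<zeta> (fst p))^2 + (snd p)^2) \<le> b}"
    using dom Lab by blast
  have "\<exists>R. (\<forall>\<theta>. R \<theta> \<in> {a..b}) \<and> (\<forall>\<theta>. (R has_real_derivative e * N (R \<theta>) \<theta> e) (at \<theta>)) \<and>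
      L = range (\<lambda>\<theta>. polar (R \<theta>) \<theta>)"
  \<comment> \<open>With \<open>F\<close> zero the angular speed is positive for every e, so any
    positive parameter bound above the given e will do, here e + 1.\<close>
  proof (rule periodic_orbit_polar[OF ab _ _ _ _ po L_sub, of "e + 1"])
    show "den r \<theta> e > 0" if "0 < r" "r \<le> b" for r \<theta> e by (rule den[OF that])
  qed (use \<open>e \<ge> 0\<close> in \<open>simp, simp, simp, blast\<close>)
  then obtain R where R: "\<And>\<theta>. R \<theta> \<in> {a..b}" "\<And>\<theta>. (R has_real_derivative e * N (R \<theta>) \<theta> e) (at \<theta>)"
    "L = range (\<lambda>\<theta>. polar (R \<theta>) \<theta>)"
    by blast
  have "(R has_real_derivative 0) (at \<theta>)" for \<theta>
    using R(2)[of \<theta>] R(1)[of \<theta>] ab F0[of "R \<theta>" \<theta>] by (simp add: N_def)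
  then have "R \<theta> = R 0" for \<theta> by (intro DERIV_isconst_all[where f = R]) auto
  then obtain r where r: "\<And>\<theta>. R \<theta> = r" by blast
  have r0: "0 < r" "r < Z" using R(1)[of 0] ab by (auto simp: r)
  have Lr: "L = range (polar r)" using R(3) by (simp add: r)
  obtain \<epsilon> where \<epsilon>: "\<epsilon> > 0" "(\<Union>v\<in>L. ball v \<epsilon>) \<subseteq> W"
    using compact_subset_open_imp_ball_epsilon_subset[OF cL W(1,2)] by blast
  define c where "c = (r + Z)/2"
  have c: "r < c" "c < Z" using r0 by (auto simp: c_def)
  have dom': "- Z < fst v * cos (snd v)" "fst v * cos (snd v) < Z" if "v \<in> {r..c} \<times> {0..2*pi}" for v
    using polar_bound[of "fst v" "snd v"] that r0 c by auto
  have "continuous_on ({r..c} \<times> {0..2*pi}) (\<lambda>v. polar (fst v) (snd v))"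
    unfolding polar_def
    by (intro continuous_intros continuous_on_compose2[OF U_cont]) (use dom' in auto)
  then have "uniformly_continuous_on ({r..c} \<times> {0..2*pi}) (\<lambda>v. polar (fst v) (snd v))"
    by (intro compact_uniformly_continuous compact_Times compact_Icc)
  then obtain d where d: "d > 0" "\<And>v w. \<lbrakk>v \<in> {r..c} \<times> {0..2*pi}; w \<in> {r..c} \<times> {0..2*pi}; dist w v < d\<rbrakk> \<Longrightarrow>
      dist (polar (fst w) (snd w)) (polar (fst v) (snd v)) < \<epsilon>"
    using \<epsilon>(1) unfolding uniformly_continuous_on_def by metis
  define r1 where "r1 = r + min (d/2) ((c - r)/2)"
  have r1: "r < r1" "r1 < c" "r1 - r < d" using d c by (auto simp: r1_def min_def field_simps)
  have "range (polar r1) \<subseteq> W"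
  proof
    fix v assume "v \<in> range (polar r1)"
    then obtain \<theta>0 where "v = polar r1 \<theta>0" by blast
    \<comment> \<open>The angle is reduced to one turn, because uniform continuity holds on a
      compact rectangle.\<close>
    moreover obtain \<theta> where "0 \<le> \<theta>" "\<theta> < 2*pi" "cos \<theta>0 = cos \<theta>" "sin \<theta>0 = sin \<theta>"
      using sincos_total_2pi[OF sin_cos_squared_add2[of \<theta>0]] by blast
    ultimately have \<theta>: "0 \<le> \<theta>" "\<theta> \<le> 2*pi" "v = polar r1 \<theta>" by (simp_all add: polar_def)
    have "dist (polar r1 \<theta>) (polar r \<theta>) < \<epsilon>"
      using d(2)[of "(r, \<theta>)" "(r1, \<theta>)"] r1 \<theta> by (simp add: dist_Pair_Pair dist_real_def)
    then have "v \<in> ball (polar r \<theta>) \<epsilon>" using \<theta> by (simp add: dist_commute)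
    then show "v \<in> W" using \<epsilon>(2) unfolding Lr by blast
  qed
  moreover have "periodic_orbit (field e) (range (polar r1))"
    using circle_periodic_orbit[of r1 e] r1 r0 c f0 by simp
  ultimately have "range (polar r1) = range (polar r)" using W(3) unfolding Lr by blast
  then have "polar r1 0 \<in> range (polar r)" by (metis rangeI)
  then obtain \<theta> where \<theta>: "polar r1 0 = polar r \<theta>" by (rule rangeE)
  have "0 < r1" "r1 < Z" using r0 r1 c by linarith+
  from polar_radius[OF this, of 0] polar_radius[OF r0, of \<theta>] have "r1^2 = r^2" unfolding \<theta> by simp
  moreover have "r^2 < r1^2" using r0 r1 by (intro power_strict_mono) auto
  ultimately show False by simp
qed

end

section \<open>Level pairs of the quartic potential\<close>

text \<open>The energy equation for the two ends $-w < 0 < a$ of a level interval, with the factor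
  $a + w$ removed.\<close>
lemma level_pair_relation:
  fixes a w b k :: real
  assumes pos: "0 < a" "0 < w"
    and level: "a^2 * (b*k + 2*(k-b)*a/3 - a^2/2) = w^2 * (b*k - 2*(k-b)*w/3 - w^2/2)"
  shows "b * k * (w - a) = 2*(k-b)/3 * (a^2 - a*w + w^2) + (w - a) * (a^2 + w^2) / 2"
proof -
  have "(a + w) * (b * k * (w - a) - (2*(k-b)/3 * (a^2 - a*w + w^2) + (w - a) * (a^2 + w^2) / 2)) =
      w^2 * (b*k - 2*(k-b)*w/3 - w^2/2) - a^2 * (b*k + 2*(k-b)*a/3 - a^2/2)"
    by (simp add: field_simps power2_eq_square)
  also have "\<dots> = 0" using level by simp
  finally show ?thesis using pos by simp
qed

text \<open>Up to the factor \<beta> the forces at the two ends are a X and w Y in modulus.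
  Multiplying X and Y by w - a allows \<open>level_pair_relation\<close> to eliminate b k, which
  leaves formulas in k - b, a and w. The bound w Y \<le> a X makes w - a grow with the energy, and
  w^2 Y \<le> a^2 X makes w / a grow.\<close>

lemma level_pair:
  fixes a w b k :: real
  assumes bk: "0 < b" "b \<le> k" and a: "0 < a" "a < k" and w: "0 < w" "w < b"
    and level: "a^2 * (b*k + 2*(k-b)*a/3 - a^2/2) = w^2 * (b*k - 2*(k-b)*w/3 - w^2/2)"
  defines "X \<equiv> (a + b) * (k - a)" and "Y \<equiv> (b - w) * (k + w)"
  shows "X > 0" "Y > 0" "a \<le> w" "b < k \<Longrightarrow> a < w" "b = k \<Longrightarrow> a = w"
    "6 * (w - a) * X = (a + w) * (2*(k-b)*(2*w - a) + 3*(w-a)^2)"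
    "6 * (w - a) * Y = (a + w) * (2*(k-b)*(2*a - w) - 3*(w-a)^2)"
    "w * Y \<le> a * X" "w^2 * Y \<le> a^2 * X"
proof -
  note rel = level_pair_relation[OF a(1) w(1) level]
  show X: "X > 0" and Y: "Y > 0" using bk a w by (auto simp: X_def Y_def)
  have XY: "X + Y = 2*b*k - (k-b)*(w-a) - (a^2 + w^2)"
    by (simp add: X_def Y_def algebra_simps power2_eq_square)
  have rel': "(w - a) * (2*b*k - (a^2 + w^2)) = 4*(k-b)/3 * (a^2 - a*w + w^2)"
    using rel by (simp add: field_simps)
  have eq: "b = k \<Longrightarrow> a = w"
  proof -
    assume "b = k"
    with rel' have "(w - a) * (2*b*k - (a^2 + w^2)) = 0" by simp
    moreover have "2*b*k - (a^2 + w^2) > 0" using XY X Y \<open>b = k\<close> by simp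
    ultimately show "a = w" by simp
  qed
  then show "b = k \<Longrightarrow> a = w" .
  \<comment> \<open>If w \<le> a, then X + Y > 0 turns the energy relation into 4 (a^2 - a w + w^2)
    \<le> 3 (w - a)^2, that is (a + w)^2 \<le> 0.\<close>
  have less: "a < w" if "b < k"
  proof (rule ccontr)
    assume "\<not> a < w"
    then have d: "w - a \<le> 0" by simp
    have "2*b*k - (a^2 + w^2) \<ge> (k-b)*(w-a)" using XY X Y by linarith
    from mult_left_mono_neg[OF this d]
    have "(w - a) * (2*b*k - (a^2 + w^2)) \<le> (k - b) * (w - a)^2"
      by (simp add: power2_eq_square mult_ac)
    with rel' have "4*(k-b)/3 * (a^2 - a*w + w^2) \<le> (k - b) * (w - a)^2" by simp
    then have "(k-b) * (4 * (a^2 - a*w + w^2)) \<le> (k - b) * (3 * (w - a)^2)"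
      by (simp add: field_simps)
    then have "4 * (a^2 - a*w + w^2) \<le> 3 * (w - a)^2" using that by simp
    then have "a^2 + 2*a*w + w^2 \<le> 0" by (simp add: power2_eq_square algebra_simps)
    moreover have "a^2 + 2*a*w + w^2 > 0" using a w by (intro add_pos_pos) auto
    ultimately show False by simp
  qed
  then show "b < k \<Longrightarrow> a < w" .
  show le: "a \<le> w" using eq less bk by fastforce
  have "6 * (w - a) * X = 6 * (b * k * (w - a)) + 6 * (w - a) * ((k - b) * a - a^2)"
    by (simp add: X_def algebra_simps power2_eq_square)
  also have "\<dots> = (a + w) * (2*(k-b)*(2*w - a) + 3*(w-a)^2)"
    unfolding rel by (simp add: field_simps power2_eq_square)
  finally show X6: "6 * (w - a) * X = (a + w) * (2*(k-b)*(2*w - a) + 3*(w-a)^2)" .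
  have "6 * (w - a) * Y = 6 * (b * k * (w - a)) - 6 * (w - a) * ((k - b) * w + w^2)"
    by (simp add: Y_def algebra_simps power2_eq_square)
  also have "\<dots> = (a + w) * (2*(k-b)*(2*a - w) - 3*(w-a)^2)"
    unfolding rel by (simp add: field_simps power2_eq_square)
  finally show Y6: "6 * (w - a) * Y = (a + w) * (2*(k-b)*(2*a - w) - 3*(w-a)^2)" .
  show "w * Y \<le> a * X" "w^2 * Y \<le> a^2 * X"
  proof -
    have "w * Y \<le> a * X \<and> w^2 * Y \<le> a^2 * X"
    proof (cases "b = k")
      case True
      then show ?thesis using eq by (simp add: X_def Y_def algebra_simps)
    next
      case False
      then have bk': "b < k" and d: "6 * (w - a) > 0" using bk less by auto
      have "6 * (w - a) * (a * X - w * Y) = a * (6 * (w - a) * X) - w * (6 * (w - a) * Y)"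
        by (simp add: algebra_simps)
      also have "\<dots> = (a + w) * (2*(k-b)*(w^2 - a^2) + 3*(w-a)^2*(a + w))"
        unfolding X6 Y6 by (simp add: algebra_simps power2_eq_square)
      also have "\<dots> \<ge> 0"
      proof -
        have "w^2 - a^2 \<ge> 0" using le a by simp
        then show ?thesis using bk' a w by (intro mult_nonneg_nonneg add_nonneg_nonneg) auto
      qed
      finally have 1: "a * X - w * Y \<ge> 0" using d by (simp add: zero_le_mult_iff)
      have "6 * (w - a) * (a^2 * X - w^2 * Y) = a^2 * (6 * (w - a) * X) - w^2 * (6 * (w - a) * Y)"
        by (simp add: algebra_simps)
      \<comment> \<open>Here a^2 - a w + w^2 is written as a^2 + a (w - a) + (w - a)^2, so that
        every summand is visibly nonnegative.\<close>
      also have "\<dots> = (a + w) * (2*(k-b)*((w - a) * (a^2 + a * (w - a) + (w-a)^2)) + 3*(w-a)^2*(a^2 + w^2))"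
        unfolding X6 Y6 by (simp add: algebra_simps power2_eq_square)
      also have "\<dots> \<ge> 0"
        using bk' a w le by (intro mult_nonneg_nonneg add_nonneg_nonneg) auto
      finally have 2: "a^2 * X - w^2 * Y \<ge> 0" using d by (simp add: zero_le_mult_iff)
      from 1 2 show ?thesis by simp
    qed
    then show "w * Y \<le> a * X" "w^2 * Y \<le> a^2 * X" by simp_all
  qed
qed

text \<open>In terms of w / a and w - a the numerator of the force ratio increases and its
  denominator decreases in both quantities. As both grow with the energy, so does the ratio. The
  denominator is positive because Y is.\<close>

lemma level_pair_ratio:
  fixes a w b k :: real
  assumes bk: "0 < b" "b < k" and a: "0 < a" "a < k" and w: "0 < w" "w < b"
    and level: "a^2 * (b*k + 2*(k-b)*a/3 - a^2/2) = w^2 * (b*k - 2*(k-b)*w/3 - w^2/2)"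
  shows "2*(k-b)*(2 - w/a) - 3*(w/a - 1)*(w - a) > 0"
    and "a * ((a + b) * (k - a)) / (w * ((b - w) * (k + w))) =
      (2*(k-b)*(2 - a/w) + 3*(1 - a/w)*(w - a)) / (2*(k-b)*(2 - w/a) - 3*(w/a - 1)*(w - a))"
proof -
  define X where "X = (a + b) * (k - a)"
  define Y where "Y = (b - w) * (k + w)"
  note L = level_pair[OF bk(1) less_imp_le[OF bk(2)] a w level, folded X_def Y_def]
  have d: "w - a > 0" using L(4) bk by simp
  have D: "a * (2*(k-b)*(2 - w/a) - 3*(w/a - 1)*(w - a)) = 2*(k-b)*(2*a - w) - 3*(w-a)^2"
    using a by (simp add: field_simps power2_eq_square)
  have N: "w * (2*(k-b)*(2 - a/w) + 3*(1 - a/w)*(w - a)) = 2*(k-b)*(2*w - a) + 3*(w-a)^2"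
    using w by (simp add: field_simps power2_eq_square)
  have "(a + w) * (2*(k-b)*(2*a - w) - 3*(w-a)^2) > 0" using L(2,7) d by (metis mult_pos_pos zero_less_numeral)
  then have D_pos: "2*(k-b)*(2*a - w) - 3*(w-a)^2 > 0" using a w by (simp add: zero_less_mult_iff)
  then show D': "2*(k-b)*(2 - w/a) - 3*(w/a - 1)*(w - a) > 0"
    unfolding D[symmetric] using a by (simp add: zero_less_mult_iff)
  have "a * X / (w * Y) = a * (6 * (w - a) * X) / (w * (6 * (w - a) * Y))" using d by simp
  also have "\<dots> = a * (2*(k-b)*(2*w - a) + 3*(w-a)^2) / (w * (2*(k-b)*(2*a - w) - 3*(w-a)^2))"
    unfolding L(6,7) using a w by simp
  also have "\<dots> = (2*(k-b)*(2 - a/w) + 3*(1 - a/w)*(w - a)) / (2*(k-b)*(2 - w/a) - 3*(w/a - 1)*(w - a))"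
    unfolding D[symmetric] N[symmetric] using a w by simp
  finally show "a * ((a + b) * (k - a)) / (w * ((b - w) * (k + w))) =
      (2*(k-b)*(2 - a/w) + 3*(1 - a/w)*(w - a)) / (2*(k-b)*(2 - w/a) - 3*(w/a - 1)*(w - a))"
    by (simp add: X_def Y_def)
qed

section \<open>Monotonicity of weighted means of powers, based on strict convexity for n \<ge>
  2\<close>

lemma power_increment_strict_mono:
  fixes x y d :: real
  assumes "0 \<le> x" "x < y" "0 < d" "n \<ge> 2"
  shows "(x + d)^n - x^n < (y + d)^n - y^n"
proof (rule DERIV_pos_imp_increasing[OF assms(2)])
  fix z assume "x \<le> z" "z \<le> y"
  have "((\<lambda>z. (z + d)^n - z^n) has_real_derivative real n * (z + d)^(n - 1) - real n * z^(n - 1)) (at z)"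
    by (auto intro!: derivative_eq_intros)
  moreover have "z^(n - 1) < (z + d)^(n - 1)"
    using assms \<open>x \<le> z\<close> by (intro power_strict_mono) auto
  then have "real n * (z + d)^(n - 1) - real n * z^(n - 1) > 0" using assms by simp
  ultimately show "\<exists>D. ((\<lambda>z. (z + d)^n - z^n) has_real_derivative D) (at z) \<and> 0 < D" by blast
qed

text \<open>For even n: shifting weight to the end of larger modulus does not lower the mean, and
  then both ends move outwards.\<close>

lemma weighted_power_mean_less:
  fixes a1 a2 w1 w2 l1 l2 :: real
  assumes "0 < a1" "a1 < a2" "a1 \<le> w1" "w1 < w2" "1/2 \<le> l1" "l1 \<le> l2" "l2 < 1" "n \<ge> 2"
  shows "(1 - l1) * a1^n + l1 * w1^n < (1 - l2) * a2^n + l2 * w2^n"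
proof -
  have "(l2 - l1) * (w1^n - a1^n) \<ge> 0" using assms by (simp add: power_mono)
  then have "(1 - l1) * a1^n + l1 * w1^n \<le> (1 - l2) * a1^n + l2 * w1^n" by (simp add: algebra_simps)
  also have "\<dots> < (1 - l2) * a2^n + l2 * w2^n"
    using assms by (intro add_strict_mono mult_strict_left_mono power_strict_mono) auto
  finally show ?thesis .
qed

text \<open>For odd n, with reversed sign: l w^n - (1 - l) a^n = l (w^n - a^n) + (2 l - 1) a^n. Both
  summands are nonnegative and grow, the first strictly by convexity, because w - a does not
  shrink.\<close>

lemma weighted_power_difference_less:
  fixes a1 a2 w1 w2 l1 l2 :: real
  assumes "0 < a1" "a1 < a2" "a1 < w1" "w1 - a1 \<le> w2 - a2" "1/2 \<le> l1" "l1 \<le> l2" "n \<ge> 2"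
  shows "l1 * w1^n - (1 - l1) * a1^n < l2 * w2^n - (1 - l2) * a2^n"
proof -
  have "w1^n - a1^n < (a2 + (w1 - a1))^n - a2^n"
    using power_increment_strict_mono[of a1 a2 "w1 - a1" n] assms by simp
  also have "\<dots> \<le> w2^n - a2^n" using assms by (simp add: power_mono)
  finally have 1: "w1^n - a1^n < w2^n - a2^n" .
  have 2: "0 < w1^n - a1^n" using assms by (simp add: power_strict_mono)
  have 3: "a1^n \<le> a2^n" "0 \<le> a1^n" using assms by (auto intro: power_mono)
  have "l1 * (w1^n - a1^n) \<le> l2 * (w1^n - a1^n)" using assms 2 by (intro mult_right_mono) auto
  also have "\<dots> < l2 * (w2^n - a2^n)" using assms 1 by (intro mult_strict_left_mono) auto
  finally have "l1 * (w1^n - a1^n) < l2 * (w2^n - a2^n)" .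
  moreover have "(2*l1 - 1) * a1^n \<le> (2*l2 - 1) * a2^n"
    using assms 3 by (intro mult_mono) auto
  ultimately show ?thesis by (simp add: algebra_simps)
qed

text \<open>As the energy grows, k - a shrinks and k + w grows, the latter at least as much. By
  convexity the gain at the larger base exceeds the loss at the smaller one, and the gain has at
  least half of the weight.\<close>

lemma weighted_shifted_power_less:
  fixes a1 a2 w1 w2 l1 l2 k :: real
  assumes "0 < a1" "a1 < a2" "a2 < k" "0 < w1" "w1 - a1 \<le> w2 - a2" "1/2 \<le> l1" "l1 \<le> l2" "n \<ge> 2"
  shows "(1 - l1) * (k - a1)^n + l1 * (k + w1)^n < (1 - l2) * (k - a2)^n + l2 * (k + w2)^n"
proof -
  have "(l2 - l1) * ((k + w1)^n - (k - a1)^n) \<ge> 0" using assms by (simp add: power_mono)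
  then have 1: "(1 - l1) * (k - a1)^n + l1 * (k + w1)^n \<le> (1 - l2) * (k - a1)^n + l2 * (k + w1)^n"
    by (simp add: algebra_simps)
  have "(k - a1)^n - (k - a2)^n < (k + w1 + (a2 - a1))^n - (k + w1)^n"
    using power_increment_strict_mono[of "k - a2" "k + w1" "a2 - a1" n] assms by simp
  also have "\<dots> \<le> (k + w2)^n - (k + w1)^n" using assms by (simp add: power_mono)
  finally have 2: "(k - a1)^n - (k - a2)^n < (k + w2)^n - (k + w1)^n" .
  have 3: "0 \<le> (k - a1)^n - (k - a2)^n" using assms by (simp add: power_mono)
  have "(1 - l2) * ((k - a1)^n - (k - a2)^n) \<le> l2 * ((k - a1)^n - (k - a2)^n)"
    using assms 3 by (intro mult_right_mono) auto
  also have "\<dots> < l2 * ((k + w2)^n - (k + w1)^n)" using assms 2 by (intro mult_strict_left_mono) auto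
  finally have "(1 - l2) * (k - a1)^n + l2 * (k + w1)^n < (1 - l2) * (k - a2)^n + l2 * (k + w2)^n"
    by (simp add: algebra_simps)
  with 1 show ?thesis by simp
qed

section \<open>The quartic normal form with saddles at -b and k\<close>

locale quartic =
  fixes \<beta> b k :: real
  assumes \<beta>: "\<beta> > 0" and bk: "0 < b" "b \<le> k"
begin

text \<open>The potential is x^2 q(x) / 2. Splitting off x^2 gives a signed square root \<zeta> that
  is smooth through the center. \<open>Z\<close> is the radius that belongs to the saddle
  -b.\<close>

definition q :: "real \<Rightarrow> real" where "q x = \<beta> * (b*k + 2*(k-b)*x/3 - x^2/2)"
definition \<zeta> :: "real \<Rightarrow> real" where "\<zeta> x = x * sqrt (q x)"
definition \<gamma> :: "real \<Rightarrow> real" where "\<gamma> x = \<beta> * ((x + b) * (k - x)) / sqrt (q x)"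
definition d\<gamma> :: "real \<Rightarrow> real" where
  "d\<gamma> x = \<beta> * (k - b - 2*x) / sqrt (q x) - \<beta> * ((x + b) * (k - x)) * (\<beta> * (2*(k-b)/3 - x)) / (2 * (q x * sqrt (q x)))"
definition Z :: real where "Z = b * sqrt (q (-b))"

lemma q_pos:
  assumes "- b \<le> x" "x \<le> k"
  shows "q x > 0"
proof -
  \<comment> \<open>A decomposition into terms whose signs are visible for x between -b and
    k.\<close>
  have eq: "6 * (b*k + 2*(k-b)*x/3 - x^2/2) = 3 * ((x + b) * (k - x)) + (k - b) * (x + b) + b * (2*k + b)"
    by (simp add: field_simps power2_eq_square)
  have "0 \<le> (x + b) * (k - x)" "0 \<le> (k - b) * (x + b)" "0 < b * (2*k + b)"
    using assms bk by (auto intro: mult_nonneg_nonneg)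
  then have "6 * (b*k + 2*(k-b)*x/3 - x^2/2) > 0" unfolding eq by linarith
  then have "\<beta> * (6 * (b*k + 2*(k-b)*x/3 - x^2/2)) > 0" using \<beta> by (rule mult_pos_pos[rotated])
  moreover have "\<beta> * (6 * (b*k + 2*(k-b)*x/3 - x^2/2)) = 6 * q x" by (simp only: q_def mult.left_commute)
  ultimately show ?thesis by simp
qed

lemma q_deriv: "(q has_real_derivative \<beta> * (2*(k-b)/3 - x)) (at x)"
  unfolding q_def by (auto intro!: derivative_eq_intros)

lemma sqrt_q_deriv:
  assumes "- b \<le> x" "x \<le> k"
  shows "((\<lambda>x. sqrt (q x)) has_real_derivative \<beta> * (2*(k-b)/3 - x) / (2 * sqrt (q x))) (at x)"
proof (rule DERIV_cong[OF DERIV_chain2[OF DERIV_real_sqrt q_deriv]])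
  show "0 < q x" by (rule q_pos[OF assms])
  show "inverse (sqrt (q x)) / 2 * (\<beta> * (2*(k-b)/3 - x)) = \<beta> * (2*(k-b)/3 - x) / (2 * sqrt (q x))"
    by (simp add: divide_simps)
qed

lemma \<zeta>_deriv:
  assumes "- b \<le> x" "x \<le> k"
  shows "(\<zeta> has_real_derivative \<gamma> x) (at x)"
proof -
  have s: "sqrt (q x) > 0" using q_pos[OF assms] by simp
  have sq: "sqrt (q x) * sqrt (q x) = q x" using q_pos[OF assms] by simp
  have "1 * sqrt (q x) + \<beta> * (2*(k-b)/3 - x) / (2 * sqrt (q x)) * x = \<gamma> x"
  proof -
    have "(1 * sqrt (q x) + \<beta> * (2*(k-b)/3 - x) / (2 * sqrt (q x)) * x) * (2 * sqrt (q x))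
        = 2 * (sqrt (q x) * sqrt (q x)) + \<beta> * (2*(k-b)/3 - x) * x"
      using s by (simp add: field_simps)
    also have "\<dots> = 2 * (\<beta> * ((x + b) * (k - x)))"
      unfolding sq by (simp add: q_def field_simps power2_eq_square)
    also have "\<dots> = \<gamma> x * (2 * sqrt (q x))" using s by (simp add: \<gamma>_def)
    finally show ?thesis using s by simp
  qed
  then show ?thesis
    unfolding \<zeta>_def by (rule DERIV_cong[OF DERIV_mult[OF DERIV_ident sqrt_q_deriv[OF assms]]])
qed

lemma \<gamma>_deriv:
  assumes "- b \<le> x" "x \<le> k"
  shows "(\<gamma> has_real_derivative d\<gamma> x) (at x)"
proof -
  have s: "sqrt (q x) > 0" using q_pos[OF assms] by simp
  have sq: "sqrt (q x) * sqrt (q x) = q x" using q_pos[OF assms] by simp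
  have n: "((\<lambda>x. \<beta> * ((x + b) * (k - x))) has_real_derivative \<beta> * (k - b - 2*x)) (at x)"
    by (auto intro!: derivative_eq_intros simp: algebra_simps)
  have quot: "(P * s - Q * (R / (2 * s))) / (s * s) = P / s - Q * R / (2 * ((s * s) * s))"
    if "s > 0" for P Q R s :: real
    using that by (simp add: field_simps)
  show ?thesis
    unfolding \<gamma>_def
  proof (rule DERIV_cong[OF DERIV_divide[OF n sqrt_q_deriv[OF assms]]])
    show "sqrt (q x) \<noteq> 0" using s by simp
    show "(\<beta> * (k - b - 2*x) * sqrt (q x) - \<beta> * ((x + b) * (k - x)) * (\<beta> * (2*(k-b)/3 - x) / (2 * sqrt (q x))))
        / (sqrt (q x) * sqrt (q x)) = d\<gamma> x"
      by (simp only: quot[OF s]) (simp only: d\<gamma>_def sq)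
  qed
qed

lemma cont_q: "continuous_on S q"
  by (rule continuous_at_imp_continuous_on, rule ballI, rule DERIV_isCont, rule q_deriv)

lemma \<zeta>_\<gamma>: "\<lbrakk>- b \<le> x; x \<le> k\<rbrakk> \<Longrightarrow> \<zeta> x * \<gamma> x = \<beta> * x * (x + b) * (k - x)"
  using q_pos[of x] by (simp add: \<zeta>_def \<gamma>_def)

lemma \<zeta>_sq: "\<lbrakk>- b \<le> x; x \<le> k\<rbrakk> \<Longrightarrow> (\<zeta> x)^2 = x^2 * q x"
  using q_pos[of x] by (simp add: \<zeta>_def power_mult_distrib)

lemma Z_pos: "Z > 0" using bk q_pos[of "-b"] by (simp add: Z_def)

text \<open>Up to a positive factor the difference of the two saddle energies is (k - b) (k + b)^3,
  so b \<le> k makes -b the lower saddle.\<close>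

lemma \<zeta>_ends: "\<zeta> (-b) = - Z" "Z \<le> \<zeta> k"
proof -
  show "\<zeta> (-b) = - Z" by (simp add: \<zeta>_def Z_def)
  have "b^2 * (b*k + 2*(k-b)*(-b)/3 - (-b)^2/2) \<le> k^2 * (b*k + 2*(k-b)*k/3 - k^2/2)"
  proof -
    have "k^2 * (b*k + 2*(k-b)*k/3 - k^2/2) - b^2 * (b*k + 2*(k-b)*(-b)/3 - (-b)^2/2)
       = (k - b) * (k + b)^3 / 6"
      by (simp add: field_simps power2_eq_square power3_eq_cube)
    moreover have "(k - b) * (k + b)^3 / 6 \<ge> 0" using bk by simp
    ultimately show ?thesis by simp
  qed
  then have "b^2 * q (-b) \<le> k^2 * q k" using \<beta> by (simp add: q_def)
  then have "sqrt (b^2 * q (-b)) \<le> sqrt (k^2 * q k)" by simp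
  then show "Z \<le> \<zeta> k" using bk by (simp add: Z_def \<zeta>_def real_sqrt_mult)
qed

lemma oscillator_quartic:
  assumes f: "\<And>u. (f has_real_derivative df u) (at u)" and df: "continuous_on UNIV df"
  shows "oscillator (-b) k Z \<zeta> \<gamma> d\<gamma> f df (\<lambda>x. \<beta> * x * (x + b) * (k - x))"
proof
  fix u assume u: "- b < u" "u < k"
  show "(\<zeta> has_real_derivative \<gamma> u) (at u)" using u by (intro \<zeta>_deriv) auto
  show "(\<gamma> has_real_derivative d\<gamma> u) (at u)" using u by (intro \<gamma>_deriv) auto
  show "(f has_real_derivative df u) (at u)" by (rule f)
  show "\<gamma> u > 0" using u q_pos[of u] \<beta> by (simp add: \<gamma>_def)
  show "\<beta> * u * (u + b) * (k - u) = \<zeta> u * \<gamma> u" using u \<zeta>_\<gamma> by simp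
next
  have "q x \<noteq> 0" if "x \<in> {-b<..<k}" for x using q_pos[of x] that by simp
  then show "continuous_on {-b<..<k} d\<gamma>"
    unfolding d\<gamma>_def by (intro continuous_intros cont_q) auto
  show "continuous_on {-b<..<k} df" by (rule continuous_on_subset[OF df]) simp
  show "Z > 0" by (rule Z_pos)
next
  fix z assume z: "- Z < z" "z < Z"
  have cont: "continuous_on {-b..k} \<zeta>"
    by (rule continuous_at_imp_continuous_on, rule ballI, rule DERIV_isCont, rule \<zeta>_deriv) auto
  obtain u where u: "- b \<le> u" "u \<le> k" "\<zeta> u = z"
    using IVT'[of \<zeta> "-b" z k] \<zeta>_ends z bk cont by auto
  moreover have "u \<noteq> -b" "u \<noteq> k" using u \<zeta>_ends z by auto
  ultimately show "\<exists>u. - b < u \<and> u < k \<and> \<zeta> u = z" by (intro exI[of _ u]) auto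
qed

text \<open>The even part of \<phi> is a positive multiple of \<alpha>0 + \<alpha>n \<rho>, where
  \<rho> is a weighted mean of h at the two ends of the level interval. A strictly monotone \<rho>
  leaves room for one sign change only. The factor \<open>s0\<close> makes the mean increasing: for
  odd powers it decreases.\<close>

lemma sign_condition:
  assumes f': "\<And>u. (f has_real_derivative df u) (at u)" and df: "continuous_on UNIV df"
    and f: "\<And>u. f u = \<alpha>0 + \<alpha>n * h u" and \<alpha>: "\<alpha>0 \<noteq> 0 \<or> \<alpha>n \<noteq> 0" and s0: "s0 \<noteq> 0"
    and h: "\<And>a1 a2 w1 w2 l1 l2. \<lbrakk>0 < a1; a1 < a2; a2 < k; w1 < w2; w2 < b; a1 \<le> w1; b < k \<Longrightarrow> a1 < w1;
        w1 - a1 \<le> w2 - a2; 1/2 \<le> l1; l1 \<le> l2; l2 < 1\<rbrakk> \<Longrightarrow>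
        s0 * ((1 - l1) * h a1 + l1 * h (- w1)) < s0 * ((1 - l2) * h a2 + l2 * h (- w2))"
  obtains s where "s \<noteq> 0"
    "\<And>x y. \<lbrakk>0 < x; x < y; y < Z;
       s * (oscillator.\<phi> (-b) k \<zeta> \<gamma> f x + oscillator.\<phi> (-b) k \<zeta> \<gamma> f (-x)) \<ge> 0\<rbrakk> \<Longrightarrow>
       s * (oscillator.\<phi> (-b) k \<zeta> \<gamma> f y + oscillator.\<phi> (-b) k \<zeta> \<gamma> f (-y)) > 0"
proof -
  interpret O: oscillator "-b" k Z \<zeta> \<gamma> d\<gamma> f df "\<lambda>x. \<beta> * x * (x + b) * (k - x)"
    by (rule oscillator_quartic[OF f' df])
  \<comment> \<open>The level interval at energy z^2 / 2 is [- w z, a z].\<close>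
  define a where "a z = O.U z" for z
  define w where "w z = - O.U (- z)" for z
  have range: "0 < a z" "a z < k" "0 < w z" "w z < b" if z: "0 < z" "z < Z" for z
  proof -
    have *: "- b < O.U z" "O.U z < k" "\<zeta> (O.U z) = z" "- b < O.U (-z)" "O.U (-z) < k" "\<zeta> (O.U (-z)) = - z"
      using O.U_range[of z] O.U_range[of "-z"] z by auto
    have sgn: "0 < \<zeta> x \<longleftrightarrow> 0 < x" "\<zeta> x < 0 \<longleftrightarrow> x < 0" if "- b < x" "x < k" for x
      using q_pos[of x] that by (auto simp: \<zeta>_def zero_less_mult_iff mult_less_0_iff)
    show "0 < a z" "a z < k" "0 < w z" "w z < b"
      using * sgn[of "O.U z"] sgn[of "O.U (-z)"] z by (auto simp: a_def w_def)
  qed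
  have zq: "a z * sqrt (q (a z)) = z" "w z * sqrt (q (- w z)) = z" if z: "0 < z" "z < Z" for z
    using O.U_range(3)[of z] O.U_range(3)[of "-z"] z by (auto simp: a_def w_def \<zeta>_def)
  have level: "(a z)^2 * (b*k + 2*(k-b)*a z/3 - (a z)^2/2) = (w z)^2 * (b*k - 2*(k-b)*w z/3 - (w z)^2/2)"
    if z: "0 < z" "z < Z" for z
  proof -
    have "(a z)^2 * q (a z) = (w z)^2 * q (- w z)"
      using \<zeta>_sq[of "a z"] \<zeta>_sq[of "- w z"] range[OF z] zq[OF z] bk by (simp add: \<zeta>_def)
    then have "\<beta> * ((a z)^2 * (b*k + 2*(k-b)*a z/3 - (a z)^2/2)) = \<beta> * ((w z)^2 * (b*k - 2*(k-b)*w z/3 - (w z)^2/2))"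
      by (simp add: q_def mult_ac)
    then show ?thesis using \<beta> by simp
  qed
  define X where "X z = (a z + b) * (k - a z)" for z
  define Y where "Y z = (b - w z) * (k + w z)" for z
  have L: "X z > 0" "Y z > 0" "a z \<le> w z" "b < k \<Longrightarrow> a z < w z" "b = k \<Longrightarrow> a z = w z"
    "w z * Y z \<le> a z * X z" "(w z)^2 * Y z \<le> (a z)^2 * X z" if z: "0 < z" "z < Z" for z
    using level_pair[OF bk range(1,2)[OF z] range(3,4)[OF z] level[OF z]] by (simp_all add: X_def Y_def)
  have ga: "inverse (\<gamma> (a z)) = z / (\<beta> * (a z * X z))" if z: "0 < z" "z < Z" for z
  proof -
    have "inverse (\<gamma> (a z)) = (a z * sqrt (q (a z))) / (\<beta> * (a z * X z))"
      using range[OF z] by (simp add: \<gamma>_def X_def)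
    then show ?thesis by (simp only: zq[OF z])
  qed
  have gw: "inverse (\<gamma> (- w z)) = z / (\<beta> * (w z * Y z))" if z: "0 < z" "z < Z" for z
  proof -
    have "inverse (\<gamma> (- w z)) = (w z * sqrt (q (- w z))) / (\<beta> * (w z * Y z))"
      using range[OF z] by (simp add: \<gamma>_def Y_def)
    then show ?thesis by (simp only: zq[OF z])
  qed
  have a': "(a has_real_derivative z / (\<beta> * (a z * X z))) (at z)" if z: "0 < z" "z < Z" for z
    using O.U_deriv[of z] z by (simp add: a_def[abs_def] flip: ga[OF z, unfolded a_def])
  have w': "(w has_real_derivative z / (\<beta> * (w z * Y z))) (at z)" if z: "0 < z" "z < Z" for z
  proof -
    have "((\<lambda>z. O.U (- z)) has_real_derivative inverse (\<gamma> (O.U (-z))) * (- 1)) (at z)"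
      by (rule DERIV_chain2[OF O.U_deriv]) (use z in \<open>auto intro!: derivative_eq_intros\<close>)
    from DERIV_minus[OF this] show ?thesis
      using gw[OF z] by (simp add: w_def[abs_def])
  qed
  \<comment> \<open>Differentiating V(a) = V(-w) = z^2 / 2 gives a' = z / V'(a) and w' = z /
    |V'(-w)|; the two force comparisons of \<open>level_pair\<close> then control w - a and w /
    a.\<close>
  have mono: "a x < a y" "w x < w y" "w x - a x \<le> w y - a y" "w x / a x \<le> w y / a y"
    if xy: "0 < x" "x < y" "y < Z" for x y
  proof -
    have dom: "0 < z" "z < Z" if "x \<le> z" "z \<le> y" for z using that xy by auto
    have pos: "z / (\<beta> * (a z * X z)) > 0" "z / (\<beta> * (w z * Y z)) > 0"
        "z / (\<beta> * (a z * X z)) \<le> z / (\<beta> * (w z * Y z))" if z: "0 < z" "z < Z" for z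
    proof -
      have "0 < \<beta> * (a z * X z)" "0 < \<beta> * (w z * Y z)" "\<beta> * (w z * Y z) \<le> \<beta> * (a z * X z)"
        using L(1,2,6)[OF z] range[OF z] \<beta> by simp_all
      then show "z / (\<beta> * (a z * X z)) > 0" "z / (\<beta> * (w z * Y z)) > 0"
        "z / (\<beta> * (a z * X z)) \<le> z / (\<beta> * (w z * Y z))"
        using z by (simp_all only: divide_pos_pos divide_left_mono less_imp_le mult_pos_pos)
    qed
    show "a x < a y"
    proof (rule DERIV_pos_imp_increasing[OF xy(2)])
      fix z assume "x \<le> z" "z \<le> y"
      from a'[OF dom[OF this]] pos(1)[OF dom[OF this]]
      show "\<exists>D. (a has_real_derivative D) (at z) \<and> 0 < D" by blast
    qed
    show "w x < w y"
    proof (rule DERIV_pos_imp_increasing[OF xy(2)])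
      fix z assume "x \<le> z" "z \<le> y"
      from w'[OF dom[OF this]] pos(2)[OF dom[OF this]]
      show "\<exists>D. (w has_real_derivative D) (at z) \<and> 0 < D" by blast
    qed
    show "w x - a x \<le> w y - a y"
    proof (rule DERIV_nonneg_imp_nondecreasing[OF less_imp_le[OF xy(2)], where f = "\<lambda>z. w z - a z"])
      fix z assume "x \<le> z" "z \<le> y"
      note z = dom[OF this]
      from DERIV_diff[OF w'[OF z] a'[OF z]] pos(3)[OF z]
      show "\<exists>D. ((\<lambda>z. w z - a z) has_real_derivative D) (at z) \<and> 0 \<le> D"
        using diff_ge_0_iff_ge by blast
    qed
    show "w x / a x \<le> w y / a y"
    proof (rule DERIV_nonneg_imp_nondecreasing[OF less_imp_le[OF xy(2)], where f = "\<lambda>z. w z / a z"])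
      fix z assume "x \<le> z" "z \<le> y"
      note z = dom[OF this]
      have "a z \<noteq> 0" using range[OF z] by simp
      note d = DERIV_divide[OF w'[OF z] a'[OF z] this]
      have "w z * (z / (\<beta> * (a z * X z))) \<le> z / (\<beta> * (w z * Y z)) * a z"
      proof -
        have "z / \<beta> * (w z / (a z * X z)) \<le> z / \<beta> * (a z / (w z * Y z))"
        proof (rule mult_left_mono)
          have "w z * (w z * Y z) \<le> a z * (a z * X z)" using L(7)[OF z] by (simp add: power2_eq_square mult.assoc)
          then show "w z / (a z * X z) \<le> a z / (w z * Y z)"
            using L(1,2)[OF z] range[OF z] by (simp add: divide_le_eq pos_le_divide_eq mult_ac)
        qed (use z \<beta> in simp)
        then show ?thesis by (simp add: mult_ac)
      qed
      then have "(z / (\<beta> * (w z * Y z)) * a z - w z * (z / (\<beta> * (a z * X z)))) / (a z * a z) \<ge> 0"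
        by (intro divide_nonneg_nonneg) auto
      with d show "\<exists>D. ((\<lambda>z. w z / a z) has_real_derivative D) (at z) \<and> 0 \<le> D" by blast
    qed
  qed
  \<comment> \<open>The ratio of the forces at the two ends. Since 1 / \<gamma>(-w) = t /
    \<gamma>(a), the ends enter the even part of \<phi> with weights 1 : t.\<close>
  define t where "t z = a z * X z / (w z * Y z)" for z
  have t1: "1 \<le> t z" if z: "0 < z" "z < Z" for z
    using L[OF z] range[OF z] by (simp add: t_def)
  have t_mono: "t x \<le> t y" if xy: "0 < x" "x < y" "y < Z" for x y
  \<comment> \<open>The ratio formula arises by cancelling w - a, which is zero for b = k; there the
    two forces agree and the ratio is 1.\<close>
  proof (cases "b = k")
    case True
    have "t z = 1" if z: "0 < z" "z < Z" for z
    proof -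
      have "a z * X z = w z * Y z" using L(5)[OF z True] True by (simp add: X_def Y_def mult_ac add_ac)
      then show ?thesis using L(2)[OF z] range[OF z] by (simp add: t_def)
    qed
    then show ?thesis using xy by simp
  next
    case False
    then have bk': "b < k" using bk by simp
    have x: "0 < x" "x < Z" and y: "0 < y" "y < Z" using xy by auto
    note rx = level_pair_ratio[OF bk(1) bk' range(1,2)[OF x] range(3,4)[OF x] level[OF x]]
    note ry = level_pair_ratio[OF bk(1) bk' range(1,2)[OF y] range(3,4)[OF y] level[OF y]]
    have e: "w x / a x \<le> w y / a y" by (rule mono(4)[OF xy])
    have e1: "1 \<le> w x / a x" using L(3)[OF x] range[OF x] by simp
    have "inverse (w y / a y) \<le> inverse (w x / a x)" using e e1 by (intro le_imp_inverse_le) auto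
    then have e': "a y / w y \<le> a x / w x" by simp
    have e1': "a x / w x \<le> 1" using L(3)[OF x] range[OF x] by simp
    have d: "0 \<le> w x - a x" "w x - a x \<le> w y - a y" using L(3)[OF x] mono(3)[OF xy] by auto
    have "2*(k-b)*(2 - a x/w x) + 3*(1 - a x/w x)*(w x - a x)
        \<le> 2*(k-b)*(2 - a y/w y) + 3*(1 - a y/w y)*(w y - a y)"
      using bk' e' e1' d by (intro add_mono mult_left_mono mult_mono) auto
    moreover have "2*(k-b)*(2 - w y/a y) - 3*(w y/a y - 1)*(w y - a y)
        \<le> 2*(k-b)*(2 - w x/a x) - 3*(w x/a x - 1)*(w x - a x)"
    proof (rule diff_mono)
      show "2*(k-b)*(2 - w y/a y) \<le> 2*(k-b)*(2 - w x/a x)"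
        using bk' e by (intro mult_left_mono) auto
      show "3*(w x/a x - 1)*(w x - a x) \<le> 3*(w y/a y - 1)*(w y - a y)"
        by (rule mult_mono) (use e e1 d in auto)
    qed
    moreover have "0 \<le> 2*(k-b)*(2 - a x/w x) + 3*(1 - a x/w x)*(w x - a x)"
      using bk' e1' d by (intro add_nonneg_nonneg mult_nonneg_nonneg) auto
    ultimately show ?thesis
      unfolding t_def X_def Y_def rx(2) ry(2) using ry(1) by (intro frac_le; linarith)
  qed
  \<comment> \<open>The weights 1 : t are normalized to 1 - l and l with l = t / (1 + t); from t
    \<ge> 1 it follows that l \<ge> 1/2.\<close>
  define \<rho> where "\<rho> z = (1 - t z / (1 + t z)) * h (a z) + t z / (1 + t z) * h (- w z)" for z
  have \<rho>_mono: "s0 * \<rho> x < s0 * \<rho> y" if xy: "0 < x" "x < y" "y < Z" for x y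
  proof -
    have x: "0 < x" "x < Z" and y: "0 < y" "y < Z" using xy by auto
    show ?thesis unfolding \<rho>_def
    proof (rule h)
      show "1/2 \<le> t x / (1 + t x)" using t1[OF x] by (simp add: field_simps)
      show "t x / (1 + t x) \<le> t y / (1 + t y)" using t1[OF x] t1[OF y] t_mono[OF xy] by (simp add: field_simps)
      show "t y / (1 + t y) < 1" using t1[OF y] by (simp add: field_simps)
    qed (use range[OF x] range[OF y] L[OF x] mono[OF xy] in auto)
  qed
  have \<psi>: "\<exists>C>0. O.\<phi> z + O.\<phi> (-z) = C * (\<alpha>0 + \<alpha>n * \<rho> z)" if z: "0 < z" "z < Z" for z
  proof -
    define C where "C = z / (\<beta> * (a z * X z)) * (1 + t z)"
    have C: "C > 0" using L[OF z] range[OF z] \<beta> z t1[OF z] by (simp add: C_def)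
    have "O.\<phi> z + O.\<phi> (-z) = f (a z) * inverse (\<gamma> (a z)) + f (- w z) * inverse (\<gamma> (- w z))"
      by (simp add: O.\<phi>_def O.F_def O.G_def a_def w_def divide_inverse)
    also have "inverse (\<gamma> (- w z)) = inverse (\<gamma> (a z)) * t z"
      unfolding ga[OF z] gw[OF z] t_def using range[OF z] L[OF z] by simp
    also have "f (a z) * inverse (\<gamma> (a z)) + f (- w z) * (inverse (\<gamma> (a z)) * t z)
        = inverse (\<gamma> (a z)) * (\<alpha>0 * (1 + t z) + \<alpha>n * (h (a z) + t z * h (- w z)))"
      by (simp add: f algebra_simps)
    also have "h (a z) + t z * h (- w z) = (1 + t z) * \<rho> z"
    proof -
      have "(1 + t z) * (1 - t z / (1 + t z)) = 1" "(1 + t z) * (t z / (1 + t z)) = t z"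
        using t1[OF z] by (simp_all add: field_simps)
      then show ?thesis unfolding \<rho>_def by (simp only: distrib_left flip: mult.assoc)
    qed
    also have "inverse (\<gamma> (a z)) * (\<alpha>0 * (1 + t z) + \<alpha>n * ((1 + t z) * \<rho> z)) = C * (\<alpha>0 + \<alpha>n * \<rho> z)"
    proof -
      have "Q * (\<alpha>0 * T + \<alpha>n * (T * r)) = Q * T * (\<alpha>0 + \<alpha>n * r)" for Q T r
        by (simp add: algebra_simps)
      then show ?thesis by (simp only: ga[OF z] C_def)
    qed
    finally show ?thesis using C by blast
  qed
  \<comment> \<open>For \<alpha>n nonzero this makes s (\<alpha>0 + \<alpha>n \<rho>) strictly
    increasing; for \<alpha>n = 0 that expression is the positive constant \<alpha>0^2.\<close>
  define s where "s = (if \<alpha>n = 0 then \<alpha>0 else s0 * \<alpha>n)"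
  show ?thesis
  proof (rule that[of s])
    show "s \<noteq> 0" using \<alpha> s0 by (auto simp: s_def)
  next
    fix x y assume xy: "0 < x" "x < y" "y < Z" and nn: "s * (O.\<phi> x + O.\<phi> (-x)) \<ge> 0"
    have x: "0 < x" "x < Z" and y: "0 < y" "y < Z" using xy by auto
    obtain C D where C: "C > 0" "O.\<phi> x + O.\<phi> (-x) = C * (\<alpha>0 + \<alpha>n * \<rho> x)"
      and D: "D > 0" "O.\<phi> y + O.\<phi> (-y) = D * (\<alpha>0 + \<alpha>n * \<rho> y)"
      using \<psi>[OF x] \<psi>[OF y] by blast
    have "C * (s * (\<alpha>0 + \<alpha>n * \<rho> x)) \<ge> 0" using nn unfolding C(2) by (simp add: mult_ac)
    then have px: "s * (\<alpha>0 + \<alpha>n * \<rho> x) \<ge> 0" using C(1) by (simp add: zero_le_mult_iff)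
    have "s * (\<alpha>0 + \<alpha>n * \<rho> y) > 0"
    proof (cases "\<alpha>n = 0")
      case True
      then have "s * (\<alpha>0 + \<alpha>n * \<rho> y) = \<alpha>0^2" "\<alpha>0 \<noteq> 0" using \<alpha> by (simp_all add: s_def power2_eq_square)
      then show ?thesis by simp
    next
      case False
      have "\<alpha>n^2 * (s0 * \<rho> x) < \<alpha>n^2 * (s0 * \<rho> y)"
        by (rule mult_strict_left_mono[OF \<rho>_mono[OF xy]]) (use False in simp)
      then have "s * (\<alpha>0 + \<alpha>n * \<rho> x) < s * (\<alpha>0 + \<alpha>n * \<rho> y)"
        using False by (simp add: s_def algebra_simps power2_eq_square)
      then show ?thesis using px by simp
    qed
    then have "D * (s * (\<alpha>0 + \<alpha>n * \<rho> y)) > 0" using D(1) by simp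
    then show "s * (O.\<phi> y + O.\<phi> (-y)) > 0" unfolding D(2) by (simp add: mult_ac)
  qed
qed

end

section \<open>Period annuli and the affine normal form\<close>

lemma scaled_solution:
  assumes x: "is_solution f x" and fg: "\<And>p. g (\<sigma> *\<^sub>R (p - c)) = \<sigma> *\<^sub>R f p"
  shows "is_solution g (\<lambda>t. \<sigma> *\<^sub>R (x t - c))"
  unfolding is_solution_def
proof
  fix t
  have "(x has_vector_derivative f (x t)) (at t)" using x by (simp add: is_solution_def)
  then have "((\<lambda>t. \<sigma> *\<^sub>R (x t - c)) has_vector_derivative \<sigma> *\<^sub>R (f (x t) - 0)) (at t)"
    by (intro bounded_linear.has_vector_derivative[OF bounded_linear_scaleR_right]
      has_vector_derivative_diff has_vector_derivative_const)
  then show "((\<lambda>t. \<sigma> *\<^sub>R (x t - c)) has_vector_derivative g (\<sigma> *\<^sub>R (x t - c))) (at t)"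
    by (simp add: fg)
qed

lemma scaled_periodic_orbit:
  assumes L: "periodic_orbit f L" and fg: "\<And>p. g (\<sigma> *\<^sub>R (p - c)) = \<sigma> *\<^sub>R f p" and \<sigma>: "\<sigma> \<noteq> 0"
  shows "periodic_orbit g ((\<lambda>p. \<sigma> *\<^sub>R (p - c)) ` L)"
proof -
  obtain x T where x: "is_solution f x" "T > 0" "\<And>t. x (t + T) = x t" "\<exists>s t. x s \<noteq> x t" "L = range x"
    using L by (auto simp: periodic_orbit_def)
  let ?x = "\<lambda>t. \<sigma> *\<^sub>R (x t - c)"
  have "is_solution g ?x" by (rule scaled_solution[OF x(1) fg])
  moreover have "\<forall>t. ?x (t + T) = ?x t" using x(3) by simp
  moreover have "\<exists>s t. ?x s \<noteq> ?x t" using x(4) \<sigma> by simp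
  moreover have "(\<lambda>p. \<sigma> *\<^sub>R (p - c)) ` L = range ?x" unfolding x(5) by (simp add: image_image)
  ultimately show ?thesis unfolding periodic_orbit_def using x(2) by blast
qed

text \<open>A factor with \<sigma>^2 = 1 is its own inverse, so the inverse of the affine map has
  the same form with center - \<sigma> c, and an isolating neighbourhood is carried over by a
  preimage.\<close>

lemma reflected_limit_cycle:
  fixes \<sigma> :: real
  assumes L: "limit_cycle f L" and fg: "\<And>p. g (\<sigma> *\<^sub>R (p - c)) = \<sigma> *\<^sub>R f p" and \<sigma>: "\<sigma> * \<sigma> = 1"
  shows "limit_cycle g ((\<lambda>p. \<sigma> *\<^sub>R (p - c)) ` L)"
proof -
  let ?B = "\<lambda>p. \<sigma> *\<^sub>R (p - c)"
  let ?A = "\<lambda>p. \<sigma> *\<^sub>R (p - (- \<sigma> *\<^sub>R c))"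
  have AB: "?A (?B p) = p" "?B (?A p) = p" for p using \<sigma> by (simp_all add: algebra_simps)
  have \<sigma>0: "\<sigma> \<noteq> 0" using \<sigma> by auto
  have gf: "f (?A p) = \<sigma> *\<^sub>R g p" for p
  proof -
    have "\<sigma> *\<^sub>R g (?B (?A p)) = (\<sigma> * \<sigma>) *\<^sub>R f (?A p)" by (simp only: fg scaleR_scaleR)
    then show ?thesis by (simp only: AB \<sigma>) simp
  qed
  obtain W where W: "periodic_orbit f L" "open W" "L \<subseteq> W"
    "\<And>L'. \<lbrakk>periodic_orbit f L'; L' \<subseteq> W\<rbrakk> \<Longrightarrow> L' = L"
    using L by (auto simp: limit_cycle_def)
  have "open (?A -` W)" by (rule open_vimage[OF W(2)]) (intro continuous_intros)
  moreover have "?B ` L \<subseteq> ?A -` W"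
  proof
    fix v assume "v \<in> ?B ` L"
    then obtain p where p: "p \<in> L" "v = ?B p" by blast
    have "?A v \<in> W" unfolding p(2) AB using W(3) p(1) by blast
    then show "v \<in> ?A -` W" by simp
  qed
  moreover have "L' = ?B ` L" if L': "periodic_orbit g L'" "L' \<subseteq> ?A -` W" for L'
  proof -
    have "periodic_orbit f (?A ` L')" by (rule scaled_periodic_orbit[OF L'(1) gf \<sigma>0])
    moreover have "?A ` L' \<subseteq> W" using L'(2) by auto
    ultimately have "?A ` L' = L" by (rule W(4))
    then have "?B ` L = ?B ` ?A ` L'" by simp
    also have "\<dots> = L'" by (simp only: image_image AB image_ident)
    finally show ?thesis by simp
  qed
  ultimately show ?thesis
    unfolding limit_cycle_def using scaled_periodic_orbit[OF W(1) fg \<sigma>0] by blast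
qed

context quartic begin

lemma \<zeta>_sq_le:
  assumes "- b \<le> x" "x \<le> 0"
  shows "(\<zeta> x)^2 \<le> Z^2"
proof -
  have "\<zeta> (-b) \<le> \<zeta> x"
  proof (rule DERIV_nonneg_imp_nondecreasing[OF assms(1)])
    fix y assume y: "- b \<le> y" "y \<le> x"
    then have "- b \<le> y" "y \<le> k" using assms bk by auto
    moreover from this have "\<gamma> y \<ge> 0" using q_pos[of y] \<beta> by (simp add: \<gamma>_def)
    ultimately show "\<exists>D. (\<zeta> has_real_derivative D) (at y) \<and> 0 \<le> D" using \<zeta>_deriv by blast
  qed
  then have "- Z \<le> \<zeta> x" by (simp add: \<zeta>_ends)
  moreover have "\<zeta> x \<le> 0" using assms bk q_pos[of x] by (simp add: \<zeta>_def mult_nonpos_nonneg)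
  ultimately have "\<bar>\<zeta> x\<bar> \<le> \<bar>Z\<bar>" by simp
  then show ?thesis by (rule abs_le_square_iff[THEN iffD1])
qed

text \<open>The lower saddle level bounds \<open>annulus_top\<close>, and the vertical lines through both saddles
  cannot be crossed below that level.\<close>
lemma annulus_subset:
  fixes H :: "real \<times> real \<Rightarrow> real" and f0 :: "real \<times> real \<Rightarrow> real \<times> real" and \<sigma> :: real and c :: "real \<times> real"
  defines "x \<equiv> \<lambda>p. fst (\<sigma> *\<^sub>R (p - c))" and "y \<equiv> \<lambda>p. snd (\<sigma> *\<^sub>R (p - c))"
  assumes \<sigma>: "\<sigma> * \<sigma> = 1"
    and H: "\<And>p. H p = H0 + ((y p)^2 + (x p)^2 * q (x p)) / 2"
    and f0: "\<And>p. f0 p = 0 \<longleftrightarrow> y p = 0 \<and> (x p = 0 \<or> x p = - b \<or> x p = k)"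
    and p: "p \<in> annulus H f0 c"
  shows "- b < x p \<and> x p < k \<and> 0 < (\<zeta> (x p))^2 + (y p)^2 \<and> (\<zeta> (x p))^2 + (y p)^2 < Z^2"
proof -
  have xy_c: "x c = 0" "y c = 0" by (simp_all add: x_def y_def)
  have eq_c: "p = c" if "x p = 0" "y p = 0" for p
  proof -
    have "\<sigma> *\<^sub>R (p - c) = 0" using that by (simp add: x_def y_def prod_eq_iff)
    then show ?thesis using \<sigma> by auto
  qed
  have cont: "continuous_on S x" "continuous_on S y" for S
    unfolding x_def y_def by (intro continuous_intros)+
  have contH: "continuous_on UNIV H"
    unfolding H[abs_def] by (intro continuous_intros cont continuous_on_compose2[OF cont_q[of UNIV] cont(1)]) auto
  define hbar where "hbar = H0 + Z^2 / 2"
  have Hc: "H c = H0" by (simp add: H xy_c)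
  have H\<zeta>: "H p = H0 + ((y p)^2 + (\<zeta> (x p))^2) / 2" if "- b \<le> x p" "x p \<le> k" for p
    using that by (simp add: H \<zeta>_sq)
  have barrier: "hbar \<le> H p" if "x p = - b \<or> x p = k" for p
  proof -
    have "Z^2 \<le> (\<zeta> (x p))^2"
      using that \<zeta>_ends Z_pos by (auto intro: power_mono)
    moreover have "- b \<le> x p" "x p \<le> k" using that bk by auto
    then have "H p = H0 + ((y p)^2 + (\<zeta> (x p))^2) / 2" by (rule H\<zeta>)
    moreover have "Z^2 / 2 \<le> ((y p)^2 + (\<zeta> (x p))^2) / 2"
      by (intro divide_right_mono add_increasing calculation(1)) auto
    ultimately show ?thesis by (simp only: hbar_def add_le_cancel_left)
  qed
  let ?C = "\<lambda>h. connected_component_set {p. H p < h} c"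
  \<comment> \<open>The component is connected and contains the center, so its image under
    \<open>x\<close> is an interval around 0; leaving the strip would force a point on one of the
    barrier lines.\<close>
  have inside: "- b < x p \<and> x p < k" if h: "h \<le> hbar" and p: "p \<in> ?C h" for h p
  proof (rule ccontr)
    assume *: "\<not> (- b < x p \<and> x p < k)"
    have Hlt: "H v < h" if "v \<in> ?C h" for v using connected_component_in[of "{p. H p < h}" c v] that by simp
    have "c \<in> ?C h" using p connected_component_in[of "{p. H p < h}" c p] by (simp add: connected_component_refl_eq)
    then have 0: "0 \<in> x ` ?C h" using xy_c by force
    have conn: "connected (x ` ?C h)" by (intro connected_continuous_image cont connected_connected_component)
    have "- b \<in> x ` ?C h \<or> k \<in> x ` ?C h"
    proof (cases "x p \<le> - b")
      case True
      then show ?thesis using conn 0 p bk unfolding connected_iff_interval by (meson imageI less_imp_le neg_le_0_iff_le)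
    next
      case False
      then have "k \<le> x p" using * by simp
      then show ?thesis using conn 0 p bk unfolding connected_iff_interval by (meson imageI less_imp_le order_trans)
    qed
    then obtain v where "v \<in> ?C h" "x v = - b \<or> x v = k" by auto
    then show False using barrier[of v] Hlt[of v] h by simp
  qed
  define T where "T = {h. H c < h \<and> bounded (?C h) \<and> (\<forall>p\<in>closure (?C h). f0 p = 0 \<longrightarrow> p = c)}"
  have top: "annulus_top H f0 c = Sup T" by (simp add: annulus_top_def T_def)
  \<comment> \<open>Above the lower saddle level, the segment from the center to the saddle -b lies
    in the sublevel set. The component then contains a second equilibrium, which membership in
    \<open>T\<close> excludes.\<close>
  have T_le: "h \<le> hbar" if "h \<in> T" for h
  proof (rule ccontr)
    assume h: "\<not> h \<le> hbar"
    define A where "A s = c + \<sigma> *\<^sub>R (s, 0)" for s :: real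
    have xA: "x (A s) = s" "y (A s) = 0" for s
      using \<sigma> by (simp_all add: x_def y_def A_def flip: mult.assoc)
    have "connected (A ` {-b..0})"
      unfolding A_def by (intro connected_continuous_image continuous_intros) auto
    moreover have "A ` {-b..0} \<subseteq> {p. H p < h}"
    proof
      fix v assume "v \<in> A ` {-b..0}"
      then obtain s where s: "s \<in> {-b..0}" and v: "v = A s" by blast
      have "H (A s) = H0 + (\<zeta> s)^2 / 2" using s bk by (simp add: H\<zeta> xA)
      also have "\<dots> \<le> hbar" using \<zeta>_sq_le[of s] s by (simp add: hbar_def)
      finally show "v \<in> {p. H p < h}" using h v by simp
    qed
    moreover have "c \<in> A ` {-b..0}" using bk by (auto simp: A_def image_iff zero_prod_def[symmetric] intro!: bexI[of _ 0])
    ultimately have "A ` {-b..0} \<subseteq> ?C h" by (intro connected_component_maximal)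
    moreover have "A (-b) \<in> A ` {-b..0}" using bk by (intro imageI) simp
    ultimately have "A (-b) \<in> closure (?C h)" using closure_subset by blast
    moreover have "f0 (A (-b)) = 0" by (simp add: f0 xA)
    ultimately have "A (-b) = c" using that by (simp add: T_def)
    then have "x (A (-b)) = x c" by simp
    then show False using bk by (simp add: xA xy_c)
  qed
  \<comment> \<open>The level halfway between center and lower saddle shows that \<open>T\<close> is
    nonempty, without which an upper bound of its elements says nothing about
    \<open>Sup T\<close>.\<close>
  define h1 where "h1 = H0 + Z^2 / 4"
  have h1: "H0 < h1" "h1 < hbar" using Z_pos by (simp_all add: h1_def hbar_def)
  have "h1 \<in> T"
  proof -
    have Hlt: "H v < h1" if "v \<in> ?C h1" for v using connected_component_in[of "{p. H p < h1}" c v] that by simp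
    have sub: "?C h1 \<subseteq> {p. - b \<le> x p \<and> x p \<le> k \<and> H p \<le> h1}"
      using inside[of h1] h1 Hlt by (force simp: less_imp_le)
    have "closed {p. - b \<le> x p \<and> x p \<le> k \<and> H p \<le> h1}"
      by (intro closed_Collect_conj closed_Collect_le continuous_on_const cont contH)
    then have clo: "closure (?C h1) \<subseteq> {p. - b \<le> x p \<and> x p \<le> k \<and> H p \<le> h1}"
      by (intro closure_minimal sub)
    have "bounded (?C h1)"
      unfolding bounded_iff
    proof (intro exI ballI)
      fix v assume v: "v \<in> ?C h1"
      then have xv: "- b \<le> x v" "x v \<le> k" "H v \<le> h1" using sub by auto
      then have "(y v)^2 \<le> Z^2" using Z_pos by (simp add: H\<zeta> h1_def) (smt (verit) zero_le_power2)
      then have "\<bar>y v\<bar> \<le> \<bar>Z\<bar>" by (rule abs_le_square_iff[THEN iffD2])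
      have "v - c = \<sigma> *\<^sub>R (\<sigma> *\<^sub>R (v - c))" using \<sigma> by simp
      then have "norm (v - c) = \<bar>\<sigma>\<bar> * norm (x v, y v)" by (metis norm_scaleR prod.collapse x_def y_def)
      also have "\<bar>\<sigma>\<bar> = 1" using \<sigma> by (metis abs_mult_self_eq abs_one abs_square_eq_1 power2_eq_square abs_abs)
      also have "norm (x v, y v) \<le> \<bar>x v\<bar> + \<bar>y v\<bar>" by (simp add: norm_Pair sqrt_sum_squares_le_sum_abs)
      also have "\<dots> \<le> (b + k) + \<bar>Z\<bar>" using xv \<open>\<bar>y v\<bar> \<le> \<bar>Z\<bar>\<close> bk by auto
      finally show "norm v \<le> norm c + ((b + k) + \<bar>Z\<bar>)" using norm_triangle_sub[of v c] by simp
    qed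
    moreover have "p = c" if "p \<in> closure (?C h1)" "f0 p = 0" for p
    proof -
      have "H p < hbar" using clo that(1) h1 by auto
      then have "x p \<noteq> - b" "x p \<noteq> k" using barrier[of p] by auto
      then show ?thesis using that(2) eq_c f0 by blast
    qed
    ultimately show ?thesis using h1 by (simp add: T_def Hc)
  qed
  then have top_le: "annulus_top H f0 c \<le> hbar" unfolding top by (intro cSup_least T_le) auto
  have pC: "p \<in> ?C (annulus_top H f0 c)" "p \<noteq> c" using p by (auto simp: annulus_def)
  have xp: "- b < x p" "x p < k" using inside[OF top_le pC(1)] by auto
  have "H p < hbar"
    using connected_component_in[of "{p. H p < annulus_top H f0 c}" c p] pC(1) top_le by simp
  then have "(\<zeta> (x p))^2 + (y p)^2 < Z^2" using xp by (simp add: H\<zeta> hbar_def)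
  moreover have "0 < (\<zeta> (x p))^2 + (y p)^2"
  proof -
    have "\<zeta> (x p) \<noteq> 0 \<or> y p \<noteq> 0" using eq_c[of p] pC(2) xp q_pos[of "x p"] by (auto simp: \<zeta>_def)
    then show ?thesis by (simp add: sum_power2_gt_zero_iff)
  qed
  ultimately show ?thesis using xp by blast
qed

text \<open>The map is a translation, composed with the point reflection if \<sigma> = -1.
  Reflecting both coordinates preserves the equation u' = y and the direction of time, so the
  perturbation keeps the factor e > 0.\<close>

theorem at_most_one_limit_cycle:
  fixes \<sigma> :: real and c :: "real \<times> real" and W :: "real \<Rightarrow> real \<times> real \<Rightarrow> real \<times> real"
  assumes f': "\<And>u. (f has_real_derivative df u) (at u)" and df: "continuous_on UNIV df"
    and f: "\<And>u. f u = \<alpha>0 + \<alpha>n * h u" and s0: "s0 \<noteq> 0"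
    and h: "\<And>a1 a2 w1 w2 l1 l2. \<lbrakk>0 < a1; a1 < a2; a2 < k; w1 < w2; w2 < b; a1 \<le> w1; b < k \<Longrightarrow> a1 < w1;
        w1 - a1 \<le> w2 - a2; 1/2 \<le> l1; l1 \<le> l2; l2 < 1\<rbrakk> \<Longrightarrow>
        s0 * ((1 - l1) * h a1 + l1 * h (- w1)) < s0 * ((1 - l2) * h a2 + l2 * h (- w2))"
    and \<sigma>: "\<sigma> * \<sigma> = 1"
    and W: "\<And>e p x y. (x, y) = \<sigma> *\<^sub>R (p - c) \<Longrightarrow>
        \<sigma> *\<^sub>R W e p = (y, e * f x * y - \<beta> * x * (x + b) * (k - x))"
    and H: "\<And>p x y. (x, y) = \<sigma> *\<^sub>R (p - c) \<Longrightarrow> H p = H0 + (y^2 + x^2 * q x) / 2"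
  shows "at_most_one_lc_from W (annulus H (W 0) c)"
  unfolding at_most_one_lc_from_def
proof (intro allI impI, elim conjE)
  fix K assume K: "compact K" "K \<subseteq> annulus H (W 0) c"
  interpret O: oscillator "-b" k Z \<zeta> \<gamma> d\<gamma> f df "\<lambda>x. \<beta> * x * (x + b) * (k - x)"
    by (rule oscillator_quartic[OF f' df])
  let ?B = "\<lambda>p. \<sigma> *\<^sub>R (p - c)"
  have \<sigma>0: "\<sigma> \<noteq> 0" using \<sigma> by auto
  have fld: "O.field e (?B p) = \<sigma> *\<^sub>R W e p" for e p
    using W[of "fst (?B p)" "snd (?B p)" p e] by (simp only: O.field_def prod.collapse)
  have zero: "W 0 p = 0 \<longleftrightarrow> snd (?B p) = 0 \<and> (fst (?B p) = 0 \<or> fst (?B p) = - b \<or> fst (?B p) = k)" for p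
  proof -
    have "W 0 p = 0 \<longleftrightarrow> \<sigma> *\<^sub>R W 0 p = 0" using \<sigma>0 by simp
    also have "\<dots> \<longleftrightarrow> snd (?B p) = 0 \<and> (fst (?B p) = 0 \<or> fst (?B p) + b = 0 \<or> k - fst (?B p) = 0)"
      unfolding fld[symmetric] O.field_def using \<beta> by (simp add: prod_eq_iff)
    finally show ?thesis by (simp add: eq_neg_iff_add_eq_0) (metis eq_iff_diff_eq_0)
  qed
  have Heq: "H p = H0 + ((snd (?B p))^2 + (fst (?B p))^2 * q (fst (?B p))) / 2" for p
    by (rule H) (rule prod.collapse)
  have dom: "- b < fst v \<and> fst v < k" and
    rng: "0 < (\<zeta> (fst v))^2 + (snd v)^2 \<and> (\<zeta> (fst v))^2 + (snd v)^2 < Z^2" if v: "v \<in> ?B ` K" for v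
  proof -
    obtain p where p: "p \<in> annulus H (W 0) c" "v = ?B p" using v K(2) by blast
    from annulus_subset[OF \<sigma> Heq zero p(1)] p(2)
    show "- b < fst v \<and> fst v < k"
      "0 < (\<zeta> (fst v))^2 + (snd v)^2 \<and> (\<zeta> (fst v))^2 + (snd v)^2 < Z^2" by simp_all
  qed
  have cK: "compact (?B ` K)" by (intro compact_continuous_image K(1) continuous_intros)
  show "\<exists>\<epsilon>0>0. \<forall>\<epsilon>. 0 < \<epsilon> \<and> \<epsilon> < \<epsilon>0 \<longrightarrow>
      (\<forall>L1 L2. limit_cycle (W \<epsilon>) L1 \<and> L1 \<subseteq> K \<and> limit_cycle (W \<epsilon>) L2 \<and> L2 \<subseteq> K \<longrightarrow> L1 = L2)"
  proof (cases "\<alpha>0 = 0 \<and> \<alpha>n = 0")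
    case True
    have "False" if "limit_cycle (W \<epsilon>) L" "L \<subseteq> K" "\<epsilon> > 0" for \<epsilon> L
    proof (rule O.not_limit_cycle)
      show "limit_cycle (O.field \<epsilon>) (?B ` L)" by (rule reflected_limit_cycle[OF that(1) fld \<sigma>])
      show "f u = 0" for u using True by (simp add: f)
      fix v assume "v \<in> ?B ` L"
      then have "v \<in> ?B ` K" using that(2) by blast
      then show "- b < fst v \<and> fst v < k"
        "0 < (\<zeta> (fst v))^2 + (snd v)^2 \<and> (\<zeta> (fst v))^2 + (snd v)^2 < Z^2" using dom rng by blast+
    qed (use that in simp)
    then show ?thesis by (intro exI[of _ 1]) auto
  next
    case False
    then have \<alpha>: "\<alpha>0 \<noteq> 0 \<or> \<alpha>n \<noteq> 0" by blast
    obtain s where s: "s \<noteq> 0" "\<And>x y. \<lbrakk>0 < x; x < y; y < Z; s * (O.\<phi> x + O.\<phi> (-x)) \<ge> 0\<rbrakk> \<Longrightarrow>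
        s * (O.\<phi> y + O.\<phi> (-y)) > 0"
      using sign_condition[OF f' df f \<alpha> s0 h] by blast
    obtain e0 where e0: "e0 > 0"
      "\<And>e L1 L2. \<lbrakk>0 < e; e < e0; periodic_orbit (O.field e) L1; L1 \<subseteq> ?B ` K;
         periodic_orbit (O.field e) L2; L2 \<subseteq> ?B ` K\<rbrakk> \<Longrightarrow> L1 = L2"
      by (rule O.unique_periodic_orbit[OF cK _ _ s(1)], erule dom, erule rng, erule (3) s(2), blast)
    have inj: "inj ?B" using \<sigma>0 by (intro injI) simp
    have "L1 = L2" if e: "0 < e" "e < e0" and L1: "limit_cycle (W e) L1" "L1 \<subseteq> K"
      and L2: "limit_cycle (W e) L2" "L2 \<subseteq> K" for e L1 L2
    proof -
      have "periodic_orbit (O.field e) (?B ` L)" if "limit_cycle (W e) L" for L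
      proof (rule scaled_periodic_orbit[where f = "W e"])
        show "periodic_orbit (W e) L" using that by (simp only: limit_cycle_def)
        show "O.field e (?B p) = \<sigma> *\<^sub>R W e p" for p by (rule fld)
      qed (rule \<sigma>0)
      then have "periodic_orbit (O.field e) (?B ` L1)" "periodic_orbit (O.field e) (?B ` L2)"
        using L1(1) L2(1) by blast+
      then have "?B ` L1 = ?B ` L2" using L1(2) L2(2) by (intro e0(2)[OF e]) auto
      then show "L1 = L2" by (simp only: inj_image_eq_iff[OF inj])
    qed
    then show ?thesis using e0(1) by blast
  qed
qed

text \<open>For even n both ends contribute with the same sign. For odd n the mean is (1 - l) a^n -
  l w^n, which decreases strictly when a < w, and this strict inequality comes from b < k.\<close>

lemma at_most_one_limit_cycle_power:
  fixes \<sigma> :: real and c :: "real \<times> real"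
  assumes n: "n \<ge> 2" and eo: "even n \<or> b < k"
    and \<sigma>: "\<sigma> * \<sigma> = 1"
    and W: "\<And>e p x y. (x, y) = \<sigma> *\<^sub>R (p - c) \<Longrightarrow>
        \<sigma> *\<^sub>R W e p = (y, e * (\<alpha>0 + \<alpha>n * x^n) * y - \<beta> * x * (x + b) * (k - x))"
    and H: "\<And>p x y. (x, y) = \<sigma> *\<^sub>R (p - c) \<Longrightarrow> H p = H0 + (y^2 + x^2 * q x) / 2"
  shows "at_most_one_lc_from W (annulus H (W 0) c)"
proof (rule at_most_one_limit_cycle[OF _ _ refl _ _ \<sigma> W H])
  show "((\<lambda>x. \<alpha>0 + \<alpha>n * x^n) has_real_derivative \<alpha>n * (real n * u^(n - 1))) (at u)" for u
    by (auto intro!: derivative_eq_intros)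
  show "continuous_on UNIV (\<lambda>u. \<alpha>n * (real n * u^(n - 1)))" by (intro continuous_intros)
  show "(if even n then 1 else -1 :: real) \<noteq> 0" by simp
  fix a1 a2 w1 w2 l1 l2 :: real
  assume *: "0 < a1" "a1 < a2" "a2 < k" "w1 < w2" "w2 < b" "a1 \<le> w1" "b < k \<Longrightarrow> a1 < w1"
    "w1 - a1 \<le> w2 - a2" "1/2 \<le> l1" "l1 \<le> l2" "l2 < 1"
  show "(if even n then 1 else -1 :: real) * ((1 - l1) * a1^n + l1 * (- w1)^n)
      < (if even n then 1 else -1) * ((1 - l2) * a2^n + l2 * (- w2)^n)"
  proof (cases "even n")
    case True
    with weighted_power_mean_less[OF *(1,2,6,4,9,10,11) n] show ?thesis by simp
  next
    case False
    then have "a1 < w1" using eo *(7) by blast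
    with weighted_power_difference_less[OF *(1,2) this *(8,9,10) n] False show ?thesis by simp
  qed
qed

text \<open>Serves the center at u_0: the substitution u = u_0 - x turns u^n into a power of u_0 -
  x, and u_0 is the right saddle \<open>k\<close> of the normal form.\<close>

lemma at_most_one_limit_cycle_shifted_power:
  fixes \<sigma> :: real and c :: "real \<times> real"
  assumes n: "n \<ge> 2" and \<sigma>: "\<sigma> * \<sigma> = 1"
    and W: "\<And>e p x y. (x, y) = \<sigma> *\<^sub>R (p - c) \<Longrightarrow>
        \<sigma> *\<^sub>R W e p = (y, e * (\<alpha>0 + \<alpha>n * (k - x)^n) * y - \<beta> * x * (x + b) * (k - x))"
    and H: "\<And>p x y. (x, y) = \<sigma> *\<^sub>R (p - c) \<Longrightarrow> H p = H0 + (y^2 + x^2 * q x) / 2"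
  shows "at_most_one_lc_from W (annulus H (W 0) c)"
proof (rule at_most_one_limit_cycle[OF _ _ refl _ _ \<sigma> W H])
  show "((\<lambda>x. \<alpha>0 + \<alpha>n * (k - x)^n) has_real_derivative \<alpha>n * (- (real n * (k - u)^(n - 1)))) (at u)" for u
    by (auto intro!: derivative_eq_intros)
  show "continuous_on UNIV (\<lambda>u. \<alpha>n * (- (real n * (k - u)^(n - 1))))" by (intro continuous_intros)
  show "(1 :: real) \<noteq> 0" by simp
  fix a1 a2 w1 w2 l1 l2 :: real
  assume *: "0 < a1" "a1 < a2" "a2 < k" "w1 < w2" "w2 < b" "a1 \<le> w1" "b < k \<Longrightarrow> a1 < w1"
    "w1 - a1 \<le> w2 - a2" "1/2 \<le> l1" "l1 \<le> l2" "l2 < 1"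
  have "0 < w1" using * by simp
  from weighted_shifted_power_less[OF *(1,2,3) this *(8,9,10) n]
  show "1 * ((1 - l1) * (k - a1)^n + l1 * (k - - w1)^n) < 1 * ((1 - l2) * (k - a2)^n + l2 * (k - - w2)^n)"
    by simp
qed

end

section \<open>Reduction of the four cases to the normal form\<close>

theorem theorem3p1:
  fixes n :: nat and D \<beta>t \<alpha>0 \<alpha>n u0 k :: real
  assumes "n \<ge> 2" and "D > 0" and "\<beta>t > 0"
  shows "(0 < u0 \<and> u0 < k \<and> k \<le> 2 * u0
            \<longrightarrow> at_most_one_periodic_wave n \<alpha>0 \<alpha>n (\<beta>t / D) u0 k (u0, 0))
       \<and> (- k < u0 \<and> u0 < 0
            \<longrightarrow> at_most_one_periodic_wave n \<alpha>0 \<alpha>n (\<beta>t / D) u0 k (0, 0))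
       \<and> (k > 0 \<and> u0 < - k
            \<longrightarrow> at_most_one_periodic_wave n \<alpha>0 \<alpha>n (\<beta>t / D) u0 k (0, 0))
       \<and> (k > 0 \<and> u0 = - k \<and> even n
            \<longrightarrow> at_most_one_periodic_wave n \<alpha>0 \<alpha>n (\<beta>t / D) u0 k (0, 0))"
proof -
  define \<beta> where "\<beta> = \<beta>t / D"
  have \<beta>: "\<beta> > 0" using assms by (simp add: \<beta>_def)
  have i: "at_most_one_periodic_wave n \<alpha>0 \<alpha>n \<beta> u0 k (u0, 0)" if c: "0 < u0" "u0 < k" "k \<le> 2 * u0"
  proof -
    \<comment> \<open>With x = u_0 - u the saddle u = k goes to u_0 - k and the saddle u = 0 to u_0;
      the locale condition on the two distances is k \<le> 2 u_0.\<close>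
    interpret quartic \<beta> "k - u0" u0 by unfold_locales (use \<beta> c in auto)
    show ?thesis
      unfolding at_most_one_periodic_wave_def
    proof (rule at_most_one_limit_cycle_shifted_power[OF assms(1), of "-1"])
      fix e x y :: real and p :: "real \<times> real" assume "(x, y) = (-1) *\<^sub>R (p - (u0, 0))"
      then have p: "p = (u0 - x, - y)" by (simp add: prod_eq_iff)
      show "(-1) *\<^sub>R vf n \<alpha>0 \<alpha>n \<beta> u0 k e p =
          (y, e * (\<alpha>0 + \<alpha>n * (u0 - x)^n) * y - \<beta> * x * (x + (k - u0)) * (u0 - x))"
        by (simp add: vf_def p algebra_simps)
      show "Ham \<beta> u0 k p = Ham \<beta> u0 k (u0, 0) + (y^2 + x^2 * q x) / 2"
        by (simp add: Ham_def q_def p field_simps power2_eq_square power3_eq_cube power4_eq_xxxx)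
    qed simp
  qed
  have pos: "at_most_one_periodic_wave n \<alpha>0 \<alpha>n \<beta> u0 k (0, 0)" if c: "- k \<le> u0" "u0 < 0" "even n \<or> - k < u0"
  proof -
    interpret quartic \<beta> "- u0" k by unfold_locales (use \<beta> c in auto)
    show ?thesis
      unfolding at_most_one_periodic_wave_def
    proof (rule at_most_one_limit_cycle_power[OF assms(1), of 1])
      fix e x y :: real and p :: "real \<times> real" assume "(x, y) = 1 *\<^sub>R (p - (0, 0))"
      then have p: "p = (x, y)" by (simp add: prod_eq_iff)
      show "1 *\<^sub>R vf n \<alpha>0 \<alpha>n \<beta> u0 k e p =
          (y, e * (\<alpha>0 + \<alpha>n * x^n) * y - \<beta> * x * (x + (- u0)) * (k - x))"
        by (simp add: vf_def p)
      show "Ham \<beta> u0 k p = 0 + (y^2 + x^2 * q x) / 2"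
        by (simp add: Ham_def q_def p field_simps power2_eq_square power3_eq_cube power4_eq_xxxx)
    qed (use c in auto)
  qed
  have neg: "at_most_one_periodic_wave n \<alpha>0 \<alpha>n \<beta> u0 k (0, 0)" if c: "k > 0" "u0 < - k"
  proof -
    \<comment> \<open>Now k is the nearer saddle, so x = - u moves it to the left; the sign (-1)^n
      of the power is absorbed into \<alpha>n.\<close>
    interpret quartic \<beta> k "- u0" by unfold_locales (use \<beta> c in auto)
    show ?thesis
      unfolding at_most_one_periodic_wave_def
    proof (rule at_most_one_limit_cycle_power[OF assms(1), of "-1"])
      fix e x y :: real and p :: "real \<times> real" assume "(x, y) = (-1) *\<^sub>R (p - (0, 0))"
      then have p: "p = (- x, - y)" by (simp add: prod_eq_iff)
      show "(-1) *\<^sub>R vf n \<alpha>0 \<alpha>n \<beta> u0 k e p =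
          (y, e * (\<alpha>0 + (\<alpha>n * (-1)^n) * x^n) * y - \<beta> * x * (x + k) * (- u0 - x))"
        by (simp add: vf_def p power_minus[of x] algebra_simps)
      show "Ham \<beta> u0 k p = 0 + (y^2 + x^2 * q x) / 2"
        by (simp add: Ham_def q_def p field_simps power2_eq_square power3_eq_cube power4_eq_xxxx)
    qed (use c in auto)
  qed
  show ?thesis unfolding \<beta>_def[symmetric] using i pos neg by auto
qed

end
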